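(* Let $R$ be an integral domain and let $*$ be a modular star operation on $R$ of finite type. The following are equivalent. (1) $R$ is a $*$-SP-domain, i.e. every $*$-ideal of $R$ is a finite $*$-product of radical $*$-ideals of $R$. (2) $\dim_*(R)\leq 1$ and every $*$-invertible $*$-ideal of $R$ is a finite $*$-product of radical $*$-ideals of $R$. (3) Each nonzero prime $*$-ideal is $*$-maximal and contains a $*$-invertible radical $*$-ideal. (4) Each $*$-ideal is a $*$-product of radical $*$-ideals $J_1\subseteq\cdots\subseteq J_n$; and for nonzero $*$-ideals these are unique when required to be proper (with $R$ the empty $*$-product). (5) The radical of each nonzero $*$-finitely generated $*$-ideal is $*$-invertible. (6) The $C$-lattice $\mathcal{I}_*(R)$ is isomorphic, as a multiplicative lattice, to $U_b( *\text{-}\max^{-1}(R))$. (7) $R$ is a P$*$MD for which the radical of each $*$-finitely generated $*$-ideal is $*$-finitely generated.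
   Context: A star operation on $R$ here is a map $*:\mathbb{P}(R)\to\mathbb{P}(R)$, $X\mapsto X_*$, on the power set of $R$ such that for all $X,Y\subseteq R$, $c\in R$: (A) $XR\cup\{0\}\subseteq X_*$, where $XR=\{xa\mid x\in X,a\in R\}$; (B) $X\subseteq Y_*$ implies $X_*\subseteq Y_*$; (C) $cX_*=(cX)_*$; and every $*$-ideal (a subset $X$ with $X_*=X$) is a ring ideal of $R$. (The set of $*$-ideals is the same as for a classical star operation, restricted to integral ideals, together with $(0)$.) It is of finite type if $X_*=\bigcup_{E\subseteq X,|E|<\infty}E_*$ for all $X$, and modular if $(I\cup J)_*\cap N\subseteq(I\cup(J\cap N))_*$ for all $*$-ideals $I,J,N$ with $I\subseteq N$. The $*$-product of $*$-ideals $I,J$ is $(IJ)_*$ (and similarly for finitely many). A $*$-ideal $I$ is $*$-invertible if $(IJ)_*=yR$ for some $J\subseteq R$ and some nonzero $y\in R$; $*$-finitely generated if $I=E_*$ for some finite $E\subseteq I$; $*$-maximal if it is maximal among proper $*$-ideals. $R$ is a P$*$MD if every nonzero $*$-finitely generated $*$-ideal is $*$-invertible. $\mathcal{I}_*(R)$ is the multiplicative lattice of $*$-ideals, ordered by inclusion with multiplication $(I,J)\mapsto(IJ)_*$. (A $C$-lattice is a multiplicative lattice in which the compact elements contain the top element, are closed under products, and generate every element by joins.) $\dim_*(R)$ is $n-1$, where $n$ is the number of members of the longest chain of prime $*$-ideals (including $(0)$). $*\text{-}\max^{-1}(R)$ is the set of all $*$-maximal $*$-ideals with the inverse topology, having as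 basis of open sets the sets $\{M\mid I\subseteq M\}$ with $I$ a $*$-finitely generated $*$-ideal; it is Hausdorff. An isomorphism of multiplicative lattices is an order isomorphism that is also a monoid isomorphism. For a Hausdorff space $X$, $U(X)$ is the monoid, under pointwise addition, of functions $f:X\to\mathbb{N}_0$ such that $f^{-1}([k,\infty))$ is compact for all $k\geq 1$ (the compactly supported upper semicontinuous functions), ordered by $f\leq_d g$ iff $f(x)\geq g(x)$ for all $x\in X$. $U_b(X)=U(X)\cup\{b\}$, where $b:X\to\mathbb{N}_0\cup\{\infty\}$, $b(x)=\infty$ for all $x\in X$, is appended as bottom element, with $b+f=f+b=b$ for all $f$. The monoid operation of $U_b(X)$ as a multiplicative lattice is $+$ and its top element is the zero function.
   Formalization: Condition (6) is claimed equivalent to the others only when R is not a field: for a field, (1) holds, but (0) is the only *-maximal *-ideal, so U_b is infinite while there are just two *-ideals. *)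

theory Defs
  imports
    "HOL-Analysis.Abstract_Topology"
    "HOL-Library.Set_Algebras"
    "HOL-Library.Extended_Nat"
    "HOL-Algebra.Group"
begin

text \<open>
  The ring \<open>R\<close> is a type of class \<^class>\<open>idom\<close>, so \<open>R\<close> as a set is \<^term>\<open>UNIV\<close>.
  Products of subsets are the elementwise ones of \<^theory>\<open>HOL-Library.Set_Algebras\<close>, for which
  the subsets of \<open>R\<close> form a commutative monoid with unit \<open>{1}\<close>; \<^term>\<open>c *o X\<close> is \<open>cX\<close>.
\<close>

text \<open>Ideals are the submodules of the ring regarded as a module over itself.\<close>

definition ring_ideal :: "'a::comm_ring_1 set \<Rightarrow> bool" where
  "ring_ideal I \<longleftrightarrow> module.subspace times I"

lemma ring_ideal_iff:
  "ring_ideal I \<longleftrightarrow>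
     0 \<in> I \<and> (\<forall>x\<in>I. \<forall>y\<in>I. x + y \<in> I) \<and> (\<forall>c. \<forall>x\<in>I. c * x \<in> I)"
proof -
  interpret module "times :: 'a \<Rightarrow> 'a \<Rightarrow> 'a"
    by unfold_locales (simp_all add: algebra_simps)
  show ?thesis
    by (simp add: ring_ideal_def subspace_def)
qed

definition prime_ideal :: "'a::comm_ring_1 set \<Rightarrow> bool" where
  "prime_ideal P \<longleftrightarrow>
     ring_ideal P \<and> P \<noteq> UNIV \<and> (\<forall>a b. a * b \<in> P \<longrightarrow> a \<in> P \<or> b \<in> P)"

definition ideal_radical :: "'a::comm_ring_1 set \<Rightarrow> 'a set" where
  "ideal_radical I = {a. \<exists>n>0. a ^ n \<in> I}"

definition star_operation :: "('a::idom set \<Rightarrow> 'a set) \<Rightarrow> bool" where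
  "star_operation star \<longleftrightarrow>
     (\<forall>X. X * UNIV \<union> {0} \<subseteq> star X) \<and>
     (\<forall>X Y. X \<subseteq> star Y \<longrightarrow> star X \<subseteq> star Y) \<and>
     (\<forall>c X. c *o star X = star (c *o X)) \<and>
     (\<forall>X. star X = X \<longrightarrow> ring_ideal X)"

definition star_ideal :: "('a::idom set \<Rightarrow> 'a set) \<Rightarrow> 'a set \<Rightarrow> bool" where
  "star_ideal star I \<longleftrightarrow> star I = I"

definition star_finite_type :: "('a::idom set \<Rightarrow> 'a set) \<Rightarrow> bool" where
  "star_finite_type star \<longleftrightarrow> (\<forall>X. star X = (\<Union>E\<in>{E. E \<subseteq> X \<and> finite E}. star E))"

definition star_modular :: "('a::idom set \<Rightarrow> 'a set) \<Rightarrow> bool" where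
  "star_modular star \<longleftrightarrow>
     (\<forall>I J N. star_ideal star I \<and> star_ideal star J \<and> star_ideal star N \<and> I \<subseteq> N \<longrightarrow>
        star (I \<union> J) \<inter> N \<subseteq> star (I \<union> (J \<inter> N)))"

text \<open>The empty product is \<open>star {1}\<close>, which is \<open>R\<close> for a star operation.\<close>

definition star_prod_list :: "('a::idom set \<Rightarrow> 'a set) \<Rightarrow> 'a set list \<Rightarrow> 'a set" where
  "star_prod_list star Is = star (prod_list Is)"

definition star_invertible :: "('a::idom set \<Rightarrow> 'a set) \<Rightarrow> 'a set \<Rightarrow> bool" where
  "star_invertible star I \<longleftrightarrow>
     star_ideal star I \<and> (\<exists>J y. y \<noteq> 0 \<and> star (I * J) = y *o UNIV)"

definition star_fin_gen :: "('a::idom set \<Rightarrow> 'a set) \<Rightarrow> 'a set \<Rightarrow> bool" where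
  "star_fin_gen star I \<longleftrightarrow> star_ideal star I \<and> (\<exists>E\<subseteq>I. finite E \<and> I = star E)"

definition star_maximal :: "('a::idom set \<Rightarrow> 'a set) \<Rightarrow> 'a set \<Rightarrow> bool" where
  "star_maximal star M \<longleftrightarrow>
     star_ideal star M \<and> M \<noteq> UNIV \<and>
     (\<forall>N. star_ideal star N \<and> N \<noteq> UNIV \<and> M \<subseteq> N \<longrightarrow> N = M)"

definition star_prime :: "('a::idom set \<Rightarrow> 'a set) \<Rightarrow> 'a set \<Rightarrow> bool" where
  "star_prime star P \<longleftrightarrow> star_ideal star P \<and> prime_ideal P"

definition star_radical_ideal :: "('a::idom set \<Rightarrow> 'a set) \<Rightarrow> 'a set \<Rightarrow> bool" where
  "star_radical_ideal star J \<longleftrightarrow> star_ideal star J \<and> ideal_radical J = J"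

definition star_radical_product :: "('a::idom set \<Rightarrow> 'a set) \<Rightarrow> 'a set \<Rightarrow> bool" where
  "star_radical_product star I \<longleftrightarrow>
     (\<exists>Js. (\<forall>J\<in>set Js. star_radical_ideal star J) \<and> I = star_prod_list star Js)"

definition star_SP_domain :: "('a::idom set \<Rightarrow> 'a set) \<Rightarrow> bool" where
  "star_SP_domain star \<longleftrightarrow> (\<forall>I. star_ideal star I \<longrightarrow> star_radical_product star I)"

definition PstarMD :: "('a::idom set \<Rightarrow> 'a set) \<Rightarrow> bool" where
  "PstarMD star \<longleftrightarrow> (\<forall>I. star_fin_gen star I \<and> I \<noteq> {0} \<longrightarrow> star_invertible star I)"

text \<open>The value is \<^term>\<open>\<infinity>::enat\<close> if there are arbitrarily long finite chains.\<close>

definition star_dim :: "('a::idom set \<Rightarrow> 'a set) \<Rightarrow> enat" where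
  "star_dim star =
     (SUP C\<in>{C. finite C \<and> subset.chain {P. star_prime star P} C}. enat (card C)) - 1"

text \<open>
  The generating sets are closed under finite intersections, since
  \<open>star (I \<union> J)\<close> is finitely generated when \<open>I\<close> and \<open>J\<close> are; so they form a basis.
  \<open>I = {0}\<close> gives the whole space.
\<close>

definition star_max_inverse :: "('a::idom set \<Rightarrow> 'a set) \<Rightarrow> 'a set topology" where
  "star_max_inverse star =
     topology_generated_by {{M. star_maximal star M \<and> I \<subseteq> M} |I. star_fin_gen star I}"

record 'a mult_lattice = "'a monoid" +
  mle :: "'a \<Rightarrow> 'a \<Rightarrow> bool"

definition mult_lattice_iso ::
    "('a, 'c) mult_lattice_scheme \<Rightarrow> ('b, 'd) mult_lattice_scheme \<Rightarrow> ('a \<Rightarrow> 'b) set" where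
  "mult_lattice_iso L M =
     {\<phi> \<in> iso L M. \<phi> \<one>\<^bsub>L\<^esub> = \<one>\<^bsub>M\<^esub> \<and>
        (\<forall>x\<in>carrier L. \<forall>y\<in>carrier L. mle L x y \<longleftrightarrow> mle M (\<phi> x) (\<phi> y))}"

definition star_ideal_lattice :: "('a::idom set \<Rightarrow> 'a set) \<Rightarrow> 'a set mult_lattice" where
  "star_ideal_lattice star =
     \<lparr>carrier = {I. star_ideal star I}, mult = (\<lambda>I J. star (I * J)), one = UNIV, mle = (\<subseteq>)\<rparr>"

text \<open>
  Functions on a space \<open>X\<close> are represented by functions on the underlying type that vanish
  outside \<^term>\<open>topspace X\<close>.
\<close>

definition usc_compact :: "'b topology \<Rightarrow> ('b \<Rightarrow> nat) set" where
  "usc_compact X =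
     {f. (\<forall>x. x \<notin> topspace X \<longrightarrow> f x = 0) \<and>
         (\<forall>k\<ge>1. compactin X {x \<in> topspace X. k \<le> f x})}"

definition usc_bottom :: "'b topology \<Rightarrow> 'b \<Rightarrow> enat" where
  "usc_bottom X = (\<lambda>x. if x \<in> topspace X then \<infinity> else 0)"

text \<open>
  The order is reversed: \<open>f\<close> is below \<open>g\<close> iff \<open>f \<ge> g\<close> pointwise. Since
  \<^prop>\<open>\<infinity> + (n::enat) = \<infinity>\<close>, pointwise addition makes \<^term>\<open>usc_bottom X\<close> absorbing.

  If \<open>R\<close> is a field, then \<open>{0}\<close> is its only maximal star ideal, so this lattice over
  \<^term>\<open>star_max_inverse star\<close> is infinite although there are just two star ideals, all of them
  radical. Hence the isomorphism with it can characterize SP-domains only for non-fields.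
\<close>

definition usc_lattice :: "'b topology \<Rightarrow> ('b \<Rightarrow> enat) mult_lattice" where
  "usc_lattice X =
     \<lparr>carrier = insert (usc_bottom X) ((\<lambda>f x. enat (f x)) ` usc_compact X),
      mult = (\<lambda>f g x. f x + g x),
      one = (\<lambda>x. 0),
      mle = (\<lambda>f g. \<forall>x\<in>topspace X. g x \<le> f x)\<rparr>"

end

(*
  If (1) holds, a chain 0 < P < M of prime *-ideals is impossible: localize the closure operation at a prime Q minimal over P + (y0), so that Q is the
  largest proper ideal and Q = P + (y) for some y. Let J = (j) be radical and contained in P, and let
  C = (J : y), modulo which y is cancellable. Then C + (y^2) has exactly two proper radical factors, both equal
  to C + (y), and modularity yields C = C(C + (y)) and hence j in C^2 or j in yC; the first
  puts y into J, and in the second case C is principal and can be cancelled. Under (5) a chain is excluded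
  directly: with J = rad(x), K = rad(x, y), J = KC and L = rad(K + C), the ideal J is divisible by L^2,
  and since J is radical this forces L = R.

  Conversely, (3) makes every nonzero *-maximal ideal M locally principal with a discrete valuation,
  and nonzero *-ideals are determined by their values. Sums, intersections and products correspond
  to minima, maxima and sums of values, so that the invertible *-ideals are closed under sums and
  intersections because (I + J)(I Int J) = IJ. By Zorn, if every prime *-ideal over I contains a member of a
  family of finitely generated *-ideals, then I contains a finite product of members. Hence there is an
  invertible radical ideal J with J^n <= I; then rad I = I + J, and the radical can be split off I
  repeatedly. The same Zorn argument shows that hulls are compact in the inverse topology.
*)
theory Submission
  imports Defs
begin

section \<open>Finitary closure operations on a domain\<close>

text \<open>An element of \<open>cl (X \<union> Y)\<close> need not be a sum of elements of
  \<open>cl X\<close> and \<open>cl Y\<close>, so computations modulo an ideal and Nakayama's lemma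
  are not directly available. The modular law is the substitute: an element of
  \<open>cl (A \<union> B)\<close> that lies in a closed ideal \<open>N\<close> containing
  \<open>A\<close> is already in the closure of \<open>A\<close> and \<open>cl B \<inter> N\<close>.
  Its main use is with \<open>N\<close> the closure of a single element \<open>c\<close>, where
  intersecting with \<open>N\<close> becomes multiplying a residual by \<open>c\<close>; this
  permits cancellation modulo an ideal. The second obstacle is that localization destroys axiom (C):
  only the cancellation of nonzero factors survives. The general theory therefore rests on
  cancellation alone, and serves the given operation and its localizations alike; invertibility is
  treated only where the full axiom holds.\<close>

lemma ring_idealD:
  assumes "ring_ideal I"
  shows "0 \<in> I" "x \<in> I \<Longrightarrow> y \<in> I \<Longrightarrow> x + y \<in> I" "x \<in> I \<Longrightarrow> c * x \<in> I" "x \<in> I \<Longrightarrow> x * c \<in> I"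
  using assms by (auto simp: ring_ideal_iff mult.commute[of x])

lemma scale_eq_times: "c *o X = {c} * X"
  by (auto simp: elt_set_times_def set_times_def)

text \<open>After localization at \<open>Q\<close> the closure of \<open>{c}\<close> is
  \<open>cR_Q \<inter> R\<close>, usually larger than \<open>cR\<close>. Hence
  \<open>cl_cancel\<close> takes the place of axiom (C); \<open>cl_finitary\<close> is finite
  type.\<close>

locale ideal_closure =
  fixes cl :: "'a::idom set \<Rightarrow> 'a set"
  assumes subset_cl: "X \<subseteq> cl X"
    and cl_least: "X \<subseteq> cl Y \<Longrightarrow> cl X \<subseteq> cl Y"
    and ring_ideal_cl: "ring_ideal (cl X)"
    and cl_cancel: "c \<noteq> 0 \<Longrightarrow> c * x \<in> cl (c *o X) \<longleftrightarrow> x \<in> cl X"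
    and cl_finitary: "x \<in> cl X \<Longrightarrow> \<exists>E\<subseteq>X. finite E \<and> x \<in> cl E"
begin

lemma cl_mono: "X \<subseteq> Y \<Longrightarrow> cl X \<subseteq> cl Y"
  using cl_least subset_cl by blast

lemma cl_cl [simp]: "cl (cl X) = cl X"
  using cl_least[of "cl X" X] subset_cl[of "cl X"] by blast

lemma star_ideal_cl [simp]: "star_ideal cl (cl X)"
  by (simp add: star_ideal_def)

lemma in_cl: "x \<in> X \<Longrightarrow> x \<in> cl X"
  using subset_cl by blast

lemma cl_subset_star_ideal: "star_ideal cl A \<Longrightarrow> cl X \<subseteq> A \<longleftrightarrow> X \<subseteq> A"
  using cl_least[of X A] subset_cl[of X] by (auto simp: star_ideal_def)

lemma star_idealI: "cl A \<subseteq> A \<Longrightarrow> star_ideal cl A"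
  using subset_cl by (auto simp: star_ideal_def)

lemma star_ideal_ring_ideal: "star_ideal cl A \<Longrightarrow> ring_ideal A"
  using ring_ideal_cl[of A] by (simp add: star_ideal_def)

lemmas star_idealD = ring_idealD[OF star_ideal_ring_ideal]

lemmas clD = ring_idealD[OF ring_ideal_cl]

lemma star_ideal_UNIV [simp]: "star_ideal cl UNIV"
  by (intro star_idealI) auto

lemma star_ideal_eq_UNIV: "star_ideal cl A \<Longrightarrow> A = UNIV \<longleftrightarrow> 1 \<in> A"
  using star_idealD(3)[of A 1] by auto

lemma cl_union_least:
  "star_ideal cl A \<Longrightarrow> cl (X \<union> Y) \<subseteq> A \<longleftrightarrow> X \<subseteq> A \<and> Y \<subseteq> A"
  by (auto simp: cl_subset_star_ideal)

lemma star_ideal_Inter: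
  assumes "\<And>A. A \<in> \<A> \<Longrightarrow> star_ideal cl A"
  shows "star_ideal cl (\<Inter>\<A>)"
proof (rule star_idealI)
  show "cl (\<Inter>\<A>) \<subseteq> \<Inter>\<A>"
  proof (rule Inter_greatest)
    fix A assume "A \<in> \<A>"
    then show "cl (\<Inter>\<A>) \<subseteq> A"
      using cl_subset_star_ideal[OF assms] by blast
  qed
qed

lemma star_ideal_Int: "star_ideal cl A \<Longrightarrow> star_ideal cl B \<Longrightarrow> star_ideal cl (A \<inter> B)"
  using star_ideal_Inter[of "{A, B}"] by auto

lemma scale_cl: "x \<in> cl X \<Longrightarrow> c * x \<in> cl (c *o X)"
  using clD(1) cl_cancel[of c x X] by (cases "c = 0") auto

lemma mult_cl:
  assumes "u \<in> cl X" "v \<in> cl Y"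
  shows "u * v \<in> cl (X * Y)"
proof -
  have "v *o X \<subseteq> cl (X * Y)"
  proof
    fix z assume "z \<in> v *o X"
    then obtain x where x: "x \<in> X" "z = x * v"
      by (auto simp: elt_set_times_def mult.commute)
    have "x *o Y \<subseteq> X * Y"
      using x(1) by (auto simp: elt_set_times_def)
    then show "z \<in> cl (X * Y)"
      using scale_cl[OF assms(2), of x] cl_mono x(2) by blast
  qed
  then show ?thesis
    using scale_cl[OF assms(1), of v] cl_least by (auto simp: mult.commute)
qed

lemma cl_times_subset: "cl X * cl Y \<subseteq> cl (X * Y)"
  by (auto elim!: set_times_elim intro: mult_cl)

lemma times_mono: "X \<subseteq> X' \<Longrightarrow> Y \<subseteq> Y' \<Longrightarrow> X * Y \<subseteq> X' * (Y'::'a set)"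
  by (rule set_times_mono2)

lemma cl_times_cl [simp]: "cl (cl X * Y) = cl (X * Y)" "cl (X * cl Y) = cl (X * Y)"
proof -
  have "cl X * Y \<subseteq> cl (X * Y)" "X * cl Y \<subseteq> cl (X * Y)"
    using cl_times_subset[of X Y] times_mono subset_cl by blast+
  moreover have "X * Y \<subseteq> cl X * Y" "X * Y \<subseteq> X * cl Y"
    by (simp_all add: times_mono subset_cl)
  ultimately show "cl (cl X * Y) = cl (X * Y)" "cl (X * cl Y) = cl (X * Y)"
    using cl_least cl_mono by (simp_all add: subset_antisym)
qed

lemma times_subset_left: "star_ideal cl A \<Longrightarrow> A * X \<subseteq> A"
  by (auto elim!: set_times_elim intro: star_idealD)

lemma times_subset_right: "star_ideal cl A \<Longrightarrow> X * A \<subseteq> A"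
  by (auto elim!: set_times_elim intro: star_idealD)

lemma cl_one [simp]: "cl 1 = UNIV" "cl {1} = UNIV"
proof -
  show "cl {1} = UNIV"
    using star_ideal_eq_UNIV[of "cl {1}"] in_cl[of 1 "{1}"] by simp
  then show "cl 1 = UNIV"
    by (simp add: set_one)
qed

lemma UNIV_times: "star_ideal cl A \<Longrightarrow> cl (UNIV * A) = A" "star_ideal cl A \<Longrightarrow> cl (A * UNIV) = A"
proof -
  assume A: "star_ideal cl A"
  have "cl (cl 1 * A) = A"
    using A by (simp only: cl_times_cl mult_1_left star_ideal_def)
  then show "cl (UNIV * A) = A" "cl (A * UNIV) = A"
    by (simp_all add: mult.commute)
qed

lemma star_prod_list_Nil [simp]: "star_prod_list cl [] = UNIV"
  by (simp add: star_prod_list_def)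

lemma star_prod_list_Cons: "star_prod_list cl (A # As) = cl (A * star_prod_list cl As)"
  by (simp add: star_prod_list_def)

lemma star_ideal_star_prod_list [simp]: "star_ideal cl (star_prod_list cl As)"
  by (simp add: star_prod_list_def)

lemma star_prod_list_filter: "star_prod_list cl (filter (\<lambda>J. J \<noteq> UNIV) Js) = star_prod_list cl Js"
  by (induction Js) (auto simp: star_prod_list_Cons UNIV_times star_ideal_star_prod_list)

lemma star_prod_list_subset:
  "J \<in> set Js \<Longrightarrow> \<forall>J\<in>set Js. star_ideal cl J \<Longrightarrow> star_prod_list cl Js \<subseteq> J"
proof (induction Js)
  case (Cons A As)
  have *: "cl (A * star_prod_list cl As) \<subseteq> A"
    using Cons.prems times_subset_left by (simp add: cl_subset_star_ideal)
  have "cl (A * star_prod_list cl As) \<subseteq> star_prod_list cl As"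
    by (subst cl_subset_star_ideal) (auto intro!: times_subset_right)
  then show ?case
    using Cons * by (auto simp: star_prod_list_Cons)
qed simp

lemma star_ideal_residual:
  assumes "star_ideal cl A"
  shows "star_ideal cl {r. r * x \<in> A}"
proof (rule star_idealI, rule)
  fix r assume "r \<in> cl {r. r * x \<in> A}"
  then have "x * r \<in> cl (x *o {r. r * x \<in> A})"
    by (rule scale_cl)
  moreover have "cl (x *o {r. r * x \<in> A}) \<subseteq> A"
    using assms by (auto simp: cl_subset_star_ideal elt_set_times_def mult.commute)
  ultimately show "r \<in> {r. r * x \<in> A}"
    by (auto simp: mult.commute)
qed

lemma star_ideal_quotient:
  assumes "star_ideal cl A"
  shows "star_ideal cl {r. r *o X \<subseteq> A}"
proof -
  have "{r. r *o X \<subseteq> A} = \<Inter>((\<lambda>x. {r. r * x \<in> A}) ` X)"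
    by (auto simp: elt_set_times_def)
  then show ?thesis
    using star_ideal_Inter[of "(\<lambda>x. {r. r * x \<in> A}) ` X"] star_ideal_residual[OF assms] by auto
qed

section \<open>Zorn arguments and prime ideals\<close>

lemma star_ideal_chain_Union:
  assumes "\<C> \<noteq> {}" "\<And>A. A \<in> \<C> \<Longrightarrow> star_ideal cl A" "subset.chain UNIV \<C>"
  shows "star_ideal cl (\<Union>\<C>)"
proof (rule star_idealI, rule)
  fix x assume "x \<in> cl (\<Union>\<C>)"
  then obtain E where E: "E \<subseteq> \<Union>\<C>" "finite E" "x \<in> cl E"
    using cl_finitary by blast
  then obtain A where "A \<in> \<C>" "E \<subseteq> A"
    using finite_subset_Union_chain[OF E(2,1) assms(1)] assms(3) by blast
  then show "x \<in> \<Union>\<C>"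
    using E(3) assms(2) cl_subset_star_ideal by blast
qed

text \<open>Finite sets rather than elements are avoided, so that whole finitely generated ideals
  can be avoided later. Finiteness makes the union of a chain avoid them again.\<close>

lemma ex_maximal_avoiding:
  assumes A: "star_ideal cl A" and fin: "\<And>E. E \<in> \<S> \<Longrightarrow> finite E \<and> \<not> E \<subseteq> A"
  obtains P where "star_ideal cl P" "A \<subseteq> P" "\<And>E. E \<in> \<S> \<Longrightarrow> \<not> E \<subseteq> P"
    "\<And>B. star_ideal cl B \<Longrightarrow> P \<subseteq> B \<Longrightarrow> (\<And>E. E \<in> \<S> \<Longrightarrow> \<not> E \<subseteq> B) \<Longrightarrow> B = P"
proof -
  define \<B> where "\<B> = {B. star_ideal cl B \<and> A \<subseteq> B \<and> (\<forall>E\<in>\<S>. \<not> E \<subseteq> B)}"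
  have "\<exists>P\<in>\<B>. \<forall>B\<in>\<B>. P \<subseteq> B \<longrightarrow> B = P"
  proof (rule subset_Zorn_nonempty)
    show "\<B> \<noteq> {}"
      using A fin by (auto simp: \<B>_def)
    fix \<C> assume C: "\<C> \<noteq> {}" "subset.chain \<B> \<C>"
    have sub: "\<C> \<subseteq> \<B>"
      using C(2) by (simp add: subset.chain_def)
    have chain: "subset.chain UNIV \<C>"
      using C(2) by (simp add: subset.chain_def)
    have "star_ideal cl (\<Union>\<C>)"
      using C(1) chain sub by (intro star_ideal_chain_Union) (auto simp: \<B>_def)
    moreover have "A \<subseteq> \<Union>\<C>"
      using C(1) sub by (auto simp: \<B>_def)
    moreover have "\<not> E \<subseteq> \<Union>\<C>" if E: "E \<in> \<S>" for E
    proof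
      assume "E \<subseteq> \<Union>\<C>"
      moreover have "finite E"
        using fin E by auto
      ultimately obtain B where "B \<in> \<C>" "E \<subseteq> B"
        using finite_subset_Union_chain[OF _ _ C(1)] chain by blast
      then show False
        using sub E by (auto simp: \<B>_def)
    qed
    ultimately show "\<Union>\<C> \<in> \<B>"
      by (auto simp: \<B>_def)
  qed
  then obtain P where P: "P \<in> \<B>" "\<And>B. B \<in> \<B> \<Longrightarrow> P \<subseteq> B \<Longrightarrow> B = P"
    by blast
  show ?thesis
  proof (rule that)
    show "B = P" if "star_ideal cl B" "P \<subseteq> B" "\<And>E. E \<in> \<S> \<Longrightarrow> \<not> E \<subseteq> B" for B
      using that P(1) by (intro P(2)) (auto simp: \<B>_def)
  qed (use P(1) in \<open>auto simp: \<B>_def\<close>)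
qed

text \<open>The classical argument: enlarging \<open>P\<close> by \<open>a\<close> or by
  \<open>b\<close> makes it contain members \<open>E\<close> and \<open>F\<close>, and if
  \<open>a * b \<in> P\<close>, then \<open>E * F\<close> lies in \<open>P\<close>. Singletons give
  multiplicative sets of elements, \<open>{{1}}\<close> gives maximal ideals, generating sets of
  products give finite product covers.\<close>

lemma ex_prime_avoiding:
  assumes A: "star_ideal cl A" and fin: "\<And>E. E \<in> \<S> \<Longrightarrow> finite E \<and> \<not> E \<subseteq> A"
    and nonempty: "\<S> \<noteq> {}"
    and mult: "\<And>E F. E \<in> \<S> \<Longrightarrow> F \<in> \<S> \<Longrightarrow> \<exists>G\<in>\<S>. G \<subseteq> cl (E * F)"
  obtains P where "star_prime cl P" "A \<subseteq> P" "\<And>E. E \<in> \<S> \<Longrightarrow> \<not> E \<subseteq> P"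
    "\<And>B. star_ideal cl B \<Longrightarrow> P \<subseteq> B \<Longrightarrow> (\<And>E. E \<in> \<S> \<Longrightarrow> \<not> E \<subseteq> B) \<Longrightarrow> B = P"
proof -
  obtain P where P: "star_ideal cl P" "A \<subseteq> P" "\<And>E. E \<in> \<S> \<Longrightarrow> \<not> E \<subseteq> P"
    and max: "\<And>B. star_ideal cl B \<Longrightarrow> P \<subseteq> B \<Longrightarrow> (\<And>E. E \<in> \<S> \<Longrightarrow> \<not> E \<subseteq> B) \<Longrightarrow> B = P"
    using ex_maximal_avoiding[OF A fin] by metis
  have big: "\<exists>E\<in>\<S>. E \<subseteq> cl (insert a P)" if "a \<notin> P" for a
    using max[of "cl (insert a P)"] subset_cl[of "insert a P"] that by auto
  have "a \<in> P \<or> b \<in> P" if ab: "a * b \<in> P" for a b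
  proof (rule ccontr)
    assume "\<not> (a \<in> P \<or> b \<in> P)"
    then obtain E F where EF: "E \<in> \<S>" "E \<subseteq> cl (insert a P)" "F \<in> \<S>" "F \<subseteq> cl (insert b P)"
      using big by meson
    obtain G where G: "G \<in> \<S>" "G \<subseteq> cl (E * F)"
      using mult EF by blast
    have "insert a P * insert b P \<subseteq> P"
      using ab star_idealD[OF P(1)] by (auto elim!: set_times_elim)
    then have "cl (insert a P * insert b P) \<subseteq> P"
      using P(1) by (simp add: cl_subset_star_ideal)
    moreover have "E * F \<subseteq> cl (insert a P * insert b P)"
      using times_mono[OF EF(2,4)] cl_times_subset by blast
    ultimately have "G \<subseteq> P"
      using G(2) cl_least by blast
    then show False
      using P(3) G(1) by blast
  qed
  moreover have "P \<noteq> UNIV"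
    using nonempty P(3) by blast
  ultimately have "star_prime cl P"
    using P(1) star_ideal_ring_ideal by (auto simp: star_prime_def prime_ideal_def)
  then show ?thesis
    using that P max by blast
qed

lemma ex_star_maximal:
  assumes "star_ideal cl A" "A \<noteq> UNIV"
  obtains M where "star_maximal cl M" "star_prime cl M" "A \<subseteq> M"
proof -
  have "\<exists>M. star_prime cl M \<and> A \<subseteq> M \<and> (\<forall>B. star_ideal cl B \<longrightarrow> M \<subseteq> B \<longrightarrow> 1 \<notin> B \<longrightarrow> B = M)"
    by (rule ex_prime_avoiding[OF assms(1), of "{{1}}"])
      (use assms star_ideal_eq_UNIV in \<open>auto intro!: in_cl simp: set_times_def\<close>)
  then obtain M where M: "star_prime cl M" "A \<subseteq> M"
    "\<And>B. star_ideal cl B \<Longrightarrow> M \<subseteq> B \<Longrightarrow> 1 \<notin> B \<Longrightarrow> B = M"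
    by blast
  have "star_maximal cl M"
    using M star_ideal_eq_UNIV by (auto simp: star_maximal_def star_prime_def prime_ideal_def)
  then show ?thesis
    using that M by blast
qed

lemma star_maximal_prime:
  assumes "star_maximal cl M"
  shows "star_prime cl M"
  using assms ex_star_maximal[of M] unfolding star_maximal_def by (metis star_prime_def prime_ideal_def)

lemma ex_prime_avoiding_elements:
  assumes A: "star_ideal cl A" and S: "1 \<in> S" "\<And>s t. s \<in> S \<Longrightarrow> t \<in> S \<Longrightarrow> s * t \<in> S" "S \<inter> A = {}"
  obtains P where "star_prime cl P" "A \<subseteq> P" "S \<inter> P = {}"
proof -
  have "\<exists>P. star_prime cl P \<and> A \<subseteq> P \<and> S \<inter> P = {}"
  proof (rule ex_prime_avoiding[OF A, of "(\<lambda>s. {s}) ` S"])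
    fix E F assume "E \<in> (\<lambda>s. {s}) ` S" "F \<in> (\<lambda>s. {s}) ` S"
    then obtain s t where "s \<in> S" "t \<in> S" "E = {s}" "F = {t}"
      by blast
    then show "\<exists>G\<in>(\<lambda>s. {s}) ` S. G \<subseteq> cl (E * F)"
      using S(2)[of s t] by (intro bexI[of _ "{s * t}"]) (auto intro: in_cl)
  qed (use S in auto)
  then show ?thesis
    using that by blast
qed

text \<open>The radical is the intersection of the closed primes above \<open>A\<close>; a prime
  missing a given element comes from avoiding all its powers.\<close>

lemma star_ideal_radical:
  assumes A: "star_ideal cl A"
  shows "star_ideal cl (ideal_radical A)"
proof -
  have "ideal_radical A = \<Inter>{P. star_prime cl P \<and> A \<subseteq> P}"
  proof (intro equalityI subsetI InterI)
    fix x P assume x: "x \<in> ideal_radical A" and "P \<in> {P. star_prime cl P \<and> A \<subseteq> P}"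
    then obtain n where n: "x ^ n \<in> P" and P: "prime_ideal P"
      by (auto simp: ideal_radical_def star_prime_def)
    from n show "x \<in> P"
    proof (induction n)
      case 0
      then have "P = UNIV"
        using P ring_idealD(3)[of P 1] by (auto simp: prime_ideal_def)
      then show ?case
        by simp
    next
      case (Suc n)
      then show ?case
        using P by (auto simp: prime_ideal_def)
    qed
  next
    fix x assume x: "x \<in> \<Inter>{P. star_prime cl P \<and> A \<subseteq> P}"
    show "x \<in> ideal_radical A"
    proof (rule ccontr)
      assume not: "x \<notin> ideal_radical A"
      have disj: "x ^ n \<notin> A" for n
      proof (cases "n = 0")
        case True
        have "x ^ 1 \<notin> A"
          using not unfolding ideal_radical_def by blast
        then show ?thesis
          using True star_idealD(3)[OF A, of 1 x] by auto
      next
        case False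
        then show ?thesis
          using not unfolding ideal_radical_def by blast
      qed
      have "\<exists>P. star_prime cl P \<and> A \<subseteq> P \<and> range (\<lambda>n. x ^ n) \<inter> P = {}"
      proof (rule ex_prime_avoiding_elements[OF A, of "range (\<lambda>n. x ^ n)"])
        show "1 \<in> range (\<lambda>n. x ^ n)"
          by (rule range_eqI[of _ _ 0]) simp
        show "s * t \<in> range (\<lambda>n. x ^ n)" if "s \<in> range (\<lambda>n. x ^ n)" "t \<in> range (\<lambda>n. x ^ n)" for s t
          using that by (auto simp flip: power_add)
      qed (use disj in auto)
      then show False
        using x by (metis (mono_tags, lifting) Int_iff InterE empty_iff mem_Collect_eq power_one_right rangeI)
    qed
  qed
  then show ?thesis
    using star_ideal_Inter[of "{P. star_prime cl P \<and> A \<subseteq> P}"] by (auto simp: star_prime_def)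
qed

text \<open>That is, \<open>A\<close> and \<open>Q\<close> have the same localization at \<open>Q\<close>.\<close>

lemma radical_locally_eq_minimal_prime:
  assumes A: "star_radical_ideal cl A" and Q: "star_prime cl Q"
    and min: "\<And>P. star_prime cl P \<Longrightarrow> A \<subseteq> P \<Longrightarrow> P \<subseteq> Q \<Longrightarrow> P = Q"
    and x: "x \<in> Q"
  obtains s where "s \<notin> Q" "s * x \<in> A"
proof -
  define S where "S = {s * x ^ n |s n. s \<notin> Q}"
  have A': "star_ideal cl A" "ideal_radical A = A"
    using A by (auto simp: star_radical_ideal_def)
  have 1: "1 \<notin> Q"
    using Q star_ideal_eq_UNIV by (auto simp: star_prime_def prime_ideal_def)
  \<comment> \<open>With exponent 0 the set \<open>S\<close> contains the complement of
    \<open>Q\<close>, so a prime above \<open>A\<close> disjoint from \<open>S\<close> lies in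
    \<open>Q\<close> and equals it by minimality. It then contains \<open>x\<close>, which is also
    in \<open>S\<close>.\<close>
  have "S \<inter> A \<noteq> {}"
  proof
    assume disj: "S \<inter> A = {}"
    have "1 * x ^ 0 \<in> S"
      unfolding S_def using 1 by blast
    moreover have "s * t \<in> S" if st: "s \<in> S" "t \<in> S" for s t
    proof -
      obtain a m b n where "a \<notin> Q" "b \<notin> Q" "s = a * x ^ m" "t = b * x ^ n"
        using st unfolding S_def by blast
      then have "a * b \<notin> Q" "s * t = (a * b) * x ^ (m + n)"
        using Q by (auto simp: star_prime_def prime_ideal_def power_add algebra_simps)
      then show ?thesis
        unfolding S_def by blast
    qed
    ultimately obtain P where P: "star_prime cl P" "A \<subseteq> P" "S \<inter> P = {}"
      using ex_prime_avoiding_elements[OF A'(1), of S] disj by auto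
    have "s * x ^ 0 \<in> S" if "s \<notin> Q" for s
      using that unfolding S_def by blast
    then have "P \<subseteq> Q"
      using P(3) by auto
    then have "x \<in> P"
      using min[OF P(1,2)] x by simp
    moreover have "1 * x ^ 1 \<in> S"
      unfolding S_def using 1 by blast
    ultimately show False
      using P(3) by auto
  qed
  then obtain s n where sn: "s \<notin> Q" "s * x ^ n \<in> A"
    unfolding S_def by blast
  have "(s * x) ^ Suc n = (s ^ n * x) * (s * x ^ n)"
    by (simp add: power_mult_distrib algebra_simps)
  then have "(s * x) ^ Suc n \<in> A"
    using star_idealD(3)[OF A'(1) sn(2)] by (simp only:)
  then have "s * x \<in> ideal_radical A"
    unfolding ideal_radical_def by blast
  then show ?thesis
    using that sn(1) A'(2) by blast
qed

lemma mem_radical_star_ideal: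
  assumes "star_radical_ideal cl J" "x ^ n \<in> J"
  shows "x \<in> J"
proof (cases "n = 0")
  case True
  then show ?thesis
    using assms star_idealD(3)[of J 1] by (auto simp: star_radical_ideal_def)
next
  case False
  then show ?thesis
    using assms by (auto simp: star_radical_ideal_def ideal_radical_def)
qed

lemma prime_contains_factor:
  assumes P: "prime_ideal P" and "star_prod_list cl Js \<subseteq> P"
  shows "\<exists>J\<in>set Js. J \<subseteq> P"
  using assms(2)
proof (induction Js)
  case Nil
  then show ?case
    using P by (auto simp: prime_ideal_def)
next
  case (Cons J Js)
  then have "J * star_prod_list cl Js \<subseteq> P"
    using subset_cl by (auto simp: star_prod_list_Cons)
  then have "J \<subseteq> P \<or> star_prod_list cl Js \<subseteq> P"
    using P unfolding prime_ideal_def by (meson set_times_intro subset_iff)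
  then show ?case
    using Cons.IH by auto
qed

end

section \<open>Invertible ideals\<close>

locale star_closure = ideal_closure star for star :: "'a::idom set \<Rightarrow> 'a set" +
  assumes star_scale: "star (c *o X) = c *o star X"

lemma star_closureI:
  assumes star: "star_operation star" and fin: "star_finite_type star"
  shows "star_closure star"
proof -
  have ext: "X * UNIV \<union> {0} \<subseteq> star X" and least: "X \<subseteq> star Y \<Longrightarrow> star X \<subseteq> star Y"
    and scale: "c *o star X = star (c *o X)" and ideal: "star X = X \<Longrightarrow> ring_ideal X" for X Y c
    using star by (simp_all add: star_operation_def)
  have sub: "X \<subseteq> star X" for X
    using ext[of X] set_times_intro[of _ X 1 UNIV] by auto
  show ?thesis
  proof
    show "ring_ideal (star X)" for X
      using sub[of "star X"] least[of "star X" X] ideal[of "star X"] by blast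
    show "c \<noteq> 0 \<Longrightarrow> c * x \<in> star (c *o X) \<longleftrightarrow> x \<in> star X" for c x X
      unfolding scale[symmetric] by (auto simp: elt_set_times_def)
    show "x \<in> star X \<Longrightarrow> \<exists>E\<subseteq>X. finite E \<and> x \<in> star E" for x X
      using fin unfolding star_finite_type_def by blast
  qed (use sub least scale in auto)
qed

context star_closure
begin

lemma star_singleton: "star {c} = c *o UNIV"
  using star_scale[of c "{1}"] by (simp add: elt_set_times_def)

lemma star_zero [simp]: "star {0} = {0}"
  by (auto simp: star_singleton elt_set_times_def)

lemma star_empty [simp]: "star {} = {0}"
  using star_scale[of 0 "{}"] clD(1)[of "{}"] by (auto simp: elt_set_times_def)

lemma star_ideal_zero [simp]: "star_ideal star {0}"
  by (simp add: star_ideal_def)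

lemma in_star_singleton: "x \<in> star {c} \<longleftrightarrow> c dvd x"
  by (auto simp: star_singleton elt_set_times_def)

lemma star_singleton_times: "star (star {c} * X) = c *o star X"
  using star_scale[of c X] by (simp add: scale_eq_times)

lemma mult_mem_scale: "y \<noteq> 0 \<Longrightarrow> y * x \<in> y *o A \<longleftrightarrow> x \<in> (A :: 'a set)"
  by (auto simp: elt_set_times_def)

lemma star_invertible_iff:
  "star_invertible star I \<longleftrightarrow> star_ideal star I \<and> (\<exists>J y. y \<noteq> 0 \<and> star (I * J) = star {y})"
  by (simp add: star_invertible_def star_singleton)

lemma star_invertible_star_ideal: "star_invertible star I \<Longrightarrow> star_ideal star I"
  by (simp add: star_invertible_def)

text \<open>Multiplying by \<open>J\<close> with \<open>star (I * J)\<close> principal turns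
  \<open>star (I * X)\<close> into \<open>y *o star X\<close>, and \<open>y\<close> cancels in a
  domain.\<close>

lemma star_invertible_cancel:
  assumes "star_invertible star I" "star (I * A) \<subseteq> star (I * B)"
  shows "star A \<subseteq> star B"
proof -
  obtain J y where Jy: "y \<noteq> 0" "star (I * J) = star {y}"
    using assms(1) by (auto simp: star_invertible_iff)
  have eq: "star (J * star (I * X)) = y *o star X" for X
  proof -
    have "star (J * star (I * X)) = star (star (I * J) * X)"
      by (simp add: ac_simps)
    then show ?thesis
      by (simp only: Jy star_singleton_times)
  qed
  have "star (J * star (I * A)) \<subseteq> star (J * star (I * B))"
    using assms(2) by (rule cl_mono[OF times_mono[OF subset_refl]])
  then show ?thesis
    using Jy(1) unfolding eq by (auto simp: elt_set_times_def)
qed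

text \<open>For an invertible ideal, to contain is to divide, with the residual as cofactor. The
  core is \<open>J * B \<subseteq> y *o ?C\<close>: if \<open>b * j = y * r\<close>, then
  \<open>r\<close> carries \<open>I\<close> into \<open>B\<close>, as seen after multiplying by
  \<open>y\<close>.\<close>

lemma star_invertible_times_quotient:
  assumes I: "star_invertible star I" and B: "star_ideal star B" "B \<subseteq> I"
  shows "star (I * {r. r *o I \<subseteq> B}) = B"
proof
  let ?C = "{r. r *o I \<subseteq> B}"
  have "I * ?C \<subseteq> B"
    by (auto elim!: set_times_elim simp: elt_set_times_def mult.commute)
  then show "star (I * ?C) \<subseteq> B"
    using B(1) by (simp add: cl_subset_star_ideal)
  obtain J y where Jy: "y \<noteq> 0" "star (I * J) = star {y}"
    using I by (auto simp: star_invertible_iff)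
  have dvd: "y dvd i * j" if "i \<in> I" "j \<in> J" for i j
    using Jy(2) in_cl[of "i * j" "I * J"] that by (auto simp: in_star_singleton)
  have "J * B \<subseteq> y *o ?C"
  proof
    fix z assume "z \<in> J * B"
    then obtain j b where z: "j \<in> J" "b \<in> B" "z = j * b"
      by (auto elim: set_times_elim)
    obtain r where r: "b * j = y * r"
      using dvd[of b j] z B(2) by (auto elim: dvdE)
    have "r *o I \<subseteq> B"
    proof
      fix x assume "x \<in> r *o I"
      then obtain i where i: "i \<in> I" "x = r * i"
        by (auto simp: elt_set_times_def)
      obtain t where t: "i * j = y * t"
        using dvd[of i j] i z by (auto elim: dvdE)
      have "y * x = (b * j) * i"
        using r i by (simp add: mult.assoc)
      also have "\<dots> = b * (i * j)"
        by (simp add: ac_simps)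
      finally have "y * x = y * (t * b)"
        using t by (simp add: ac_simps)
      then show "x \<in> B"
        using Jy(1) star_idealD(3)[OF B(1) z(2)] by simp
    qed
    moreover have "z = y * r"
      using r z(3) by (simp add: mult.commute)
    ultimately show "z \<in> y *o ?C"
      by (auto intro: set_times_intro2)
  qed
  then have "star (I * (J * B)) \<subseteq> star (I * (y *o ?C))"
    by (intro cl_mono times_mono) auto
  moreover have "I * (y *o ?C) = y *o (I * ?C)"
    by (simp only: scale_eq_times mult.left_commute)
  moreover have "star (I * (J * B)) = y *o B"
  proof -
    have "star (I * (J * B)) = star (star (I * J) * B)"
      by (simp add: mult.assoc)
    then show ?thesis
      using B(1) by (simp only: Jy star_singleton_times star_ideal_def)
  qed
  ultimately have "y *o B \<subseteq> y *o star (I * ?C)"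
    by (simp add: star_scale)
  then show "B \<subseteq> star (I * ?C)"
    using Jy(1) by (auto simp: elt_set_times_def)
qed

lemma star_invertible_factor:
  assumes "star_invertible star (star (A * B))" "star_ideal star A"
  shows "star_invertible star A"
  using assms by (auto simp: star_invertible_iff mult.assoc)

lemma star_invertible_times:
  assumes "star_invertible star I" "star_invertible star J"
  shows "star_invertible star (star (I * J))"
proof -
  obtain I' x where I: "x \<noteq> 0" "star (I * I') = star {x}"
    using assms(1) by (auto simp: star_invertible_iff)
  obtain J' y where J: "y \<noteq> 0" "star (J * J') = star {y}"
    using assms(2) by (auto simp: star_invertible_iff)
  have "(I * J) * (I' * J') = (I * I') * (J * J')"
    by (simp add: ac_simps)
  then have "star (star (I * J) * (I' * J')) = star (star (I * I') * star (J * J'))"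
    by (simp only: cl_times_cl)
  also have "\<dots> = star {x * y}"
    by (simp only: I(2) J(2) cl_times_cl) (simp add: set_times_def)
  finally show ?thesis
    unfolding star_invertible_iff using I(1) J(1) star_ideal_cl mult_eq_0_iff by metis
qed

lemma star_invertible_singleton: "c \<noteq> 0 \<Longrightarrow> star_invertible star (star {c})"
  unfolding star_invertible_iff cl_times_cl using mult_1_right[of "{c}"] star_ideal_cl by metis

lemma star_invertible_nonzero:
  assumes "star_invertible star I"
  shows "I \<noteq> {0}"
proof
  assume I: "I = {0}"
  obtain J y where y: "y \<noteq> 0" "star (I * J) = star {y}"
    using assms by (auto simp: star_invertible_iff)
  have "I * J \<subseteq> {0}"
    using I by (auto elim: set_times_elim)
  then have "star (I * J) \<subseteq> {0}"
    using cl_mono[of "I * J" "{0}"] by simp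
  then show False
    using y in_cl[of y "{y}"] by auto
qed

text \<open>Finitely many elements of \<open>I * J\<close> have \<open>y\<close> in their closure.
  The left factors chosen for them generate \<open>I\<close>: up to closure they have the same
  product with \<open>J\<close> as \<open>I\<close> has, and that product is principal.\<close>

lemma star_invertible_fin_gen:
  assumes I: "star_invertible star I"
  shows "star_fin_gen star I"
proof -
  obtain J y where y: "y \<noteq> 0" "star (I * J) = star {y}"
    using I by (auto simp: star_invertible_iff)
  then have "y \<in> star (I * J)"
    using in_cl[of y "{y}"] by simp
  from cl_finitary[OF this] obtain E where E: "E \<subseteq> I * J" "finite E" "y \<in> star E"
    by blast
  obtain f g where fg: "\<And>e. e \<in> E \<Longrightarrow> f e \<in> I \<and> g e \<in> J \<and> e = f e * g e"
  proof -
    have "\<forall>e\<in>E. \<exists>a b. a \<in> I \<and> b \<in> J \<and> e = a * b"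
      using E(1) unfolding set_times_def by blast
    then show ?thesis
      using that by metis
  qed
  have "E \<subseteq> f ` E * J"
  proof
    fix e assume "e \<in> E"
    then show "e \<in> f ` E * J"
      using fg[of e] set_times_intro[of "f e" "f ` E" "g e" J] by simp
  qed
  then have "star {y} \<subseteq> star (f ` E * J)"
    using E(3) cl_mono[of E "f ` E * J"] by (intro cl_least) auto
  moreover have "star (f ` E * J) \<subseteq> star (I * J)"
    using fg by (intro cl_mono times_mono) auto
  ultimately have eq: "star (f ` E * J) = star {y}"
    using y(2) by simp
  have "(f ` E * J) * I = (I * J) * f ` E"
    by (simp add: ac_simps)
  then have "star (star (f ` E * J) * I) = star (star (I * J) * f ` E)"
    by (simp only: cl_times_cl)
  then have "star (star {y} * I) = star (star {y} * f ` E)"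
    by (simp only: y(2) eq)
  then have "y *o star I = y *o star (f ` E)"
    by (simp only: star_singleton_times)
  then have "star I = star (f ` E)"
    using mult_mem_scale[OF y(1)] by (metis subsetI subset_antisym)
  moreover have "f ` E \<subseteq> I"
    using fg by auto
  ultimately show ?thesis
    using I E(2) unfolding star_fin_gen_def by (auto simp: star_invertible_def star_ideal_def)
qed

text \<open>If all products \<open>a * b\<close> lay in \<open>y *o P\<close>, then so would
  \<open>y\<close>, and \<open>P\<close> would contain 1. The left factor of a product outside is a
  local generator, with the quotient \<open>s\<close> of \<open>a * b\<close> by \<open>y\<close> as
  denominator.\<close>

lemma star_invertible_locally_principal:
  assumes I: "star_invertible star I" and P: "star_prime star P"
  obtains a s where "a \<in> I" "a \<noteq> 0" "s \<notin> P" "\<And>x. x \<in> I \<Longrightarrow> a dvd s * x"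
proof -
  obtain J y where y: "y \<noteq> 0" "star (I * J) = star {y}"
    using I by (auto simp: star_invertible_iff)
  have P': "star_ideal star P" "P \<noteq> UNIV"
    using P by (auto simp: star_prime_def prime_ideal_def)
  have dvd: "y dvd i * j" if "i \<in> I" "j \<in> J" for i j
    using y(2) in_cl[of "i * j" "I * J"] that by (auto simp: in_star_singleton)
  have "\<exists>a\<in>I. \<exists>b\<in>J. a * b \<notin> y *o P"
  proof (rule ccontr)
    assume "\<not> (\<exists>a\<in>I. \<exists>b\<in>J. a * b \<notin> y *o P)"
    then have "I * J \<subseteq> star (y *o P)"
      using P'(1) by (auto elim!: set_times_elim simp: star_ideal_def star_scale)
    then have "star (I * J) \<subseteq> star (y *o P)"
      by (rule cl_least)
    then have "y \<in> y *o P"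
      using y(2) in_cl[of y "{y}"] P'(1) by (auto simp: star_ideal_def star_scale)
    then show False
      using y(1) P' star_ideal_eq_UNIV by (auto simp: elt_set_times_def)
  qed
  then obtain a b where ab: "a \<in> I" "b \<in> J" "a * b \<notin> y *o P"
    by blast
  obtain s where s: "a * b = y * s"
    using dvd[OF ab(1,2)] by (auto elim: dvdE)
  show ?thesis
  proof (rule that[of a s])
    show "s \<notin> P"
      using ab(3) s by (auto simp: elt_set_times_def)
    then show "a \<noteq> 0"
      using s y(1) star_idealD(1)[OF P'(1)] by auto
    fix x assume "x \<in> I"
    then obtain r where r: "x * b = y * r"
      using dvd[OF _ ab(2)] by (auto elim: dvdE)
    have "y * (s * x) = (a * b) * x"
      by (simp add: s mult.assoc)
    also have "\<dots> = a * (x * b)"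
      by (simp add: ac_simps)
    also have "\<dots> = y * (a * r)"
      by (simp only: r mult.left_commute)
    finally show "a dvd s * x"
      using y(1) by simp
  qed (rule ab(1))
qed

lemma star_prime_zero: "star_prime star {0}"
  by (auto simp: star_prime_def prime_ideal_def ring_ideal_iff set_eq_iff intro!: exI[of _ "1::'a"])

lemma subset_radical: "A \<subseteq> ideal_radical A"
  by (auto simp: ideal_radical_def intro: exI[of _ 1])

lemma star_radical_ideal_radical:
  assumes "star_ideal star A"
  shows "star_radical_ideal star (ideal_radical A)"
proof -
  have "ideal_radical (ideal_radical A) \<subseteq> ideal_radical A"
    by (auto simp: ideal_radical_def simp flip: power_mult)
      (metis nat_0_less_mult_iff)
  then show ?thesis
    using subset_radical[of "ideal_radical A"] star_ideal_radical[OF assms]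
    by (auto simp: star_radical_ideal_def)
qed

lemma radical_least: "star_radical_ideal star J \<Longrightarrow> A \<subseteq> J \<Longrightarrow> ideal_radical A \<subseteq> J"
  unfolding star_radical_ideal_def ideal_radical_def by blast

lemma radical_subset_prime: "star_prime star P \<Longrightarrow> A \<subseteq> P \<Longrightarrow> ideal_radical A \<subseteq> P"
proof
  fix x assume P: "star_prime star P" "A \<subseteq> P" and "x \<in> ideal_radical A"
  then obtain n where "x ^ n \<in> P"
    by (auto simp: ideal_radical_def)
  then show "x \<in> P"
    using P(1) by (induction n) (auto simp: star_prime_def prime_ideal_def dest: ring_idealD(3)[of P 1])
qed

lemma star_fin_gen_cl: "finite E \<Longrightarrow> star_fin_gen star (star E)"
  unfolding star_fin_gen_def using subset_cl[of E] by auto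

lemma star_fin_gen_union:
  assumes "star_fin_gen star I" "star_fin_gen star J"
  shows "star_fin_gen star (star (I \<union> J))"
proof -
  obtain E F where EF: "finite E" "I = star E" "finite F" "J = star F"
    using assms unfolding star_fin_gen_def by blast
  have "star (star E \<union> star F) = star (E \<union> F)"
  proof
    show "star (star E \<union> star F) \<subseteq> star (E \<union> F)"
      using cl_mono[of E "E \<union> F"] cl_mono[of F "E \<union> F"] by (intro cl_least) auto
    show "star (E \<union> F) \<subseteq> star (star E \<union> star F)"
      using subset_cl by (intro cl_mono) auto
  qed
  then show ?thesis
    using EF star_fin_gen_cl[of "E \<union> F"] by simp
qed

lemma nonzero_star_ideal:
  assumes "star_ideal star I" "I \<noteq> {0}"
  obtains x where "x \<in> I" "x \<noteq> 0"
  using assms star_idealD(1)[of I] by auto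

text \<open>The ideal \<open>L\<close> stays proper: \<open>y\<close> multiplies \<open>C\<close>
  into \<open>J \<subseteq> P\<close> and is not in \<open>P\<close>, so
  \<open>C \<subseteq> P\<close>, and both \<open>K\<close> and \<open>C\<close> lie in
  \<open>M\<close>. On the other hand \<open>L\<close> divides both \<open>K\<close> and
  \<open>C\<close>, so it divides the radical ideal \<open>J\<close> twice.\<close>

lemma prime_maximal_if_radicals_invertible:
  assumes rad: "\<And>I. star_fin_gen star I \<Longrightarrow> I \<noteq> {0} \<Longrightarrow> star_invertible star (ideal_radical I)"
    and P: "star_prime star P" "P \<noteq> {0}"
  shows "star_maximal star P"
proof -
  have eq: "P = M" if M: "star_maximal star M" "star_prime star M" "P \<subseteq> M" for M
  proof (rule ccontr)
    assume "P \<noteq> M"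
    then obtain y where y: "y \<in> M" "y \<notin> P"
      using M(3) by blast
    have P': "star_ideal star P" and M': "star_ideal star M"
      using P M(2) by (auto simp: star_prime_def)
    obtain x where x: "x \<in> P" "x \<noteq> 0"
      using nonzero_star_ideal P(2) P' by blast
    have inv: "star_invertible star (ideal_radical (star E))" if "finite E" "\<exists>x\<in>E. x \<noteq> 0" for E
      using that in_cl[of _ E] by (intro rad star_fin_gen_cl) auto
    define J where "J = ideal_radical (star {x})"
    define K where "K = ideal_radical (star {x, y})"
    have J: "star_invertible star J" and K: "star_invertible star K"
      unfolding J_def K_def using x(2) by (auto intro!: inv)
    have radJ: "star_radical_ideal star J" and radK: "star_radical_ideal star K"
      unfolding J_def K_def by (simp_all add: star_radical_ideal_radical)
    have "star {x} \<subseteq> star {x, y}"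
      by (rule cl_mono) auto
    then have JK: "J \<subseteq> K"
      unfolding J_def K_def ideal_radical_def by blast
    have JP: "J \<subseteq> P"
      unfolding J_def using x P' by (intro radical_subset_prime[OF P(1)]) (simp add: cl_subset_star_ideal)
    have KM: "K \<subseteq> M"
      unfolding K_def using x y M' M(3)
      by (intro radical_subset_prime[OF M(2)]) (auto simp: cl_subset_star_ideal)
    have "y \<in> K"
      unfolding K_def using subset_radical in_cl by blast
    define C where "C = {r. r *o K \<subseteq> J}"
    have sJ: "star_ideal star J"
      using J star_invertible_star_ideal by blast
    have C: "star_ideal star C" "star (K * C) = J"
      unfolding C_def using star_ideal_quotient[OF sJ] star_invertible_times_quotient[OF K sJ JK] .
    have CI: "star_invertible star C"
      using star_invertible_factor[of C K] C J by (simp add: mult.commute)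
    have "C \<subseteq> P"
    proof
      fix c assume "c \<in> C"
      then have "c * y \<in> J"
        using \<open>y \<in> K\<close> unfolding C_def by (auto simp: elt_set_times_def)
      then show "c \<in> P"
        using JP y(2) P(1) by (auto simp: star_prime_def prime_ideal_def)
    qed
    define L where "L = ideal_radical (star (K \<union> C))"
    have KL: "K \<subseteq> L" "C \<subseteq> L"
      unfolding L_def using subset_cl[of "K \<union> C"] subset_radical[of "star (K \<union> C)"] by auto
    have "star_fin_gen star (star (K \<union> C))"
      by (intro star_fin_gen_union star_invertible_fin_gen K CI)
    moreover have "star (K \<union> C) \<noteq> {0}"
      using subset_cl[of "K \<union> C"] star_invertible_nonzero[OF K] star_idealD(1)[of K]
        star_invertible_star_ideal[OF K] by blast
    ultimately have L: "star_invertible star L"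
      unfolding L_def by (rule rad)
    have LM: "L \<subseteq> M"
      unfolding L_def using M(2) M' KM M(3) \<open>C \<subseteq> P\<close>
      by (intro radical_subset_prime) (auto simp: cl_union_least)
    define D where "D = {r. r *o L \<subseteq> K}"
    define E where "E = {r. r *o L \<subseteq> C}"
    have D: "star (L * D) = K"
      unfolding D_def using star_invertible_times_quotient[OF L star_invertible_star_ideal[OF K] KL(1)] .
    have E: "star (L * E) = C"
      unfolding E_def using star_invertible_times_quotient[OF L C(1) KL(2)] .
    have J_eq: "J = star (L * (L * (D * E)))"
    proof -
      have "J = star (star (L * D) * star (L * E))"
        by (simp add: C D E)
      also have "\<dots> = star ((L * D) * (L * E))"
        by (simp only: cl_times_cl)
      also have "(L * D) * (L * E) = L * (L * (D * E))"
        by (simp add: ac_simps)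
      finally show ?thesis .
    qed
    \<comment> \<open>The square of \<open>l * (d * e)\<close> is a multiple of
      \<open>l * (l * (d * e)) \<in> J\<close>, so radicality removes one factor \<open>L\<close>.
      Cancelling the invertible \<open>star (L * (D * E))\<close> then leaves \<open>R\<close>
      inside \<open>star L\<close>.\<close>
    have sub: "L * (D * E) \<subseteq> J"
    proof
      fix z assume z: "z \<in> L * (D * E)"
      then obtain l d e where lde: "l \<in> L" "d \<in> D" "e \<in> E" "z = l * (d * e)"
        by (auto elim!: set_times_elim)
      have "l * (l * (d * e)) \<in> J"
        unfolding J_eq using lde by (intro in_cl set_times_intro)
      then have "(d * e) * (l * (l * (d * e))) \<in> J"
        using star_idealD(3)[OF sJ] by blast
      moreover have "z ^ 2 = (d * e) * (l * (l * (d * e)))"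
        by (simp add: lde power2_eq_square ac_simps)
      ultimately show "z \<in> J"
        using mem_radical_star_ideal[OF radJ] by metis
    qed
    have "star ((L * (D * E)) * UNIV) \<subseteq> star ((L * (D * E)) * L)"
    proof -
      have "star ((L * (D * E)) * UNIV) = star (L * (D * E))"
        using UNIV_times(2)[of "star (L * (D * E))"] by (simp only: cl_times_cl star_ideal_cl)
      moreover have "star (L * (D * E)) \<subseteq> J"
        using sub sJ by (simp only: cl_subset_star_ideal)
      ultimately show ?thesis
        by (simp only: J_eq mult.commute[of _ L])
    qed
    moreover have "star_invertible star (star (L * (D * E)))"
    proof (rule star_invertible_factor)
      have "star (star (L * (D * E)) * L) = J"
        by (simp only: cl_times_cl J_eq mult.commute[of _ L])
      then show "star_invertible star (star (star (L * (D * E)) * L))"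
        using J by simp
    qed simp
    ultimately have "star UNIV \<subseteq> star L"
      using star_invertible_cancel[of "star (L * (D * E))" UNIV L] by simp
    then have "star UNIV \<subseteq> M"
      using LM cl_subset_star_ideal[OF M'] by blast
    then show False
      using M(1) star_ideal_UNIV by (auto simp: star_maximal_def star_ideal_def)
  qed
  have "star_ideal star P" "P \<noteq> UNIV"
    using P(1) by (auto simp: star_prime_def prime_ideal_def)
  then obtain M where "star_maximal star M" "star_prime star M" "P \<subseteq> M"
    by (rule ex_star_maximal)
  then show ?thesis
    using eq by metis
qed

end

section \<open>Local modular closure operations\<close>

text \<open>
  The closure operation \<open>X \<mapsto> (X\<^sub>*)\<^sub>Q \<inter> R\<close>: it is finitary and
  modular again, and \<open>Q\<close> is its only maximal closed ideal.
\<close>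

definition localized_star :: "('a::idom set \<Rightarrow> 'a set) \<Rightarrow> 'a set \<Rightarrow> 'a set \<Rightarrow> 'a set" where
  "localized_star star Q X = {x. \<exists>s. s \<notin> Q \<and> s * x \<in> star X}"

text \<open>The local ring at \<open>Q\<close> without fractions: by \<open>saturated\<close> the
  elements outside \<open>Q\<close> act as units, and by \<open>locally_dvd\<close> the closure of
  \<open>{c}\<close> consists of multiples of \<open>c\<close> up to such units.\<close>

locale local_modular_closure = ideal_closure w for w :: "'a::idom set \<Rightarrow> 'a set" +
  fixes Q :: "'a set"
  assumes Q: "star_prime w Q"
    and saturated: "s \<notin> Q \<Longrightarrow> s * x \<in> w X \<Longrightarrow> x \<in> w X"
    and locally_dvd: "x \<in> w {c} \<Longrightarrow> \<exists>s. s \<notin> Q \<and> c dvd s * x"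
    and modular: "star_modular w"
begin

lemma star_ideal_Q: "star_ideal w Q"
  using Q by (simp add: star_prime_def)

lemma one_notin_Q: "1 \<notin> Q"
  using Q star_ideal_eq_UNIV[OF star_ideal_Q] by (auto simp: star_prime_def prime_ideal_def)

lemma saturated_star_ideal: "star_ideal w A \<Longrightarrow> s \<notin> Q \<Longrightarrow> s * x \<in> A \<Longrightarrow> x \<in> A"
  using saturated[of s x A] by (simp add: star_ideal_def)

lemma proper_subset_Q:
  assumes "star_ideal w A" "A \<noteq> UNIV"
  shows "A \<subseteq> Q"
proof
  fix x assume "x \<in> A"
  then show "x \<in> Q"
    using saturated_star_ideal[OF assms(1), of x 1] assms star_ideal_eq_UNIV by auto
qed

lemma modularD:
  assumes "star_ideal w N" "A \<subseteq> N" "x \<in> w (A \<union> B)" "x \<in> N"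
  shows "x \<in> w (A \<union> (w B \<inter> N))"
proof -
  have "w A \<subseteq> N"
    using assms by (simp add: cl_subset_star_ideal)
  then have "w (w A \<union> w B) \<inter> N \<subseteq> w (w A \<union> (w B \<inter> N))"
    using modular assms(1) unfolding star_modular_def by simp
  moreover have "w (A \<union> B) \<subseteq> w (w A \<union> w B)"
    using subset_cl by (intro cl_mono) auto
  moreover have "w (w A \<union> (w B \<inter> N)) \<subseteq> w (A \<union> (w B \<inter> N))"
    using cl_mono[of A "A \<union> (w B \<inter> N)"] subset_cl[of "A \<union> (w B \<inter> N)"] by (intro cl_least) auto
  ultimately show ?thesis
    using assms by auto
qed

lemma scale_Un: "c *o (A \<union> B) = c *o A \<union> c *o B"
  by (auto simp: elt_set_times_def)

text \<open>Take \<open>N = w {c}\<close> in the modular law. As \<open>c\<close> is cancellable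
  modulo \<open>C\<close>, the intersection of \<open>C\<close> with \<open>N\<close> lies in
  \<open>w (c *o C)\<close>; so \<open>c * x\<close> lies in \<open>w (c *o (C \<union> X))\<close>,
  and \<open>c\<close> cancels. This replaces computing in the quotient by \<open>C\<close>.\<close>

lemma modular_cancel:
  assumes C: "star_ideal w C" "\<And>x. c * x \<in> C \<Longrightarrow> x \<in> C" and c: "c \<noteq> 0"
    and x: "c * x \<in> w (C \<union> c *o X)"
  shows "x \<in> w (C \<union> X)"
proof -
  have N: "star_ideal w (w {c})" "c \<in> w {c}"
    by (simp_all add: in_cl)
  have "c *o X \<subseteq> w {c}"
    using star_idealD(4)[OF N] by (auto simp: elt_set_times_def)
  then have "c * x \<in> w (c *o X \<union> (w C \<inter> w {c}))"
    using star_idealD(4)[OF N] x by (intro modularD) (auto simp: Un_commute)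
  moreover have "w C \<inter> w {c} \<subseteq> w (c *o C)"
  proof
    fix z assume z: "z \<in> w C \<inter> w {c}"
    then obtain s r where sr: "s \<notin> Q" "s * z = c * r"
      using locally_dvd[of z c] unfolding dvd_def by auto
    have "c * r \<in> C"
      using star_idealD(3)[OF C(1), of z s] z C(1) sr(2) by (simp add: star_ideal_def)
    then have "s * z \<in> w (c *o C)"
      using C(2) sr(2) by (auto intro!: in_cl)
    then show "z \<in> w (c *o C)"
      using saturated sr(1) by blast
  qed
  then have "w (c *o X \<union> (w C \<inter> w {c})) \<subseteq> w (c *o (C \<union> X))"
    using cl_mono[of "c *o C" "c *o (C \<union> X)"] subset_cl[of "c *o (C \<union> X)"]
    by (intro cl_least) (auto simp: scale_Un)
  ultimately show ?thesis
    using cl_cancel[OF c] by blast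
qed

lemma prime_modular_cancel:
  assumes "star_prime w P" "c \<notin> P" "c * x \<in> w (P \<union> c *o X)"
  shows "x \<in> w (P \<union> X)"
proof (rule modular_cancel[OF _ _ _ assms(3)])
  show P: "star_ideal w P"
    using assms(1) by (simp add: star_prime_def)
  show "c \<noteq> 0"
    using star_idealD(1)[OF P] assms(2) by auto
  show "c * y \<in> P \<Longrightarrow> y \<in> P" for y
    using assms(1,2) by (auto simp: star_prime_def prime_ideal_def)
qed

text \<open>Factors equal to \<open>R\<close> may be dropped, and \<open>Q\<close> contains every
  proper closed ideal.\<close>

lemma ex_proper_factorization:
  assumes "star_radical_product w A"
  shows "\<exists>Ks. (\<forall>K\<in>set Ks. star_radical_ideal w K \<and> K \<subseteq> Q \<and> A \<subseteq> K) \<and> A = star_prod_list w Ks"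
proof -
  obtain Js where Js: "\<forall>J\<in>set Js. star_radical_ideal w J" "A = star_prod_list w Js"
    using assms by (auto simp: star_radical_product_def)
  define Ks where "Ks = filter (\<lambda>J. J \<noteq> UNIV) Js"
  have A: "A = star_prod_list w Ks"
    by (simp add: Ks_def Js star_prod_list_filter)
  have rad: "\<forall>K\<in>set Ks. star_radical_ideal w K"
    using Js by (simp add: Ks_def)
  then have sid: "\<forall>K\<in>set Ks. star_ideal w K"
    by (simp add: star_radical_ideal_def)
  show ?thesis
  proof (intro exI conjI ballI)
    fix K assume K: "K \<in> set Ks"
    then have "K \<subseteq> Q"
      using sid by (intro proper_subset_Q) (auto simp: Ks_def)
    then show "star_radical_ideal w K" "K \<subseteq> Q" "A \<subseteq> K"
      using K rad A star_prod_list_subset[OF K sid] by auto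
  qed (rule A)
qed

text \<open>A Nakayama argument by hand. Write \<open>w (P \<union> {y0})\<close> as
  \<open>w (Q * B)\<close>, where \<open>B\<close> is the product of the remaining factors. A single
  product \<open>k * b\<close> outside \<open>w (P \<union> y0 *o Q)\<close> generates this ideal
  modulo \<open>P\<close>, and cancelling \<open>b\<close> shows that \<open>k\<close> generates
  \<open>Q\<close> modulo \<open>P\<close>.\<close>

lemma maximal_principal_mod_prime:
  assumes P: "star_prime w P" and y0: "y0 \<in> Q" "y0 \<notin> P"
    and min: "\<And>P'. star_prime w P' \<Longrightarrow> P \<subseteq> P' \<Longrightarrow> y0 \<in> P' \<Longrightarrow> P' = Q"
    and prod: "star_radical_product w (w (P \<union> {y0}))"
  obtains y where "y \<notin> P" "Q = w (P \<union> {y})"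
proof -
  have P': "star_ideal w P" "P \<subseteq> Q"
    using P proper_subset_Q by (auto simp: star_prime_def prime_ideal_def)
  have sub: "w (P \<union> X) \<subseteq> Q" if "X \<subseteq> Q" for X
    using P' that star_ideal_Q by (simp add: cl_union_least)
  obtain Ks where Ks: "\<And>K. K \<in> set Ks \<Longrightarrow> star_radical_ideal w K \<and> K \<subseteq> Q \<and> w (P \<union> {y0}) \<subseteq> K"
    and eq: "w (P \<union> {y0}) = star_prod_list w Ks"
    using ex_proper_factorization[OF prod] by metis
  \<comment> \<open>By the choice of \<open>Q\<close> no smaller prime contains \<open>K\<close>, so
    the radical ideal \<open>K\<close> agrees with \<open>Q\<close> up to factors outside
    \<open>Q\<close>, and these can be removed from closed ideals.\<close>
  have KQ: "K = Q" if K: "K \<in> set Ks" for K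
  proof
    show "Q \<subseteq> K"
    proof
      fix x assume x: "x \<in> Q"
      have min': "star_prime w P' \<Longrightarrow> K \<subseteq> P' \<Longrightarrow> P' \<subseteq> Q \<Longrightarrow> P' = Q" for P'
        using min[of P'] Ks[OF K] subset_cl[of "P \<union> {y0}"] by blast
      have "star_radical_ideal w K"
        using Ks[OF K] by blast
      then obtain s where "s \<notin> Q" "s * x \<in> K"
        using radical_locally_eq_minimal_prime[OF _ Q min' x] by blast
      then show "x \<in> K"
        using saturated_star_ideal Ks[OF K] by (auto simp: star_radical_ideal_def)
    qed
  qed (use Ks[OF K] in blast)
  obtain B where B: "w (P \<union> {y0}) = w (Q * B)"
  proof (cases Ks)
    case Nil
    then show ?thesis
      using eq sub[of "{y0}"] y0(1) one_notin_Q by auto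
  next
    case (Cons K Ks')
    then show ?thesis
      using that[of "star_prod_list w Ks'"] eq KQ[of K] by (simp add: star_prod_list_Cons)
  qed
  \<comment> \<open>Otherwise \<open>y0\<close> lies in \<open>w (P \<union> y0 *o Q)\<close>, and
    cancelling \<open>y0\<close> modulo \<open>P\<close> puts 1 into \<open>Q\<close>.\<close>
  have "\<exists>k\<in>Q. \<exists>b\<in>B. k * b \<notin> w (P \<union> y0 *o Q)"
  proof (rule ccontr)
    assume "\<not> (\<exists>k\<in>Q. \<exists>b\<in>B. k * b \<notin> w (P \<union> y0 *o Q))"
    then have "w (Q * B) \<subseteq> w (P \<union> y0 *o Q)"
      by (intro cl_least) (auto elim!: set_times_elim)
    then have "y0 * 1 \<in> w (P \<union> y0 *o Q)"
      using B in_cl[of y0 "P \<union> {y0}"] by auto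
    then have "1 \<in> w (P \<union> Q)"
      by (rule prime_modular_cancel[OF P y0(2)])
    then show False
      using sub[of Q] one_notin_Q by auto
  qed
  then obtain k b where kb: "k \<in> Q" "b \<in> B" "k * b \<notin> w (P \<union> y0 *o Q)"
    by blast
  have b: "b \<notin> P"
    using kb(3) star_idealD(3)[OF P'(1), of b k] by (auto intro: in_cl)
  \<comment> \<open>If \<open>y0\<close> were outside this ideal, every \<open>r\<close> with
    \<open>r * y0\<close> inside it would lie in \<open>Q\<close>. The modular law, with this ideal
    as \<open>N\<close>, would then put \<open>k * b\<close> into
    \<open>w (P \<union> y0 *o Q)\<close>.\<close>
  have y0T: "y0 \<in> w (P \<union> {k * b})"
  proof (rule ccontr)
    assume not: "y0 \<notin> w (P \<union> {k * b})"
    let ?T = "w (P \<union> {k * b})"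
    have "k * b \<in> w (P \<union> {y0})"
      unfolding B using kb by (intro in_cl set_times_intro)
    then have "k * b \<in> w (P \<union> (w {y0} \<inter> ?T))"
      by (intro modularD) (auto intro: in_cl)
    moreover have "w {y0} \<inter> ?T \<subseteq> w (y0 *o Q)"
    proof
      fix z assume z: "z \<in> w {y0} \<inter> ?T"
      then obtain s r where sr: "s \<notin> Q" "s * z = y0 * r"
        using locally_dvd[of z y0] unfolding dvd_def by auto
      have "r * y0 \<in> ?T"
        using z sr(2) clD(3)[of z _ s] by (simp add: mult.commute)
      then have "r \<in> Q"
        using saturated[of r y0] not by blast
      then have "s * z \<in> w (y0 *o Q)"
        using sr(2) by (auto intro!: in_cl)
      then show "z \<in> w (y0 *o Q)"
        using saturated sr(1) by blast
    qed
    then have "w (P \<union> (w {y0} \<inter> ?T)) \<subseteq> w (P \<union> y0 *o Q)"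
      using cl_mono[of "y0 *o Q" "P \<union> y0 *o Q"] subset_cl[of "P \<union> y0 *o Q"]
      by (intro cl_least) auto
    ultimately show False
      using kb(3) by blast
  qed
  have "w (P \<union> {y0}) \<subseteq> w (P \<union> {k * b})"
    using y0T subset_cl[of "P \<union> {k * b}"] by (intro cl_least) auto
  then have T: "w (Q * B) \<subseteq> w (P \<union> b *o {k})"
    using B by (simp add: elt_set_times_def mult.commute)
  have "Q \<subseteq> w (P \<union> {k})"
  proof
    fix x assume "x \<in> Q"
    then have "b * x \<in> w (Q * B)"
      using kb(2) by (subst mult.commute) (intro in_cl set_times_intro)
    then show "x \<in> w (P \<union> {k})"
      using T prime_modular_cancel[OF P b] by blast
  qed
  moreover have "w (P \<union> {k}) \<subseteq> Q"
    using sub[of "{k}"] kb(1) by blast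
  ultimately have Qk: "Q = w (P \<union> {k})"
    by blast
  have "k \<notin> P"
  proof
    assume "k \<in> P"
    then have "Q = P"
      using Qk P'(1) by (simp add: insert_absorb star_ideal_def)
    then show False
      using y0 by blast
  qed
  then show ?thesis
    using that Qk by blast
qed

lemma no_prime_below_principal_maximal:
  assumes SP: "\<And>A. star_ideal w A \<Longrightarrow> star_radical_product w A"
    and P: "star_prime w P" and y: "y \<notin> P" "Q = w (P \<union> {y})"
    and j: "j \<in> P" "j \<noteq> 0" "star_radical_ideal w (w {j})"
  shows False
proof -
  have P': "star_ideal w P" "P \<subseteq> Q"
    using P proper_subset_Q by (auto simp: star_prime_def prime_ideal_def)
  have y0: "y \<noteq> 0"
    using y(1) star_idealD(1)[OF P'(1)] by auto
  have yQ: "y \<in> Q"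
    using y(2) by (simp add: in_cl)
  have rad: "x \<in> w {j}" if "x ^ n \<in> w {j}" for x n
    using mem_radical_star_ideal j(3) that by blast
  have jP: "w {j} \<subseteq> P"
    using j(1) P'(1) by (simp add: cl_subset_star_ideal)
  define C where "C = {x. x * y \<in> w {j}}"
  have C: "star_ideal w C"
    unfolding C_def by (rule star_ideal_residual) simp
  have CP: "C \<subseteq> P"
    using jP P y(1) by (auto simp: C_def star_prime_def prime_ideal_def)
  \<comment> \<open>Radicality of \<open>w {j}\<close> makes \<open>y\<close> cancellable modulo
    \<open>C\<close>: a second factor \<open>y\<close> only completes the square of
    \<open>x * y\<close>.\<close>
  have Cy: "x \<in> C" if "y * x \<in> C" for x
  proof -
    have "x * (y * x * y) \<in> w {j}"
      using that clD(3) unfolding C_def by blast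
    then have "(x * y) ^ 2 \<in> w {j}"
      by (simp add: power2_eq_square ac_simps)
    then show ?thesis
      unfolding C_def using rad[of "x * y" 2] by simp
  qed
  have CyQ: "w (C \<union> {y}) \<subseteq> Q"
    using CP P'(2) yQ star_ideal_Q by (auto simp: cl_subset_star_ideal)
  have not_y: "y \<notin> w (C \<union> {y * y})"
  proof
    assume "y \<in> w (C \<union> {y * y})"
    then have "y * 1 \<in> w (P \<union> y *o {y})"
      using cl_mono[of "C \<union> {y * y}" "P \<union> {y * y}"] CP by (auto simp: elt_set_times_def)
    then show False
      using prime_modular_cancel[OF P y(1)] y(2) one_notin_Q by blast
  qed
  \<comment> \<open>The cube of \<open>Q = w (P \<union> {y})\<close> lies in
    \<open>w (P \<union> {y * y * y})\<close>, so cancelling \<open>y * y\<close> modulo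
    \<open>P\<close> would put 1 into \<open>Q\<close>.\<close>
  have not_y2: "y * y \<notin> w (Q * (Q * Q))"
  proof
    let ?Y = "P \<union> {y}"
    assume "y * y \<in> w (Q * (Q * Q))"
    moreover have "w (Q * (Q * Q)) = w (w ?Y * w (w ?Y * w ?Y))"
      by (simp only: cl_times_cl y(2)[symmetric])
    ultimately have "y * y \<in> w (?Y * (?Y * ?Y))"
      by (simp only: cl_times_cl)
    moreover have "?Y * (?Y * ?Y) \<subseteq> P \<union> {y * y * y}"
      using star_idealD(3,4)[OF P'(1)] by (auto elim!: set_times_elim simp: mult.assoc)
    ultimately have "(y * y) * 1 \<in> w (P \<union> (y * y) *o {y})"
      using cl_mono by (auto simp: elt_set_times_def)
    moreover have "y * y \<notin> P"
      using P y(1) by (auto simp: star_prime_def prime_ideal_def)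
    ultimately show False
      using prime_modular_cancel[OF P] y(2) one_notin_Q by blast
  qed
  obtain Ls where Ls: "\<And>L. L \<in> set Ls \<Longrightarrow> star_radical_ideal w L \<and> L \<subseteq> Q \<and> w (C \<union> {y * y}) \<subseteq> L"
    and eq: "w (C \<union> {y * y}) = star_prod_list w Ls"
    using ex_proper_factorization[OF SP[OF star_ideal_cl, of "C \<union> {y * y}"]] by metis
  have yL: "y \<in> L" if "L \<in> set Ls" for L
  proof -
    have "y ^ 2 \<in> L"
      using Ls[OF that] in_cl[of "y * y" "C \<union> {y * y}"] by (auto simp: power2_eq_square)
    then show ?thesis
      using mem_radical_star_ideal Ls[OF that] by blast
  qed
  \<comment> \<open>The empty product is excluded since the ideal lies in \<open>Q\<close>; a single
    factor would be the ideal itself and contain \<open>y\<close>; three factors would put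
    \<open>y * y\<close> into \<open>w (Q * (Q * Q))\<close>.\<close>
  obtain L M where LM: "Ls = [L, M]"
  proof -
    have "Ls \<noteq> []"
    proof
      assume "Ls = []"
      then have "1 \<in> w (C \<union> {y * y})"
        using eq by simp
      moreover have "w (C \<union> {y * y}) \<subseteq> Q"
        using CP P'(2) star_idealD(3)[OF star_ideal_Q yQ] star_ideal_Q by (auto simp: cl_subset_star_ideal)
      ultimately show False
        using one_notin_Q by blast
    qed
    moreover have "Ls \<noteq> [L]" for L
    proof
      assume L: "Ls = [L]"
      then have "star_ideal w L"
        using Ls by (simp add: star_radical_ideal_def)
      then have "w (C \<union> {y * y}) = L"
        using eq L by (simp add: star_prod_list_Cons UNIV_times)
      then show False
        using not_y yL L by simp
    qed
    moreover have "Ls \<noteq> L1 # L2 # L3 # Ls'" for L1 L2 L3 Ls'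
    proof
      assume L: "Ls = L1 # L2 # L3 # Ls'"
      have sub: "L1 \<subseteq> Q" "L2 \<subseteq> Q" "L3 \<subseteq> Q" "star_ideal w L3"
        using L Ls by (auto simp: star_radical_ideal_def)
      have "w (C \<union> {y * y}) = w (L1 * (L2 * (L3 * star_prod_list w Ls')))"
        using eq L by (simp add: star_prod_list_Cons)
      also have "\<dots> \<subseteq> w (Q * (Q * Q))"
        by (intro cl_mono times_mono sub(1,2) order_trans[OF times_subset_left[OF sub(4)] sub(3)])
      finally show False
        using not_y2 in_cl[of "y * y" "C \<union> {y * y}"] by blast
    qed
    ultimately show ?thesis
      using that by (metis neq_Nil_conv)
  qed
  have eq2: "w (C \<union> {y * y}) = w (L * M)"
  proof -
    have "star_ideal w M"
      using LM Ls by (simp add: star_radical_ideal_def)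
    then have "w (L * w (M * UNIV)) = w (L * M)"
      by (simp only: UNIV_times)
    then show ?thesis
      using eq LM by (simp only: star_prod_list_Cons star_prod_list_Nil)
  qed
  have sub: "x \<in> w (C \<union> {y})" if "y * x \<in> L * M" for x
  proof (rule modular_cancel[OF C Cy y0])
    show "y * x \<in> w (C \<union> y *o {y})"
      using that eq2 in_cl[of "y * x" "L * M"] by (simp add: elt_set_times_def)
  qed
  have "L \<subseteq> w (C \<union> {y})"
    using sub yL LM by (auto simp: mult.commute[of y])
  moreover have "M \<subseteq> w (C \<union> {y})"
    using sub yL LM by auto
  ultimately have "w (L * M) \<subseteq> w (w (C \<union> {y}) * w (C \<union> {y}))"
    by (intro cl_mono times_mono)
  then have sq: "C \<subseteq> w ((C \<union> {y}) * (C \<union> {y}))"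
    using eq2 subset_cl[of "C \<union> {y * y}"] by auto
  have prod_sub: "(C \<union> {y}) * (C \<union> {y}) \<subseteq> C * (C \<union> {y}) \<union> {y * y}"
  proof
    fix z assume "z \<in> (C \<union> {y}) * (C \<union> {y})"
    then obtain a b where "a \<in> C \<union> {y}" "b \<in> C \<union> {y}" "z = a * b"
      unfolding set_times_def by blast
    then show "z \<in> C * (C \<union> {y}) \<union> {y * y}"
      using set_times_intro[of a C b "C \<union> {y}"] set_times_intro[of b C a "C \<union> {y}"]
      by (auto simp: mult.commute)
  qed
  \<comment> \<open>The modular law with \<open>N = C\<close> replaces the generator
    \<open>y * y\<close> by \<open>w {y * y} \<inter> C\<close>. If \<open>y * y * r\<close> lies in
    \<open>C\<close>, then so does \<open>y * r\<close>, and the element is a product of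
    \<open>C\<close> with \<open>y\<close>.\<close>
  have CG: "C \<subseteq> w (C * (C \<union> {y}))"
  proof
    fix c assume c: "c \<in> C"
    then have "c \<in> w (C * (C \<union> {y}) \<union> {y * y})"
      using sq cl_mono[OF prod_sub] by blast
    then have "c \<in> w (C * (C \<union> {y}) \<union> (w {y * y} \<inter> C))"
      using c by (intro modularD[OF C] times_subset_left[OF C])
    moreover have "w {y * y} \<inter> C \<subseteq> w (C * (C \<union> {y}))"
    proof
      fix z assume z: "z \<in> w {y * y} \<inter> C"
      then obtain s r where sr: "s \<notin> Q" "s * z = y * y * r"
        using locally_dvd[of z "y * y"] unfolding dvd_def by auto
      have "y * (y * r) \<in> C"
        using star_idealD(3)[OF C, of z s] z sr(2) by (simp add: mult.assoc)
      then have "y * r \<in> C"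
        by (rule Cy)
      then have "(y * r) * y \<in> C * (C \<union> {y})"
        by (intro set_times_intro) auto
      then have "s * z \<in> w (C * (C \<union> {y}))"
        using sr(2) by (auto intro!: in_cl simp: ac_simps)
      then show "z \<in> w (C * (C \<union> {y}))"
        using saturated sr(1) by blast
    qed
    then have "w (C * (C \<union> {y}) \<union> (w {y * y} \<inter> C)) \<subseteq> w (C * (C \<union> {y}))"
      using subset_cl[of "C * (C \<union> {y})"] by (intro cl_least) auto
    ultimately show "c \<in> w (C * (C \<union> {y}))"
      by blast
  qed
  have yC: "y *o C \<subseteq> w {j}"
    by (auto simp: C_def elt_set_times_def mult.commute)
  have "j \<in> C"
    using clD(4)[of j "{j}" y] in_cl[of j "{j}"] by (simp add: C_def)
  moreover have "C * (C \<union> {y}) \<subseteq> y *o C \<union> C * C"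
  proof
    fix z assume "z \<in> C * (C \<union> {y})"
    then obtain a b where "a \<in> C" "b \<in> C \<union> {y}" "z = a * b"
      unfolding set_times_def by blast
    then show "z \<in> y *o C \<union> C * C"
      using set_times_intro[of a C b C] set_times_intro2[of a C y] by (auto simp: mult.commute)
  qed
  ultimately have "j \<in> w (y *o C \<union> C * C)"
    using CG cl_mono by blast
  then have j1: "j \<in> w (y *o C \<union> (w (C * C) \<inter> w {j}))"
    by (intro modularD yC) (auto intro: in_cl)
  \<comment> \<open>Inside the ideal of \<open>j\<close>, an intersection is \<open>j\<close> times
    a residual. Cancelling \<open>j\<close> will show that the two residuals \<open>?D\<close> and
    \<open>?E\<close> together generate everything.\<close>
  have colon: "w A \<inter> w {j} \<subseteq> w (j *o {r. r * j \<in> w A})" for A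
  proof
    fix z assume z: "z \<in> w A \<inter> w {j}"
    then obtain s r where sr: "s \<notin> Q" "s * z = j * r"
      using locally_dvd[of z j] unfolding dvd_def by auto
    have "r * j \<in> w A"
      using clD(3)[of z A s] z sr(2) by (simp add: mult.commute)
    then have "s * z \<in> w (j *o {r. r * j \<in> w A})"
      using sr(2) by (auto intro!: in_cl)
    then show "z \<in> w (j *o {r. r * j \<in> w A})"
      using saturated sr(1) by blast
  qed
  let ?D = "{r. r * j \<in> w (y *o C)}" and ?E = "{r. r * j \<in> w (C * C)}"
  have "y *o C \<union> (w (C * C) \<inter> w {j}) \<subseteq> w (j *o ?D) \<union> w (j *o ?E)"
    using colon[of "y *o C"] colon[of "C * C"] yC subset_cl[of "y *o C"] by blast
  also have "\<dots> \<subseteq> w (j *o (?D \<union> ?E))"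
    by (intro Un_least cl_mono) (auto simp: elt_set_times_def)
  finally have "w (y *o C \<union> (w (C * C) \<inter> w {j})) \<subseteq> w (j *o (?D \<union> ?E))"
    by (rule cl_least)
  then have "j * 1 \<in> w (j *o (?D \<union> ?E))"
    using j1 by auto
  then have "1 \<in> w (?D \<union> ?E)"
    using cl_cancel[OF j(2)] by blast
  \<comment> \<open>Locality turns the sum into an alternative: one of the residuals has an element
    outside \<open>Q\<close>, which acts as a unit.\<close>
  then have "\<not> ?D \<union> ?E \<subseteq> Q"
    using one_notin_Q cl_subset_star_ideal[OF star_ideal_Q] by blast
  then have "j \<in> w (y *o C) \<or> j \<in> w (C * C)"
    using saturated by blast
  then show False
  proof
    assume "j \<in> w (C * C)"
    \<comment> \<open>Each factor \<open>y\<close> moves one factor \<open>C\<close> into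
      \<open>w {j}\<close>; cancelling \<open>j\<close> afterwards leaves
      \<open>y ^ 2 \<in> w {j}\<close>.\<close>
    then have "(y * y) * j \<in> w ((y * y) *o (C * C))"
      by (rule scale_cl)
    moreover have "(y * y) *o (C * C) \<subseteq> w {j} * w {j}"
    proof
      fix z assume "z \<in> (y * y) *o (C * C)"
      then obtain c d where "c \<in> C" "d \<in> C" "z = y * y * (c * d)"
        by (auto simp: elt_set_times_def elim!: set_times_elim)
      then have "c * y \<in> w {j}" "d * y \<in> w {j}" "z = (c * y) * (d * y)"
        by (auto simp: C_def ac_simps)
      then show "z \<in> w {j} * w {j}"
        by (simp add: set_times_intro)
    qed
    ultimately have "(y * y) * j \<in> w (w {j} * w {j})"
      using cl_mono by blast
    moreover have "w (w {j} * w {j}) = w (j *o {j})"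
      by (simp only: cl_times_cl) (simp add: set_times_def elt_set_times_def)
    ultimately have "j * y ^ 2 \<in> w (j *o {j})"
      by (simp add: power2_eq_square mult.commute)
    then have "y ^ 2 \<in> w {j}"
      using cl_cancel[OF j(2)] by blast
    then show False
      using rad[of y 2] jP y(1) by auto
  next
    assume "j \<in> w (y *o C)"
    moreover have "w (y *o C) \<subseteq> w {y}"
      using clD(4)[of y "{y}"] in_cl[of y "{y}"] by (intro cl_least) (auto simp: elt_set_times_def)
    \<comment> \<open>Up to a unit, \<open>u\<close> is the quotient of \<open>j\<close> by
      \<open>y\<close>. It generates \<open>C\<close>, so cancelling \<open>u\<close> in
      \<open>CG\<close> puts 1 into \<open>w (C \<union> {y})\<close>.\<close>
    ultimately obtain s u where su: "s \<notin> Q" "s * j = y * u"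
      using locally_dvd[of j y] unfolding dvd_def by auto
    have u: "u \<in> C" "u \<noteq> 0"
    proof -
      show "u \<in> C"
        using clD(3)[of j "{j}" s] in_cl[of j "{j}"] su(2) by (simp add: C_def mult.commute)
      show "u \<noteq> 0"
        using su j(2) star_idealD(1)[OF star_ideal_Q] by auto
    qed
    have "C \<subseteq> w {u}"
    proof
      fix c assume "c \<in> C"
      then obtain s' a where s': "s' \<notin> Q" "s' * (c * y) = j * a"
        using locally_dvd[of "c * y" j] unfolding dvd_def C_def by auto
      have "y * (s * s' * c) = s * (s' * (c * y))"
        by (simp add: ac_simps)
      also have "\<dots> = (s * j) * a"
        by (simp only: s' mult.assoc)
      also have "\<dots> = y * (u * a)"
        by (simp only: su mult.assoc)
      finally have "s * (s' * c) = u * a"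
        using y0 by (simp add: mult.assoc)
      then have "s * (s' * c) \<in> w {u}"
        using clD(4)[of u "{u}" a] in_cl[of u "{u}"] by simp
      then show "c \<in> w {u}"
        using saturated su(1) s'(1) by blast
    qed
    then have "w (C * (C \<union> {y})) \<subseteq> w (w {u} * (C \<union> {y}))"
      by (intro cl_mono times_mono) auto
    also have "\<dots> = w (u *o (C \<union> {y}))"
    proof -
      have "{u} * (C \<union> {y}) = u *o (C \<union> {y})"
        by (auto simp: set_times_def elt_set_times_def)
      then show ?thesis
        by simp
    qed
    finally have "u * 1 \<in> w (u *o (C \<union> {y}))"
      using CG u(1) by auto
    then have "1 \<in> w (C \<union> {y})"
      using cl_cancel[OF u(2)] by blast
    then show False
      using CyQ one_notin_Q by blast
  qed
qed

end

section \<open>Localization\<close>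

lemma localized_starI: "s \<notin> Q \<Longrightarrow> s * x \<in> star X \<Longrightarrow> x \<in> localized_star star Q X"
  by (auto simp: localized_star_def)

lemma localized_starE:
  assumes "x \<in> localized_star star Q X"
  obtains s where "s \<notin> Q" "s * x \<in> star X"
  using assms by (auto simp: localized_star_def)

context star_closure
begin

context
  fixes Q
  assumes Q: "star_prime star Q"
begin

lemma prime_mult_notin: "s \<notin> Q \<Longrightarrow> t \<notin> Q \<Longrightarrow> s * t \<notin> Q"
  using Q by (auto simp: star_prime_def prime_ideal_def)

lemma prime_one_notin: "1 \<notin> Q"
  using Q star_ideal_eq_UNIV by (auto simp: star_prime_def prime_ideal_def)

lemma star_subset_localized_star: "star X \<subseteq> localized_star star Q X"
  using prime_one_notin by (auto intro: localized_starI[of 1])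

lemma star_ideal_of_localized: "star_ideal (localized_star star Q) A \<Longrightarrow> star_ideal star A"
  using star_subset_localized_star[of A] by (intro star_idealI) (auto simp: star_ideal_def)

text \<open>Finite type reduces closures to finite sets, which have a common denominator because
  \<open>Q\<close> is prime. This is why the localized operation is again a closure.\<close>

lemma common_denominator:
  assumes "finite E" "E \<subseteq> localized_star star Q Y"
  shows "\<exists>s. s \<notin> Q \<and> s *o E \<subseteq> star Y"
  using assms
proof induction
  case empty
  then show ?case
    using prime_one_notin by (auto simp: elt_set_times_def)
next
  case (insert e E)
  obtain s where s: "s \<notin> Q" "s *o E \<subseteq> star Y"
    using insert by auto
  obtain t where t: "t \<notin> Q" "t * e \<in> star Y"
    using insert.prems by (auto elim: localized_starE)
  have "(s * t) * x \<in> star Y" if "x \<in> insert e E" for x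
  proof (cases "x = e")
    case True
    then show ?thesis
      using clD(3)[OF t(2), of s] by (simp add: mult.assoc)
  next
    case False
    then have "s * x \<in> star Y"
      using s(2) that by (auto simp: elt_set_times_def)
    then show ?thesis
      using clD(3)[of "s * x" Y t] by (simp add: ac_simps)
  qed
  then have "(s * t) *o insert e E \<subseteq> star Y"
    by (auto simp: elt_set_times_def)
  then show ?case
    using prime_mult_notin[OF s(1) t(1)] by blast
qed

lemma ideal_closure_localized: "ideal_closure (localized_star star Q)"
proof
  let ?w = "localized_star star Q"
  show "X \<subseteq> ?w X" for X
    using subset_cl star_subset_localized_star by blast
  show "?w X \<subseteq> ?w Y" if XY: "X \<subseteq> ?w Y" for X Y
  proof
    fix x assume "x \<in> ?w X"
    then obtain s where s: "s \<notin> Q" "s * x \<in> star X"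
      by (rule localized_starE)
    then obtain E where E: "E \<subseteq> X" "finite E" "s * x \<in> star E"
      using cl_finitary by blast
    obtain t where t: "t \<notin> Q" "t *o E \<subseteq> star Y"
      using common_denominator[OF E(2)] E(1) XY by blast
    have "t * (s * x) \<in> star (t *o E)"
      using E(3) by (rule scale_cl)
    then have "(t * s) * x \<in> star Y"
      using cl_least[OF t(2)] by (auto simp: mult.assoc)
    then show "x \<in> ?w Y"
      using localized_starI prime_mult_notin[OF t(1) s(1)] by blast
  qed
  show "ring_ideal (?w X)" for X
    unfolding ring_ideal_iff
  proof (intro conjI ballI allI)
    show "0 \<in> ?w X"
      using clD(1) star_subset_localized_star by blast
    fix x assume "x \<in> ?w X"
    then obtain s where s: "s \<notin> Q" "s * x \<in> star X"
      by (rule localized_starE)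
    have "s * (c * x) \<in> star X" for c
      using clD(3)[OF s(2), of c] by (simp add: ac_simps)
    then show "c * x \<in> ?w X" for c
      using localized_starI[OF s(1)] by blast
    fix y assume "y \<in> ?w X"
    then obtain t where t: "t \<notin> Q" "t * y \<in> star X"
      by (rule localized_starE)
    have "t * (s * x) + s * (t * y) \<in> star X"
      by (rule clD(2)[OF clD(3)[OF s(2)] clD(3)[OF t(2)]])
    then have "(t * s) * (x + y) \<in> star X"
      by (simp add: algebra_simps)
    then show "x + y \<in> ?w X"
      using localized_starI prime_mult_notin[OF t(1) s(1)] by blast
  qed
  show "c * x \<in> ?w (c *o X) \<longleftrightarrow> x \<in> ?w X" if "c \<noteq> 0" for c x X
    unfolding localized_star_def mem_Collect_eq using cl_cancel[OF that, of _ X]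
    by (simp add: mult.left_commute[of _ c])
  show "\<exists>E\<subseteq>X. finite E \<and> x \<in> ?w E" if x: "x \<in> ?w X" for x X
  proof -
    obtain s where "s \<notin> Q" "s * x \<in> star X"
      using x by (rule localized_starE)
    then show ?thesis
      using cl_finitary localized_starI by meson
  qed
qed

interpretation w: ideal_closure "localized_star star Q"
  by (rule ideal_closure_localized)

lemma star_prime_localized:
  assumes "star_prime star P" "P \<subseteq> Q"
  shows "star_prime (localized_star star Q) P"
proof -
  have "localized_star star Q P \<subseteq> P"
    using assms by (auto simp: localized_star_def star_prime_def star_ideal_def prime_ideal_def)
  then show ?thesis
    using w.star_idealI assms(1) by (simp add: star_prime_def)
qed

text \<open>Modularity is inherited because ideals closed for the localization are closed for
  \<open>star\<close>, and a denominator of \<open>x\<close> keeps \<open>s * x\<close> inside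
  \<open>N\<close>.\<close>

lemma local_modular_closure_localized:
  assumes "star_modular star"
  shows "local_modular_closure (localized_star star Q) Q"
proof (intro local_modular_closure.intro local_modular_closure_axioms.intro ideal_closure_localized)
  let ?w = "localized_star star Q"
  show "star_prime ?w Q"
    using star_prime_localized[OF Q] by simp
  show "x \<in> ?w X" if s: "s \<notin> Q" "s * x \<in> ?w X" for s x X
  proof -
    obtain t where t: "t \<notin> Q" "t * (s * x) \<in> star X"
      using s(2) by (rule localized_starE)
    then show ?thesis
      using localized_starI[of "t * s"] prime_mult_notin[OF t(1) s(1)] by (simp add: mult.assoc)
  qed
  show "\<exists>s. s \<notin> Q \<and> c dvd s * x" if "x \<in> ?w {c}" for x c
    using that by (auto simp: localized_star_def in_star_singleton)
  show "star_modular ?w"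
    unfolding star_modular_def
  proof (intro allI impI subsetI)
    fix I J N x
    assume *: "star_ideal ?w I \<and> star_ideal ?w J \<and> star_ideal ?w N \<and> I \<subseteq> N"
      and x: "x \<in> ?w (I \<union> J) \<inter> N"
    obtain s where s: "s \<notin> Q" "s * x \<in> star (I \<union> J)"
      using x by (auto elim: localized_starE)
    have "s * x \<in> N"
      using x * w.star_idealD(3)[of N x s] by blast
    then have "s * x \<in> star (I \<union> (J \<inter> N))"
      using assms * s(2) star_ideal_of_localized unfolding star_modular_def by blast
    then show "x \<in> ?w (I \<union> (J \<inter> N))"
      using s(1) by (rule localized_starI[rotated])
  qed
qed

lemma localized_star_star: "localized_star star Q (star X) = localized_star star Q X"
  by (simp add: localized_star_def)

lemma localized_radical:
  assumes "star_radical_ideal star J"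
  shows "star_radical_ideal (localized_star star Q) (localized_star star Q J)"
proof -
  have J: "star J = J"
    using assms by (simp add: star_radical_ideal_def star_ideal_def)
  have "x \<in> localized_star star Q J" if x: "x ^ n \<in> localized_star star Q J" for x n
  proof -
    obtain s where s: "s \<notin> Q" "s * x ^ n \<in> star J"
      using x by (rule localized_starE)
    then have "(s ^ n * x) * (s * x ^ n) \<in> J"
      using star_idealD(3)[of J] assms J by (simp add: star_radical_ideal_def)
    then have "(s * x) ^ Suc n \<in> J"
      by (simp add: power_mult_distrib ac_simps)
    then have "s * x \<in> star J"
      using mem_radical_star_ideal[OF assms] J by blast
    then show ?thesis
      using s(1) by (rule localized_starI[rotated])
  qed
  then have "ideal_radical (localized_star star Q J) = localized_star star Q J"
    using subset_radical by (auto simp: ideal_radical_def)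
  then show ?thesis
    by (simp add: star_radical_ideal_def)
qed

lemma localized_star_prod_list:
  "star_prod_list (localized_star star Q) (map (localized_star star Q) Js) =
    localized_star star Q (star_prod_list star Js)"
proof (induction Js)
  case Nil
  then show ?case
    using w.subset_cl[of UNIV] by auto
next
  case (Cons J Js)
  then show ?case
    by (simp add: w.star_prod_list_Cons star_prod_list_Cons localized_star_star)
qed

lemma localized_SP:
  assumes "star_SP_domain star" "star_ideal (localized_star star Q) A"
  shows "star_radical_product (localized_star star Q) A"
proof -
  obtain Js where Js: "\<forall>J\<in>set Js. star_radical_ideal star J" "A = star_prod_list star Js"
    using assms star_ideal_of_localized unfolding star_SP_domain_def star_radical_product_def by blast
  have "A = star_prod_list (localized_star star Q) (map (localized_star star Q) Js)"
    using assms(2) Js(2) by (simp only: localized_star_prod_list star_ideal_def)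
  then show ?thesis
    unfolding star_radical_product_def
    using Js(1) localized_radical by (intro exI[of _ "map (localized_star star Q) Js"]) auto
qed

text \<open>At \<open>Q\<close> an invertible ideal has a single local generator, so it has the same
  localized closure as \<open>{j}\<close>; radicality survives localization.\<close>

lemma localized_invertible_radical:
  assumes "star_invertible star J" "star_radical_ideal star J"
  obtains j where "j \<in> J" "j \<noteq> 0" "star_radical_ideal (localized_star star Q) (localized_star star Q {j})"
proof -
  obtain j s where j: "j \<in> J" "j \<noteq> 0" "s \<notin> Q" "\<And>x. x \<in> J \<Longrightarrow> j dvd s * x"
    using star_invertible_locally_principal[OF assms(1) Q] by blast
  have "J \<subseteq> localized_star star Q {j}"
    using j(3,4) by (auto simp: localized_star_def in_star_singleton)
  then have "localized_star star Q J = localized_star star Q {j}"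
    using j(1) by (intro equalityI w.cl_least) (auto intro: w.in_cl)
  then show ?thesis
    using that j localized_radical[OF assms(2)] by simp
qed

end

section \<open>Minimal primes, and maximality of nonzero primes in SP-domains\<close>

lemma star_prime_Inter_chain:
  assumes "\<C> \<noteq> {}" "\<And>P. P \<in> \<C> \<Longrightarrow> star_prime star P"
    and chain: "\<And>P P'. P \<in> \<C> \<Longrightarrow> P' \<in> \<C> \<Longrightarrow> P \<subseteq> P' \<or> P' \<subseteq> P"
  shows "star_prime star (\<Inter>\<C>)"
proof -
  have "star_ideal star (\<Inter>\<C>)"
    using assms(2) by (intro star_ideal_Inter) (simp add: star_prime_def)
  moreover have "\<Inter>\<C> \<noteq> UNIV"
    using assms(1,2) by (auto simp: star_prime_def prime_ideal_def)
  moreover have "a \<in> \<Inter>\<C> \<or> b \<in> \<Inter>\<C>" if ab: "a * b \<in> \<Inter>\<C>" for a b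
  proof (rule ccontr)
    assume "\<not> (a \<in> \<Inter>\<C> \<or> b \<in> \<Inter>\<C>)"
    then obtain P P' where PP: "P \<in> \<C>" "a \<notin> P" "P' \<in> \<C>" "b \<notin> P'"
      by blast
    then obtain P0 where "P0 \<in> \<C>" "a \<notin> P0" "b \<notin> P0"
      using chain[of P P'] by blast
    then show False
      using ab assms(2)[of P0] by (auto simp: star_prime_def prime_ideal_def)
  qed
  ultimately show ?thesis
    using star_ideal_ring_ideal by (auto simp: star_prime_def prime_ideal_def)
qed

lemma ex_minimal_prime_between:
  assumes M: "star_prime star M" "A \<subseteq> M"
  obtains Q where "star_prime star Q" "A \<subseteq> Q" "Q \<subseteq> M"
    "\<And>P. star_prime star P \<Longrightarrow> A \<subseteq> P \<Longrightarrow> P \<subseteq> Q \<Longrightarrow> P = Q"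
proof -
  define \<P> where "\<P> = {P. star_prime star P \<and> A \<subseteq> P \<and> P \<subseteq> M}"
  \<comment> \<open>Passing to complements turns the search for a minimal prime into one for a
    maximal set.\<close>
  have "\<exists>Q\<in>uminus ` \<P>. \<forall>P\<in>uminus ` \<P>. Q \<subseteq> P \<longrightarrow> P = Q"
  proof (rule subset_Zorn_nonempty)
    show "uminus ` \<P> \<noteq> {}"
      using M by (auto simp: \<P>_def)
    fix \<C> assume C: "\<C> \<noteq> {}" "subset.chain (uminus ` \<P>) \<C>"
    have sub: "uminus ` \<C> \<subseteq> \<P>"
      using C(2) by (auto simp: subset.chain_def)
    have chain: "X \<subseteq> Y \<or> Y \<subseteq> X" if "X \<in> \<C>" "Y \<in> \<C>" for X Y
      using C(2) that by (auto simp: subset_chain_def)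
    have "star_prime star (\<Inter>(uminus ` \<C>))"
    proof (rule star_prime_Inter_chain)
      show "P \<subseteq> P' \<or> P' \<subseteq> P" if "P \<in> uminus ` \<C>" "P' \<in> uminus ` \<C>" for P P'
        using that chain by (metis Compl_subset_Compl_iff imageE)
    qed (use C(1) sub in \<open>auto simp: \<P>_def\<close>)
    then have "\<Inter>(uminus ` \<C>) \<in> \<P>"
      using C(1) sub unfolding \<P>_def by blast
    moreover have "\<Union>\<C> = - \<Inter>(uminus ` \<C>)"
      by auto
    ultimately show "\<Union>\<C> \<in> uminus ` \<P>"
      by blast
  qed
  then obtain Q where Q: "Q \<in> \<P>" "\<And>P. P \<in> \<P> \<Longrightarrow> P \<subseteq> Q \<Longrightarrow> P = Q"
    by auto
  show ?thesis
  proof (rule that)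
    show "P = Q" if "star_prime star P" "A \<subseteq> P" "P \<subseteq> Q" for P
      using that Q(1) by (intro Q(2)) (auto simp: \<P>_def)
  qed (use Q(1) in \<open>auto simp: \<P>_def\<close>)
qed

lemma star_invertible_prod_list_factor:
  "star_invertible star (star_prod_list star Js) \<Longrightarrow> J \<in> set Js \<Longrightarrow> star_ideal star J \<Longrightarrow>
    star_invertible star J"
proof (induction Js)
  case (Cons A Js)
  have A: "star_invertible star (star (star A * star_prod_list star Js))"
    using Cons.prems(1) by (simp add: star_prod_list_Cons)
  then have "star_invertible star (star (star_prod_list star Js * star A))"
    by (simp only: mult.commute)
  then have "star_invertible star (star_prod_list star Js)"
    by (rule star_invertible_factor) simp
  moreover have "star_invertible star (star A)"
    using A by (rule star_invertible_factor) simp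
  ultimately show ?case
    using Cons by (auto simp: star_ideal_def)
qed simp

text \<open>Factors of a nonzero principal ideal are invertible, and a prime above the product
  contains one of them.\<close>

lemma prime_contains_invertible_radical:
  assumes P: "star_prime star P" "x \<in> P" and x: "x \<noteq> 0"
    and prod: "star_radical_product star (star {x})"
  shows "\<exists>J\<subseteq>P. star_invertible star J \<and> star_radical_ideal star J"
proof -
  obtain Js where Js: "\<forall>J\<in>set Js. star_radical_ideal star J" "star {x} = star_prod_list star Js"
    using prod unfolding star_radical_product_def by blast
  have "star {x} \<subseteq> P"
    using P by (auto simp: star_prime_def cl_subset_star_ideal)
  then obtain J where J: "J \<in> set Js" "J \<subseteq> P"
    using prime_contains_factor[of P Js] P(1) Js(2) by (auto simp: star_prime_def)
  have "star_invertible star (star_prod_list star Js)"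
    using star_invertible_singleton[OF x] Js(2) by simp
  moreover have "star_ideal star J"
    using Js(1) J(1) by (simp add: star_radical_ideal_def)
  ultimately have "star_invertible star J"
    using J(1) star_invertible_prod_list_factor by blast
  then show ?thesis
    using J Js by blast
qed

text \<open>The localization is taken at a prime \<open>Q\<close> minimal over \<open>P\<close> and
  \<open>y0\<close>, not at \<open>M\<close>: minimality makes the factors of
  \<open>w (P \<union> {y0})\<close> all equal to \<open>Q\<close>.\<close>

lemma SP_imp_prime_maximal:
  assumes modular: "star_modular star" and SP: "star_SP_domain star"
    and P: "star_prime star P" "P \<noteq> {0}"
  shows "star_maximal star P"
proof -
  have P': "star_ideal star P" "P \<noteq> UNIV"
    using P by (auto simp: star_prime_def prime_ideal_def)
  then obtain M where M: "star_maximal star M" "star_prime star M" "P \<subseteq> M"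
    by (rule ex_star_maximal)
  have "P = M"
  proof (rule ccontr)
    assume "P \<noteq> M"
    then obtain y0 where y0: "y0 \<in> M" "y0 \<notin> P"
      using M(3) by blast
    have "P \<union> {y0} \<subseteq> M"
      using M(3) y0(1) by blast
    then obtain Q where Q: "star_prime star Q" "P \<union> {y0} \<subseteq> Q" "Q \<subseteq> M"
      and min: "\<And>P'. star_prime star P' \<Longrightarrow> P \<union> {y0} \<subseteq> P' \<Longrightarrow> P' \<subseteq> Q \<Longrightarrow> P' = Q"
      by (rule ex_minimal_prime_between[OF M(2)]) (rule that)
    define w where "w = localized_star star Q"
    interpret w: local_modular_closure w Q
      unfolding w_def by (rule local_modular_closure_localized[OF Q(1) modular])
    have SPw: "star_radical_product w A" if "star_ideal w A" for A
      using localized_SP[OF Q(1) SP] that unfolding w_def .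
    have Pw: "star_prime w P"
      unfolding w_def using star_prime_localized[OF Q(1) P(1)] Q(2) by blast
    obtain x where x: "x \<in> P" "x \<noteq> 0"
      using nonzero_star_ideal P(2) P'(1) by blast
    have "star_radical_product star (star {x})"
      using SP by (simp add: star_SP_domain_def)
    then obtain J where J: "J \<subseteq> P" "star_invertible star J" "star_radical_ideal star J"
      using prime_contains_invertible_radical[OF P(1) x] by blast
    then obtain j where j: "j \<in> J" "j \<noteq> 0" "star_radical_ideal w (w {j})"
      unfolding w_def using localized_invertible_radical[OF Q(1)] by blast
    have minw: "P' = Q" if "star_prime w P'" "P \<subseteq> P'" "y0 \<in> P'" for P'
    proof (rule min)
      show "star_prime star P'"
        using that(1) star_ideal_of_localized[OF Q(1)] by (simp add: star_prime_def w_def)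
      show "P' \<subseteq> Q"
        using that(1) w.proper_subset_Q[of P'] by (simp add: star_prime_def prime_ideal_def)
    qed (use that in auto)
    obtain y where "y \<notin> P" "Q = w (P \<union> {y})"
      using w.maximal_principal_mod_prime[OF Pw _ y0(2) minw SPw] Q(2) by auto
    then show False
      using w.no_prime_below_principal_maximal[OF SPw Pw] j J(1) by blast
  qed
  then show ?thesis
    using M(1) by simp
qed

end

section \<open>Valuations\<close>

lemma enat_leI:
  assumes "\<And>k. enat k \<le> a \<Longrightarrow> enat k \<le> b"
  shows "a \<le> b"
proof (cases b)
  case (enat n)
  then have "\<not> enat (Suc n) \<le> a"
    using assms[of "Suc n"] by auto
  then show ?thesis
    using enat by (cases a) auto
qed simp

context ideal_closure
begin

lemma star_prod_list_append:
  "star_prod_list cl (Js @ Ks) = cl (star_prod_list cl Js * star_prod_list cl Ks)"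
  by (simp add: star_prod_list_def)

lemma star_prod_list_single: "star_ideal cl J \<Longrightarrow> star_prod_list cl [J] = J"
  by (simp add: star_prod_list_Cons UNIV_times del: cl_times_cl)

text \<open>If no product lay in \<open>A\<close>, the finite generating sets of products would form
  a multiplicative family avoidable by a prime above \<open>A\<close>, against the cover. The lemma
  gives both the bounds for values and the compactness of hulls.\<close>

lemma product_of_prime_cover_subset:
  assumes A: "star_ideal cl A" and fin: "\<And>F. F \<in> \<F> \<Longrightarrow> star_fin_gen cl F"
    and cover: "\<And>P. star_prime cl P \<Longrightarrow> A \<subseteq> P \<Longrightarrow> \<exists>F\<in>\<F>. F \<subseteq> P"
  shows "\<exists>Js. set Js \<subseteq> \<F> \<and> star_prod_list cl Js \<subseteq> A"
proof (rule ccontr)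
  assume not: "\<nexists>Js. set Js \<subseteq> \<F> \<and> star_prod_list cl Js \<subseteq> A"
  define \<S> where "\<S> = {E. finite E \<and> (\<exists>Js. set Js \<subseteq> \<F> \<and> cl E = star_prod_list cl Js)}"
  have ne: "{1} \<in> \<S>"
    unfolding \<S>_def by (auto intro: exI[of _ "[]"])
  have fin': "finite E \<and> \<not> E \<subseteq> A" if "E \<in> \<S>" for E
    using that not cl_subset_star_ideal[OF A, of E] unfolding \<S>_def by auto
  have mult: "\<exists>G\<in>\<S>. G \<subseteq> cl (E * F)" if EF: "E \<in> \<S>" "F \<in> \<S>" for E F
  proof -
    obtain Js Ks where JK: "finite E" "set Js \<subseteq> \<F>" "cl E = star_prod_list cl Js"
      "finite F" "set Ks \<subseteq> \<F>" "cl F = star_prod_list cl Ks"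
      using EF unfolding \<S>_def by blast
    have "cl (E * F) = cl (cl E * cl F)"
      by (simp only: cl_times_cl)
    then have "cl (E * F) = star_prod_list cl (Js @ Ks)"
      by (simp only: JK star_prod_list_append)
    moreover have "set (Js @ Ks) \<subseteq> \<F>" "finite (E * F)"
      using JK by (simp_all add: finite_set_times)
    ultimately have "E * F \<in> \<S>"
      unfolding \<S>_def by blast
    then show ?thesis
      using subset_cl by blast
  qed
  obtain P where P: "star_prime cl P" "A \<subseteq> P" "\<And>E. E \<in> \<S> \<Longrightarrow> \<not> E \<subseteq> P"
    using ex_prime_avoiding[OF A fin' _ mult] ne by (metis empty_iff)
  obtain F where F: "F \<in> \<F>" "F \<subseteq> P"
    using cover[OF P(1,2)] by blast
  obtain E where E: "E \<subseteq> F" "finite E" "F = cl E"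
    using fin[OF F(1)] unfolding star_fin_gen_def by blast
  have "cl E = star_prod_list cl [F]"
    using E(3) star_prod_list_single[of F] by simp
  then have "E \<in> \<S>"
    unfolding \<S>_def using E(2) F(1) by (auto intro: exI[of _ "[F]"])
  then show False
    using P(3) E(1) F(2) by blast
qed

end

section \<open>Discrete valuations under condition (3)\<close>

locale star_closure_dim_one = star_closure +
  assumes prime_maximal: "star_prime star P \<Longrightarrow> P \<noteq> {0} \<Longrightarrow> star_maximal star P"
    and prime_contains: "star_prime star P \<Longrightarrow> P \<noteq> {0} \<Longrightarrow>
      \<exists>J\<subseteq>P. star_invertible star J \<and> star_radical_ideal star J"
begin

text \<open>In a field \<open>{0}\<close> is maximal but has no uniformizer, so it is excluded here;
  in all other domains these are exactly the maximal star-ideals.\<close>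

definition place :: "'a set \<Rightarrow> bool" where
  "place M \<longleftrightarrow> star_maximal star M \<and> M \<noteq> {0}"

lemma place_prime: "place M \<Longrightarrow> star_prime star M"
  by (simp add: place_def star_maximal_prime)

lemma place_star_ideal: "place M \<Longrightarrow> star_ideal star M"
  by (simp add: place_def star_maximal_def)

lemma place_mult: "place M \<Longrightarrow> s * t \<in> M \<longleftrightarrow> s \<in> M \<or> t \<in> M"
  using place_prime[of M] star_idealD(3,4)[OF place_star_ideal, of M]
  by (auto simp: star_prime_def prime_ideal_def)

lemma place_one: "place M \<Longrightarrow> 1 \<notin> M"
  by (simp add: prime_one_notin place_prime)

lemma place_power: "place M \<Longrightarrow> x ^ n \<in> M \<Longrightarrow> x \<in> M"
  by (induction n) (auto simp: place_mult place_one)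

lemma prime_unique_below_place:
  assumes "place M" "star_prime star P" "P \<noteq> {0}" "P \<subseteq> M"
  shows "P = M"
  using prime_maximal[OF assms(2,3)] assms(1,4) by (auto simp: star_maximal_def place_def)

lemma ex_place:
  assumes "star_ideal star A" "A \<noteq> UNIV" "A \<noteq> {0}"
  obtains M where "place M" "A \<subseteq> M"
proof -
  obtain M where "star_maximal star M" "star_prime star M" "A \<subseteq> M"
    using ex_star_maximal[OF assms(1,2)] .
  moreover from this have "M \<noteq> {0}"
    using assms star_idealD(1) by blast
  ultimately show ?thesis
    using that by (simp add: place_def)
qed

lemma radical_locally_eq_place:
  assumes M: "place M" and J: "star_radical_ideal star J" "J \<noteq> {0}" "J \<subseteq> M" and x: "x \<in> M"
  obtains s where "s \<notin> M" "s * x \<in> J"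
proof (rule radical_locally_eq_minimal_prime[OF J(1) place_prime[OF M] _ x])
  fix P assume P: "star_prime star P" "J \<subseteq> P" "P \<subseteq> M"
  have "0 \<in> J"
    using J(1) star_idealD(1) by (simp add: star_radical_ideal_def)
  then have "P \<noteq> {0}"
    using J(2) P(2) by blast
  then show "P = M"
    using prime_unique_below_place[OF M P(1)] P(3) by blast
qed (rule that)

text \<open>An invertible radical ideal inside \<open>M\<close> is locally principal, and locally
  equal to \<open>M\<close> because no smaller prime contains it. So its local generator generates
  \<open>M\<close>.\<close>

lemma ex_uniformizer:
  assumes M: "place M"
  shows "\<exists>a. a \<in> M \<and> a \<noteq> 0 \<and> (\<forall>x\<in>M. \<exists>s. s \<notin> M \<and> a dvd s * x)"
proof -
  obtain J where J: "J \<subseteq> M" "star_invertible star J" "star_radical_ideal star J"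
    using prime_contains[OF place_prime[OF M]] M by (auto simp: place_def)
  obtain a s where a: "a \<in> J" "a \<noteq> 0" "s \<notin> M" "\<And>x. x \<in> J \<Longrightarrow> a dvd s * x"
    using star_invertible_locally_principal[OF J(2) place_prime[OF M]] by blast
  have "\<exists>s. s \<notin> M \<and> a dvd s * x" if "x \<in> M" for x
  proof -
    obtain t where t: "t \<notin> M" "t * x \<in> J"
      using radical_locally_eq_place[OF M J(3) star_invertible_nonzero[OF J(2)] J(1) \<open>x \<in> M\<close>] .
    then have "a dvd (s * t) * x"
      using a(4)[of "t * x"] by (simp add: mult.assoc)
    then show ?thesis
      using t(1) a(3) place_mult[OF M] by blast
  qed
  then show ?thesis
    using a J(1) by blast
qed

definition uniformizer :: "'a set \<Rightarrow> 'a" where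
  "uniformizer M = (SOME a. a \<in> M \<and> a \<noteq> 0 \<and> (\<forall>x\<in>M. \<exists>s. s \<notin> M \<and> a dvd s * x))"

lemma uniformizer:
  assumes "place M"
  shows "uniformizer M \<in> M" "uniformizer M \<noteq> 0" "x \<in> M \<Longrightarrow> \<exists>s. s \<notin> M \<and> uniformizer M dvd s * x"
  using someI_ex[OF ex_uniformizer[OF assms]] unfolding uniformizer_def by blast+

text \<open>The \<open>k\<close>-th symbolic power of \<open>M\<close>, that is, the contraction of
  the \<open>k\<close>-th power of the maximal ideal of the localization.\<close>

definition level :: "'a set \<Rightarrow> nat \<Rightarrow> 'a set" where
  "level M k = localized_star star M {uniformizer M ^ k}"

lemma in_level: "x \<in> level M k \<longleftrightarrow> (\<exists>s. s \<notin> M \<and> uniformizer M ^ k dvd s * x)"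
  by (simp add: level_def localized_star_def in_star_singleton)

lemma star_ideal_level: "place M \<Longrightarrow> star_ideal star (level M k)"
  using star_ideal_of_localized[OF place_prime] ideal_closure.star_ideal_cl[OF ideal_closure_localized]
  unfolding level_def by (simp add: place_prime)

lemma level_0: "place M \<Longrightarrow> level M 0 = UNIV"
  by (auto simp: in_level intro!: exI[of _ 1] place_one)

lemma level_antimono: "k \<le> l \<Longrightarrow> level M l \<subseteq> level M k"
  unfolding in_level subset_iff by (meson dvd_trans le_imp_power_dvd)

text \<open>Such an equation says that \<open>x\<close> has value \<open>m\<close> at \<open>M\<close>.\<close>

lemma in_level_iff:
  assumes M: "place M" and st: "s \<notin> M" "t \<notin> M" and eq: "s * x = uniformizer M ^ m * t"
  shows "x \<in> level M k \<longleftrightarrow> k \<le> m"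
proof
  assume "k \<le> m"
  then show "x \<in> level M k"
    unfolding in_level using st(1) eq by (metis dvd_mult2 le_imp_power_dvd)
next
  let ?a = "uniformizer M"
  assume "x \<in> level M k"
  then obtain u r where u: "u \<notin> M" "u * x = ?a ^ k * r"
    unfolding in_level dvd_def by blast
  show "k \<le> m"
  proof (rule ccontr)
    assume "\<not> k \<le> m"
    then have k: "k = m + Suc (k - Suc m)"
      by simp
    have "?a ^ m * (u * t) = u * (s * x)"
      by (simp only: eq mult.left_commute)
    also have "\<dots> = s * (u * x)"
      by (simp only: mult.left_commute)
    also have "\<dots> = s * (?a ^ (m + Suc (k - Suc m)) * r)"
      by (simp only: u(2) k[symmetric])
    also have "\<dots> = ?a ^ m * (?a * (?a ^ (k - Suc m) * (s * r)))"
      by (simp add: power_add ac_simps)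
    finally have "u * t = ?a * (?a ^ (k - Suc m) * (s * r))"
      using uniformizer(2)[OF M] by simp
    then have "u * t \<in> M"
      using uniformizer(1)[OF M] place_mult[OF M] by simp
    then show False
      using u(1) st(2) place_mult[OF M] by blast
  qed
qed

lemma level_decomposition:
  assumes M: "place M" and x: "x \<in> level M m" "x \<notin> level M (Suc m)"
  obtains s t where "s \<notin> M" "t \<notin> M" "s * x = uniformizer M ^ m * t"
proof -
  obtain s t where st: "s \<notin> M" "s * x = uniformizer M ^ m * t"
    using x(1) unfolding in_level dvd_def by blast
  have "t \<notin> M"
  proof
    assume "t \<in> M"
    then obtain u r where u: "u \<notin> M" "u * t = uniformizer M * r"
      using uniformizer(3)[OF M] unfolding dvd_def by blast
    have "(u * s) * x = uniformizer M ^ m * (u * t)"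
      by (simp only: mult.assoc st(2) mult.left_commute)
    also have "\<dots> = uniformizer M ^ Suc m * r"
      by (simp only: u(2) power_Suc2 mult.assoc)
    finally have "x \<in> level M (Suc m)"
      unfolding in_level using place_mult[OF M] u(1) st(1) by (metis dvd_triv_left)
    then show False
      using x(2) by blast
  qed
  then show ?thesis
    using that st by blast
qed

lemma ex_last_level:
  assumes M: "place M" and "\<not> X \<subseteq> level M k"
  obtains m where "X \<subseteq> level M m" "\<not> X \<subseteq> level M (Suc m)"
proof -
  define m where "m = (LEAST k. \<not> X \<subseteq> level M k)"
  have m: "\<not> X \<subseteq> level M m"
    unfolding m_def using assms(2) by (rule LeastI)
  then obtain n where n: "m = Suc n"
    using level_0[OF M] by (cases m) auto
  then have "X \<subseteq> level M n"
    using not_less_Least[of n "\<lambda>k. \<not> X \<subseteq> level M k"] unfolding m_def by auto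
  then show ?thesis
    using that m n by blast
qed

text \<open>Elements of exact values \<open>m\<close> and \<open>n\<close> have a product of exact
  value \<open>m + n\<close>, so the complement of the intersection is multiplicative.\<close>

lemma star_prime_Inter_level:
  assumes M: "place M"
  shows "star_prime star (\<Inter>k. level M k)"
proof -
  let ?P = "\<Inter>k. level M k"
  have "star_ideal star ?P"
    using star_ideal_level[OF M] by (intro star_ideal_Inter) auto
  moreover have "1 \<notin> level M 1"
    using in_level_iff[OF M place_one[OF M] place_one[OF M], of 1 0 1] by simp
  moreover have "x \<in> ?P \<or> y \<in> ?P" if xy: "x * y \<in> ?P" for x y
  proof (rule ccontr)
    assume "\<not> (x \<in> ?P \<or> y \<in> ?P)"
    then obtain k l where "\<not> {x} \<subseteq> level M k" "\<not> {y} \<subseteq> level M l"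
      by blast
    then obtain m n where mn: "{x} \<subseteq> level M m" "\<not> {x} \<subseteq> level M (Suc m)"
      "{y} \<subseteq> level M n" "\<not> {y} \<subseteq> level M (Suc n)"
      using ex_last_level[OF M] by metis
    obtain s t where "s \<notin> M" "t \<notin> M" "s * x = uniformizer M ^ m * t"
      using level_decomposition[OF M, of x m] mn(1,2) by blast
    moreover obtain s' t' where "s' \<notin> M" "t' \<notin> M" "s' * y = uniformizer M ^ n * t'"
      using level_decomposition[OF M, of y n] mn(3,4) by blast
    ultimately have st: "s \<notin> M" "t \<notin> M" "s * x = uniformizer M ^ m * t"
      "s' \<notin> M" "t' \<notin> M" "s' * y = uniformizer M ^ n * t'"
      by blast+
    have "(s * s') * (x * y) = (s * x) * (s' * y)"
      by (simp only: ac_simps)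
    also have "\<dots> = uniformizer M ^ (m + n) * (t * t')"
      by (simp only: st power_add ac_simps)
    finally have "x * y \<notin> level M (Suc (m + n))"
      using in_level_iff[OF M, of "s * s'" "t * t'" "x * y" "m + n"] st place_mult[OF M] by auto
    then show False
      using xy by blast
  qed
  ultimately show ?thesis
    using star_ideal_ring_ideal by (auto simp: star_prime_def prime_ideal_def)
qed

lemma level_1: "place M \<Longrightarrow> level M 1 = M"
proof
  assume M: "place M"
  show "level M 1 \<subseteq> M"
  proof
    fix x assume "x \<in> level M 1"
    then obtain s r where "s \<notin> M" "s * x = uniformizer M * r"
      unfolding in_level dvd_def by auto
    then show "x \<in> M"
      using place_mult[OF M] uniformizer(1)[OF M] by metis
  qed
  show "M \<subseteq> level M 1"
    using uniformizer(3)[OF M] by (auto simp: in_level)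
qed

text \<open>Dimension one stands in for Krull's intersection theorem: a nonzero prime inside
  \<open>M\<close> is \<open>M\<close> itself, but the uniformizer is not in
  \<open>level M 2\<close>.\<close>

lemma Inter_level:
  assumes M: "place M"
  shows "(\<Inter>k. level M k) = {0}"
proof (rule ccontr)
  let ?P = "\<Inter>k. level M k"
  assume "?P \<noteq> {0}"
  moreover have "?P \<subseteq> M"
    using level_1[OF M] by blast
  ultimately have "?P = M"
    using prime_unique_below_place[OF M star_prime_Inter_level[OF M]] by blast
  then have "uniformizer M \<in> level M 2"
    using uniformizer(1)[OF M] by blast
  then show False
    using in_level_iff[OF M place_one[OF M] place_one[OF M], of "uniformizer M" 1 2] by simp
qed

text \<open>The least valuation at \<open>M\<close> of an element of \<open>X\<close>; for a place
  \<open>M\<close> it is \<open>\<infinity>\<close> exactly when \<open>X\<close> has no nonzero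
  element.\<close>

definition val :: "'a set \<Rightarrow> 'a set \<Rightarrow> enat" where
  "val M X = (SUP k\<in>{k. X \<subseteq> level M k}. enat k)"

lemma le_val_iff:
  assumes M: "place M"
  shows "enat k \<le> val M X \<longleftrightarrow> X \<subseteq> level M k"
proof
  assume k: "enat k \<le> val M X"
  show "X \<subseteq> level M k"
  proof (cases k)
    case 0
    then show ?thesis
      using level_0[OF M] by simp
  next
    case (Suc n)
    then have "enat n < val M X"
      using k by (simp add: Suc_ile_eq)
    then obtain l where "X \<subseteq> level M l" "n < l"
      unfolding val_def less_SUP_iff by auto
    then show ?thesis
      using level_antimono[of k l M] Suc by auto
  qed
qed (auto simp: val_def intro: SUP_upper)

lemma val_antimono: "place M \<Longrightarrow> X \<subseteq> Y \<Longrightarrow> val M Y \<le> val M X"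
  by (rule enat_leI) (auto simp: le_val_iff)

lemma val_star: "place M \<Longrightarrow> val M (star X) = val M X"
  by (rule antisym; rule enat_leI) (simp_all add: le_val_iff cl_subset_star_ideal[OF star_ideal_level])

lemma val_union: "place M \<Longrightarrow> val M (X \<union> Y) = min (val M X) (val M Y)"
  by (rule antisym; rule enat_leI) (simp_all add: le_val_iff)

lemma val_zero:
  assumes M: "place M" and X: "X \<subseteq> {0}"
  shows "val M X = \<infinity>"
proof (rule antisym)
  show "\<infinity> \<le> val M X"
  proof (rule enat_leI)
    show "enat k \<le> val M X" for k
      using star_idealD(1)[OF star_ideal_level[OF M]] X le_val_iff[OF M] by blast
  qed
qed simp

lemma val_eq:
  assumes M: "place M" and x: "x \<in> X" "s \<notin> M" "t \<notin> M" "s * x = uniformizer M ^ m * t"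
  shows "val M X \<le> enat m"
proof (rule enat_leI)
  fix k assume "enat k \<le> val M X"
  then have "x \<in> level M k"
    using x(1) le_val_iff[OF M] by blast
  then show "enat k \<le> enat m"
    using in_level_iff[OF M x(2-4)] by simp
qed

lemma val_attained:
  assumes M: "place M" and X: "\<not> X \<subseteq> {0}"
  obtains x s t m where "x \<in> X" "s \<notin> M" "t \<notin> M" "s * x = uniformizer M ^ m * t" "val M X = enat m"
proof -
  obtain k where "\<not> X \<subseteq> level M k"
    using X Inter_level[OF M] by blast
  then obtain m where m: "X \<subseteq> level M m" "\<not> X \<subseteq> level M (Suc m)"
    by (rule ex_last_level[OF M])
  then obtain x where x: "x \<in> X" "x \<in> level M m" "x \<notin> level M (Suc m)"
    by blast
  obtain s t where st: "s \<notin> M" "t \<notin> M" "s * x = uniformizer M ^ m * t"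
    by (rule level_decomposition[OF M x(2,3)])
  have "val M X = enat m"
    using val_eq[OF M x(1) st] m(1) le_val_iff[OF M] by (intro antisym) auto
  then show ?thesis
    using that x(1) st by blast
qed

lemma val_finite:
  assumes "place M" "\<not> X \<subseteq> {0}"
  shows "val M X \<noteq> \<infinity>"
  by (rule val_attained[OF assms]) simp

lemma val_times:
  assumes M: "place M"
  shows "val M (X * Y) = val M X + val M Y"
proof (cases "X \<subseteq> {0} \<or> Y \<subseteq> {0}")
  case True
  then have "X * Y \<subseteq> {0}"
    by (auto elim!: set_times_elim)
  then show ?thesis
    using True val_zero[OF M] by auto
next
  case False
  obtain x s t m where x: "x \<in> X" "s \<notin> M" "t \<notin> M" "s * x = uniformizer M ^ m * t" "val M X = enat m"
    using val_attained[OF M, of X] False by blast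
  obtain y s' t' n where y: "y \<in> Y" "s' \<notin> M" "t' \<notin> M" "s' * y = uniformizer M ^ n * t'" "val M Y = enat n"
    using val_attained[OF M, of Y] False by blast
  have "val M (X * Y) \<le> enat (m + n)"
  proof (rule val_eq[OF M])
    show "x * y \<in> X * Y"
      using x(1) y(1) by (rule set_times_intro)
    show "s * s' \<notin> M" "t * t' \<notin> M"
      using x y place_mult[OF M] by blast+
    have "(s * s') * (x * y) = (s * x) * (s' * y)"
      by (simp only: ac_simps)
    then show "(s * s') * (x * y) = uniformizer M ^ (m + n) * (t * t')"
      by (simp only: x(4) y(4) power_add ac_simps)
  qed
  moreover have "X * Y \<subseteq> level M (m + n)"
  proof
    fix z assume "z \<in> X * Y"
    then obtain u v where uv: "u \<in> X" "v \<in> Y" "z = u * v"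
      unfolding set_times_def by blast
    have "X \<subseteq> level M m" "Y \<subseteq> level M n"
      using x(5) y(5) le_val_iff[OF M] by (metis order_refl)+
    then obtain p q where "p \<notin> M" "uniformizer M ^ m dvd p * u" "q \<notin> M" "uniformizer M ^ n dvd q * v"
      using uv unfolding in_level subset_iff by meson
    moreover from this have "uniformizer M ^ (m + n) dvd (p * u) * (q * v)"
      unfolding power_add by (intro mult_dvd_mono)
    ultimately show "z \<in> level M (m + n)"
      unfolding in_level uv(3) using place_mult[OF M] by (intro exI[of _ "p * q"]) (auto simp: ac_simps)
  qed
  ultimately show ?thesis
    using x(5) y(5) le_val_iff[OF M, of "m + n"] by (auto intro!: antisym)
qed

text \<open>Let \<open>x\<close> and \<open>y\<close> attain the values \<open>m\<close> and
  \<open>n = m + d\<close>. Up to factors outside \<open>M\<close>, \<open>y\<close> is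
  \<open>x\<close> times the \<open>d\<close>-th power of the uniformizer, so
  \<open>(t * s') * y\<close> lies in both ideals and still has value \<open>n\<close>.\<close>

lemma val_Int_le:
  assumes M: "place M" and IJ: "star_ideal star I" "star_ideal star J" and le: "val M I \<le> val M J"
  shows "val M (I \<inter> J) \<le> val M J"
proof (cases "I \<subseteq> {0} \<or> J \<subseteq> {0}")
  case True
  then show ?thesis
    using val_zero[OF M] le by auto
next
  case False
  obtain x s t m where x: "x \<in> I" "s \<notin> M" "t \<notin> M" "s * x = uniformizer M ^ m * t" "val M I = enat m"
    using val_attained[OF M, of I] False by blast
  obtain y s' t' n where y: "y \<in> J" "s' \<notin> M" "t' \<notin> M" "s' * y = uniformizer M ^ n * t'" "val M J = enat n"
    using val_attained[OF M, of J] False by blast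
  obtain d where d: "n = m + d"
    using le x(5) y(5) le_Suc_ex by auto
  have "(t * s') * y = t * (uniformizer M ^ n * t')"
    by (simp only: mult.assoc y(4))
  also have "\<dots> = (uniformizer M ^ d * t') * (s * x)"
    by (simp only: x(4) d power_add ac_simps)
  finally have z: "(t * s') * y = (uniformizer M ^ d * t') * s * x"
    by (simp only: mult.assoc)
  have "(t * s') * y \<in> I \<inter> J"
    using star_idealD(3)[OF IJ(2) y(1), of "t * s'"] star_idealD(3)[OF IJ(1) x(1), of "(uniformizer M ^ d * t') * s"]
    by (simp only: z[symmetric] Int_iff)
  moreover have "1 * ((t * s') * y) = uniformizer M ^ n * (t * t')"
    by (simp only: mult_1_left mult.assoc y(4)) (simp only: ac_simps)
  ultimately have "val M (I \<inter> J) \<le> enat n"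
    using val_eq[OF M _ place_one[OF M]] place_mult[OF M] x(3) y(3) by blast
  then show ?thesis
    using y(5) by simp
qed

lemma val_Int:
  assumes M: "place M" and IJ: "star_ideal star I" "star_ideal star J"
  shows "val M (I \<inter> J) = max (val M I) (val M J)"
proof (rule antisym)
  show "val M (I \<inter> J) \<le> max (val M I) (val M J)"
    using val_Int_le[OF M IJ] val_Int_le[OF M IJ(2,1)]
    by (cases "val M I \<le> val M J") (auto simp: Int_commute max_def)
qed (simp add: val_antimono[OF M])

text \<open>For \<open>x \<in> I\<close> the residual of \<open>J\<close> by \<open>x\<close>
  contains the nonzero ideal \<open>J\<close>, so if proper it lies in a place \<open>M\<close>.
  Comparing \<open>x\<close> with an element of least value in \<open>J\<close> produces a member of
  the residual outside \<open>M\<close>.\<close>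

lemma subset_iff_val:
  assumes IJ: "star_ideal star I" "star_ideal star J" "J \<noteq> {0}"
  shows "I \<subseteq> J \<longleftrightarrow> (\<forall>M. place M \<longrightarrow> val M J \<le> val M I)"
proof
  assume le: "\<forall>M. place M \<longrightarrow> val M J \<le> val M I"
  show "I \<subseteq> J"
  proof
    fix x assume x: "x \<in> I"
    let ?R = "{r. r * x \<in> J}"
    have R: "star_ideal star ?R"
      using star_ideal_residual[OF IJ(2)] .
    have J_sub: "J \<subseteq> ?R"
      using star_idealD(4)[OF IJ(2)] by auto
    have nz: "\<not> J \<subseteq> {0}"
      using IJ(3) star_idealD(1)[OF IJ(2)] by blast
    have "?R = UNIV"
    proof (rule ccontr)
      assume "?R \<noteq> UNIV"
      then obtain M where M: "place M" "?R \<subseteq> M"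
        using ex_place[OF R] J_sub nz by blast
      obtain y s t m where y: "y \<in> J" "s \<notin> M" "t \<notin> M" "s * y = uniformizer M ^ m * t" "val M J = enat m"
        using val_attained[OF M(1) nz] .
      have "enat m \<le> val M I"
        using le M(1) y(5) by metis
      then have "x \<in> level M m"
        using x le_val_iff[OF M(1)] by blast
      then obtain u r where u: "u \<notin> M" "u * x = uniformizer M ^ m * r"
        unfolding in_level dvd_def by blast
      have "(t * u) * x = t * (uniformizer M ^ m * r)"
        by (simp only: mult.assoc u(2))
      also have "\<dots> = r * (s * y)"
        by (simp only: y(4) ac_simps)
      finally have "(t * u) * x = (r * s) * y"
        by (simp only: mult.assoc)
      then have "t * u \<in> ?R"
        using star_idealD(3)[OF IJ(2) y(1), of "r * s"] by simp
      then show False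
        using M place_mult[OF M(1)] y(3) u(1) by blast
    qed
    then have "1 \<in> ?R"
      by blast
    then show "x \<in> J"
      by simp
  qed
qed (simp add: val_antimono)

lemma eq_iff_val:
  assumes "star_ideal star I" "star_ideal star J" "I \<noteq> {0}" "J \<noteq> {0}"
  shows "I = J \<longleftrightarrow> (\<forall>M. place M \<longrightarrow> val M I = val M J)"
  using subset_iff_val[of I J] subset_iff_val[of J I] assms by (metis antisym order_refl subset_antisym)

lemma one_le_val_iff: "place M \<Longrightarrow> 1 \<le> val M X \<longleftrightarrow> X \<subseteq> M"
  using le_val_iff[of M 1 X] level_1 by (simp add: one_enat_def)

lemma val_radical:
  assumes M: "place M" and J: "star_radical_ideal star J" "J \<noteq> {0}"
  shows "val M J = (if J \<subseteq> M then 1 else 0)"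
proof (cases "J \<subseteq> M")
  case True
  obtain s where s: "s \<notin> M" "s * uniformizer M \<in> J"
    using radical_locally_eq_place[OF M J True uniformizer(1)[OF M]] .
  have "val M J \<le> enat 1"
    by (rule val_eq[OF M s(2) place_one[OF M] s(1)]) (simp add: mult.commute)
  then show ?thesis
    using True one_le_val_iff[OF M] by (auto simp: one_enat_def intro: antisym)
next
  case False
  then show ?thesis
    using one_le_val_iff[OF M, of J] by (simp add: not_le one_eSuc)
qed

lemma le_val_power: "place M \<Longrightarrow> x \<in> M \<Longrightarrow> enat n \<le> val M {x ^ n}"
proof (induction n)
  case (Suc n)
  have "1 + enat n \<le> val M {x} + val M {x ^ n}"
    using Suc one_le_val_iff[of M "{x}"] by (intro add_mono) auto
  also have "\<dots> = val M {x ^ Suc n}"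
    using val_times[of M "{x}" "{x ^ n}"] Suc.prems by (simp add: set_times_def)
  finally show ?case
    by (simp add: one_enat_def)
qed (simp add: zero_enat_def[symmetric])

lemma power_mem_place: "place M \<Longrightarrow> n > 0 \<Longrightarrow> x ^ n \<in> M \<longleftrightarrow> x \<in> M"
  by (cases n) (auto simp: place_mult dest: place_power)

text \<open>Containment is tested by values: at a place above \<open>I\<close>, a power of
  \<open>x\<close> in \<open>I\<close> forces \<open>x \<in> M\<close> and hence value at least 1;
  elsewhere \<open>I\<close> has value 0.\<close>

lemma radical_if_val_le_1:
  assumes I: "star_ideal star I" "I \<noteq> {0}" and le: "\<And>M. place M \<Longrightarrow> val M I \<le> 1"
  shows "star_radical_ideal star I"
proof -
  have "x \<in> I" if xn: "x ^ n \<in> I" "n > 0" for x n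
  proof -
    have "star {x} \<subseteq> I"
      unfolding subset_iff_val[OF star_ideal_cl I]
    proof (intro allI impI)
      fix M assume M: "place M"
      show "val M I \<le> val M (star {x})"
      proof (cases "I \<subseteq> M")
        case True
        then have "x \<in> M"
          using xn power_mem_place[OF M] by blast
        then have "1 \<le> val M (star {x})"
          using one_le_val_iff[OF M] by (simp add: val_star[OF M])
        then show ?thesis
          using le[OF M] by (rule order_trans[rotated])
      next
        case False
        then have "val M I = 0"
          using one_le_val_iff[OF M, of I] by (simp add: not_le one_eSuc)
        then show ?thesis
          by simp
      qed
    qed
    then show ?thesis
      using in_cl by blast
  qed
  then show ?thesis
    using I(1) subset_radical[of I] by (auto simp: star_radical_ideal_def ideal_radical_def)
qed

section \<open>Sums, intersections and invertibility\<close>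

lemma Int_nonzero:
  assumes I: "star_ideal star I" "I \<noteq> {0}" and J: "star_ideal star J" "J \<noteq> {0}"
  shows "I \<inter> J \<noteq> {0}"
proof -
  obtain x where "x \<in> I" "x \<noteq> 0"
    by (rule nonzero_star_ideal[OF I])
  moreover obtain y where "y \<in> J" "y \<noteq> 0"
    by (rule nonzero_star_ideal[OF J])
  ultimately have "x * y \<in> I \<inter> J" "x * y \<noteq> 0"
    using star_idealD(4)[OF I(1)] star_idealD(3)[OF J(1)] by auto
  then show ?thesis
    by blast
qed

lemma star_times_nonzero:
  assumes I: "star_ideal star I" "I \<noteq> {0}" and J: "star_ideal star J" "J \<noteq> {0}"
  shows "star (I * J) \<noteq> {0}"
proof -
  obtain x where "x \<in> I" "x \<noteq> 0"
    by (rule nonzero_star_ideal[OF I])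
  moreover obtain y where "y \<in> J" "y \<noteq> 0"
    by (rule nonzero_star_ideal[OF J])
  ultimately have "x * y \<in> star (I * J)" "x * y \<noteq> 0"
    by (auto intro: in_cl)
  then show ?thesis
    by blast
qed

lemma star_union_nonzero: "star_ideal star I \<Longrightarrow> I \<noteq> {0} \<Longrightarrow> star (I \<union> J) \<noteq> {0}"
  using nonzero_star_ideal[of I] subset_cl[of "I \<union> J"] by blast

text \<open>At every place this is the identity min + max = sum.\<close>

lemma union_times_Int:
  assumes I: "star_ideal star I" "I \<noteq> {0}" and J: "star_ideal star J" "J \<noteq> {0}"
  shows "star (star (I \<union> J) * (I \<inter> J)) = star (I * J)"
proof -
  have "val M (I \<union> J) + val M (I \<inter> J) = val M I + val M J" if M: "place M" for M
    unfolding val_union[OF M] val_Int[OF M I(1) J(1)] by (simp add: min_def max_def add.commute)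
  moreover have "star (star (I \<union> J) * (I \<inter> J)) \<noteq> {0}"
    by (rule star_times_nonzero) (use star_union_nonzero Int_nonzero star_ideal_Int I J in auto)
  ultimately show ?thesis
    using star_times_nonzero[OF I J]
    by (subst eq_iff_val) (auto simp: val_star val_times simp del: cl_times_cl)
qed

lemma star_invertible_union_Int:
  assumes I: "star_invertible star I" and J: "star_invertible star J"
  shows "star_invertible star (star (I \<union> J))" "star_invertible star (I \<inter> J)"
proof -
  have IJ: "star_ideal star I" "I \<noteq> {0}" "star_ideal star J" "J \<noteq> {0}"
    using I J star_invertible_star_ideal star_invertible_nonzero by auto
  have inv: "star_invertible star (star (star (I \<union> J) * (I \<inter> J)))"
    using star_invertible_times[OF I J] union_times_Int[OF IJ] by simp
  then show "star_invertible star (star (I \<union> J))"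
    by (rule star_invertible_factor) simp
  from inv have "star_invertible star (star ((I \<inter> J) * star (I \<union> J)))"
    by (simp only: mult.commute)
  then show "star_invertible star (I \<inter> J)"
    by (rule star_invertible_factor) (simp add: star_ideal_Int IJ)
qed

text \<open>Each generator adds a principal ideal, and the sum of two invertible ideals is
  invertible because it divides their product.\<close>

lemma star_invertible_finite:
  assumes "finite E" "\<not> E \<subseteq> {0}"
  shows "star_invertible star (star E)"
  using assms
proof (induction E)
  case (insert e E)
  have eq: "star (insert e E) = star (star {e} \<union> star E)"
  proof
    show "star (insert e E) \<subseteq> star (star {e} \<union> star E)"
      using subset_cl[of "{e}"] subset_cl[of E] by (intro cl_mono) auto
    show "star (star {e} \<union> star E) \<subseteq> star (insert e E)"
      using cl_mono[of "{e}" "insert e E"] cl_mono[of E "insert e E"] by (intro cl_least) auto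
  qed
  show ?case
  proof (cases "E \<subseteq> {0}")
    case True
    then have "star E \<subseteq> star {e}"
      using cl_mono[of E "{0}"] clD(1)[of "{e}"] by auto
    then have "star (insert e E) = star {e}"
      unfolding eq by (simp add: Un_absorb2)
    then show ?thesis
      using True insert.prems star_invertible_singleton by auto
  next
    case False
    then have inv: "star_invertible star (star E)"
      using insert.IH by blast
    show ?thesis
    proof (cases "e = 0")
      case True
      then have "star (insert e E) = star E"
        unfolding eq using clD(1)[of E] by (simp add: insert_absorb)
      then show ?thesis
        using inv by simp
    next
      case False
      then show ?thesis
        unfolding eq using inv star_invertible_singleton by (intro star_invertible_union_Int)
    qed
  qed
qed simp

lemma fin_gen_star_invertible:
  assumes "star_fin_gen star I" "I \<noteq> {0}"
  shows "star_invertible star I"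
proof -
  obtain E where E: "finite E" "I = star E"
    using assms(1) unfolding star_fin_gen_def by blast
  moreover have "\<not> E \<subseteq> {0}"
    using assms(2) E(2) cl_mono[of E "{0}"] clD(1)[of E] by auto
  ultimately show ?thesis
    using star_invertible_finite by simp
qed

section \<open>Radicals and factorizations along chains\<close>

lemma ex_invertible_radical_support:
  assumes I: "star_ideal star I" "I \<noteq> {0}"
  obtains J n where "star_invertible star J" "star_radical_ideal star J"
    "\<And>M. place M \<Longrightarrow> I \<subseteq> M \<Longrightarrow> J \<subseteq> M" "\<And>M. place M \<Longrightarrow> val M I \<le> enat n"
proof -
  let ?F = "{J. star_invertible star J \<and> star_radical_ideal star J}"
  have "\<exists>Js. set Js \<subseteq> ?F \<and> star_prod_list star Js \<subseteq> I"
  proof (rule product_of_prime_cover_subset[OF I(1)])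
    show "star_fin_gen star F" if "F \<in> ?F" for F
      using that star_invertible_fin_gen by blast
    show "\<exists>F\<in>?F. F \<subseteq> P" if "star_prime star P" "I \<subseteq> P" for P
    proof -
      have "P \<noteq> {0}"
        using that(2) I star_idealD(1) by blast
      then show ?thesis
        using prime_contains[OF that(1)] by blast
    qed
  qed
  then obtain Js where Js: "set Js \<subseteq> ?F" "star_prod_list star Js \<subseteq> I"
    by blast
  \<comment> \<open>Every factor is radical and has value at most 1, so the number of factors bounds
    the values uniformly.\<close>
  have le: "val M (star_prod_list star Js) \<le> enat (length Js)" if M: "place M" for M
    using Js(1)
  proof (induction Js)
    case Nil
    then show ?case
      using val_eq[OF M UNIV_I place_one[OF M] place_one[OF M], of 1 0] by simp
  next
    case (Cons J Js)
    have "val M J \<le> 1"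
      using Cons.prems val_radical[OF M, of J] star_invertible_nonzero[of J] by auto
    then have "val M J + val M (star_prod_list star Js) \<le> 1 + enat (length Js)"
      using Cons by (intro add_mono) auto
    then show ?case
      by (simp add: star_prod_list_Cons val_star[OF M] val_times[OF M] one_enat_def)
  qed
  \<comment> \<open>The intersection of all factors stays invertible and radical. A place above
    \<open>I\<close> contains one of the factors, hence the intersection.\<close>
  have "\<exists>J. J \<in> ?F \<and> (\<forall>K\<in>set Js. J \<subseteq> K)"
    using Js(1)
  proof (induction Js)
    case Nil
    have "UNIV \<in> ?F"
      using star_invertible_singleton[of 1] by (auto simp: star_radical_ideal_def ideal_radical_def)
    then show ?case
      by auto
  next
    case (Cons K Js)
    then obtain J where J: "J \<in> ?F" "\<forall>K\<in>set Js. J \<subseteq> K"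
      by auto
    have "K \<inter> J \<in> ?F"
      using J(1) Cons.prems star_invertible_union_Int(2)[of K J] star_ideal_Int[of K J] subset_radical[of "K \<inter> J"]
      by (auto simp: star_radical_ideal_def ideal_radical_def)
    then show ?case
      using J(2) by (intro exI[of _ "K \<inter> J"]) auto
  qed
  then obtain J where J: "star_invertible star J" "star_radical_ideal star J" "\<forall>K\<in>set Js. J \<subseteq> K"
    by blast
  show ?thesis
  proof (rule that[OF J(1,2)])
    show "J \<subseteq> M" if M: "place M" "I \<subseteq> M" for M
    proof -
      have "star_prod_list star Js \<subseteq> M" "prime_ideal M"
        using Js(2) M place_prime[OF M(1)] by (auto simp: star_prime_def)
      then show ?thesis
        using prime_contains_factor J(3) by blast
    qed
    show "val M I \<le> enat (length Js)" if M: "place M" for M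
      using val_antimono[OF M Js(2)] le[OF M] by (rule order_trans)
  qed
qed

lemma star_ideal_nonzero_not_subset: "star_ideal star I \<Longrightarrow> I \<noteq> {0} \<Longrightarrow> \<not> I \<subseteq> {0}"
  using star_idealD(1) by blast

text \<open>The values of the sum are at most those of \<open>J\<close>, hence at most 1, so the sum
  is radical. Conversely its elements lie in every place above \<open>I\<close>, so a power with
  exponent above the bound \<open>n\<close> lies in \<open>I\<close>.\<close>

lemma radical_eq_union:
  assumes I: "star_ideal star I" "I \<noteq> {0}" and J: "star_radical_ideal star J" "J \<noteq> {0}"
    and support: "\<And>M. place M \<Longrightarrow> I \<subseteq> M \<Longrightarrow> J \<subseteq> M" and bound: "\<And>M. place M \<Longrightarrow> val M I \<le> enat n"
  shows "ideal_radical I = star (I \<union> J)"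
proof
  let ?K = "star (I \<union> J)"
  have K: "star_ideal star ?K" "?K \<noteq> {0}"
    using star_union_nonzero I by auto
  have "val M ?K \<le> 1" if M: "place M" for M
    using val_radical[OF M J] by (simp add: val_star[OF M] val_union[OF M] min_le_iff_disj)
  then have "star_radical_ideal star ?K"
    by (rule radical_if_val_le_1[OF K])
  then show "ideal_radical I \<subseteq> ?K"
    using subset_cl[of "I \<union> J"] by (intro radical_least) auto
  show "?K \<subseteq> ideal_radical I"
  proof
    fix x assume x: "x \<in> ?K"
    \<comment> \<open>The exponent is \<open>Suc n\<close> because the radical asks for a positive
      one, while \<open>n\<close> may be 0.\<close>
    have "star {x ^ Suc n} \<subseteq> I"
      unfolding subset_iff_val[OF star_ideal_cl I]
    proof (intro allI impI)
      fix M assume M: "place M"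
      show "val M I \<le> val M (star {x ^ Suc n})"
      proof (cases "I \<subseteq> M")
        case True
        then have "?K \<subseteq> M"
          using support[OF M] place_star_ideal[OF M] by (simp add: cl_subset_star_ideal)
        then have "enat (Suc n) \<le> val M (star {x ^ Suc n})"
          unfolding val_star[OF M] using x by (intro le_val_power[OF M]) auto
        moreover have "val M I \<le> enat (Suc n)"
          using bound[OF M] by (rule order_trans) simp
        ultimately show ?thesis
          by (rule order_trans[rotated])
      next
        case False
        then have "val M I = 0"
          using one_le_val_iff[OF M, of I] by (simp add: not_le one_eSuc)
        then show ?thesis
          by simp
      qed
    qed
    then have "x ^ Suc n \<in> I"
      using in_cl by blast
    then show "x \<in> ideal_radical I"
      unfolding ideal_radical_def by blast
  qed
qed

lemma radical_invertible:
  assumes "star_fin_gen star I" "I \<noteq> {0}"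
  shows "star_invertible star (ideal_radical I)"
proof -
  have I: "star_ideal star I" "star_invertible star I"
    using assms fin_gen_star_invertible by (auto simp: star_fin_gen_def)
  obtain J n where J: "star_invertible star J" "star_radical_ideal star J"
    "\<And>M. place M \<Longrightarrow> I \<subseteq> M \<Longrightarrow> J \<subseteq> M" "\<And>M. place M \<Longrightarrow> val M I \<le> enat n"
    using ex_invertible_radical_support[OF I(1) assms(2)] by metis
  have "ideal_radical I = star (I \<union> J)"
    by (rule radical_eq_union[OF I(1) assms(2) J(2) star_invertible_nonzero[OF J(1)] J(3,4)])
  then show ?thesis
    using star_invertible_union_Int(1)[OF I(2) J(1)] by simp
qed

lemma radical_nonzero: "star_ideal star I \<Longrightarrow> I \<noteq> {0} \<Longrightarrow> ideal_radical I \<noteq> {0}"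
  using subset_radical[of I] star_ideal_nonzero_not_subset[of I] by blast

lemma ideal_radical_subset_place: "place M \<Longrightarrow> ideal_radical I \<subseteq> M \<longleftrightarrow> I \<subseteq> M"
  using subset_radical[of I] radical_subset_prime[OF place_prime, of M I] by blast

lemma val_ideal_radical:
  assumes "place M" "star_ideal star I" "I \<noteq> {0}"
  shows "val M (ideal_radical I) = (if I \<subseteq> M then 1 else 0)"
  using val_radical[OF assms(1) star_radical_ideal_radical radical_nonzero] assms
  by (simp add: ideal_radical_subset_place)

text \<open>The radical of \<open>I\<close> need not be invertible, so the division is by the
  invertible \<open>J\<close> instead. Where \<open>I\<close> has value 0 and \<open>J\<close> value
  1, the intersection \<open>I \<inter> J\<close> has value 1 and its quotient by \<open>J\<close>
  value 0; so the value of \<open>I\<close> drops by one exactly at the places above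
  \<open>I\<close>.\<close>

lemma split_off_radical:
  assumes I: "star_ideal star I" "I \<noteq> {0}"
  obtains C n where "star_ideal star C" "C \<noteq> {0}" "I \<subseteq> C" "I = star (ideal_radical I * C)"
    "\<And>M. place M \<Longrightarrow> val M I = (if I \<subseteq> M then 1 else 0) + val M C"
    "\<And>M. place M \<Longrightarrow> val M I \<le> enat n"
proof -
  obtain J n where J: "star_invertible star J" "star_radical_ideal star J"
    "\<And>M. place M \<Longrightarrow> I \<subseteq> M \<Longrightarrow> J \<subseteq> M" "\<And>M. place M \<Longrightarrow> val M I \<le> enat n"
    using ex_invertible_radical_support[OF I] by metis
  have J': "star_ideal star J" "J \<noteq> {0}"
    using J(1) star_invertible_star_ideal star_invertible_nonzero by auto
  define C where "C = {r. r *o J \<subseteq> I \<inter> J}"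
  have IJ: "star_ideal star (I \<inter> J)"
    using I(1) J'(1) by (rule star_ideal_Int)
  have C: "star_ideal star C"
    unfolding C_def by (rule star_ideal_quotient[OF IJ])
  have "I \<subseteq> C"
    unfolding C_def using star_idealD(4)[OF I(1)] star_idealD(3)[OF J'(1)] by (auto simp: elt_set_times_def)
  then have C0: "C \<noteq> {0}"
    using star_ideal_nonzero_not_subset[OF I] by blast
  have JC: "star (J * C) = I \<inter> J"
    unfolding C_def by (rule star_invertible_times_quotient[OF J(1) IJ]) simp
  have val: "val M I = (if I \<subseteq> M then 1 else 0) + val M C" if M: "place M" for M
  proof -
    have eq: "val M J + val M C = max (val M I) (val M J)"
      using val_times[OF M, of J C] val_star[OF M, of "J * C"] val_Int[OF M I(1) J'(1)] JC by simp
    show ?thesis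
    proof (cases "I \<subseteq> M")
      case True
      then have "val M J = 1" "1 \<le> val M I"
        using J(3)[OF M] val_radical[OF M J(2) J'(2)] one_le_val_iff[OF M] by auto
      then show ?thesis
        using eq True by (simp add: max_absorb1)
    next
      case False
      then have "val M I = 0"
        using one_le_val_iff[OF M, of I] by (simp add: not_le one_eSuc)
      moreover have "val M J \<noteq> \<infinity>"
        using val_finite[OF M star_ideal_nonzero_not_subset[OF J']] .
      ultimately have "val M C = 0"
        using eq by (cases "val M J"; cases "val M C") (auto simp: zero_enat_def)
      then show ?thesis
        using False \<open>val M I = 0\<close> by simp
    qed
  qed
  have "I = star (ideal_radical I * C)"
    using I C C0 radical_nonzero[OF I] star_ideal_radical[OF I(1)]
    by (subst eq_iff_val)
      (auto simp: val_star val_times val val_ideal_radical star_times_nonzero simp del: cl_times_cl)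
  then show ?thesis
    using that[OF C C0 \<open>I \<subseteq> C\<close> _ val J(4)] by blast
qed

text \<open>Induction on the bound for the values: splitting off the radical lowers every positive
  value by one. The cofactor contains \<open>I\<close>, so the radical of \<open>I\<close> lies
  below all later factors.\<close>

lemma ex_chain_factorization_bounded:
  assumes "star_ideal star I" "I \<noteq> {0}" "\<And>M. place M \<Longrightarrow> val M I \<le> enat n"
  shows "\<exists>Js. (\<forall>J\<in>set Js. star_radical_ideal star J \<and> J \<noteq> UNIV) \<and> sorted_wrt (\<subseteq>) Js \<and>
    I = star_prod_list star Js"
  using assms
proof (induction n arbitrary: I)
  case 0
  have "UNIV \<subseteq> I"
    using subset_iff_val[OF star_ideal_UNIV 0(1,2)] 0(3) by (auto simp: zero_enat_def[symmetric])
  then show ?case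
    by (intro exI[of _ "[]"]) auto
next
  case (Suc n)
  show ?case
  proof (cases "I = UNIV")
    case True
    then show ?thesis
      by (intro exI[of _ "[]"]) auto
  next
    case False
    obtain C where C: "star_ideal star C" "C \<noteq> {0}" "I \<subseteq> C" "I = star (ideal_radical I * C)"
      "\<And>M. place M \<Longrightarrow> val M I = (if I \<subseteq> M then 1 else 0) + val M C"
      using split_off_radical[OF Suc.prems(1,2)] by metis
    have "val M C \<le> enat n" if M: "place M" for M
    proof (cases "I \<subseteq> M")
      case True
      then have "1 + val M C \<le> enat (Suc n)"
        using C(5)[OF M] Suc.prems(3)[OF M] by simp
      then show ?thesis
        by (cases "val M C") (auto simp: one_enat_def)
    next
      case False
      then have "\<not> C \<subseteq> M"
        using C(3) by blast
      then have "val M C = 0"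
        using one_le_val_iff[OF M, of C] by (simp add: not_le one_eSuc)
      then show ?thesis
        by simp
    qed
    then obtain Js where Js: "\<forall>J\<in>set Js. star_radical_ideal star J \<and> J \<noteq> UNIV" "sorted_wrt (\<subseteq>) Js"
      "C = star_prod_list star Js"
      using Suc.IH[OF C(1,2)] by blast
    have sub: "ideal_radical I \<subseteq> J" if J: "J \<in> set Js" for J
    proof (rule radical_least)
      show "star_radical_ideal star J"
        using Js(1) J by blast
      have "C \<subseteq> J"
        unfolding Js(3) using Js(1) by (intro star_prod_list_subset[OF J]) (auto simp: star_radical_ideal_def)
      then show "I \<subseteq> J"
        using C(3) by blast
    qed
    have "ideal_radical I \<noteq> UNIV"
    proof
      assume "ideal_radical I = UNIV"
      then have "1 \<in> ideal_radical I"
        by simp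
      then show False
        using False star_ideal_eq_UNIV[OF Suc.prems(1)] by (auto simp: ideal_radical_def)
    qed
    then show ?thesis
      using Js C(4) sub star_radical_ideal_radical[OF Suc.prems(1)]
      by (intro exI[of _ "ideal_radical I # Js"]) (auto simp: star_prod_list_Cons)
  qed
qed

lemma ex_chain_factorization:
  assumes "star_ideal star I" "I \<noteq> {0}"
  shows "\<exists>Js. (\<forall>J\<in>set Js. star_radical_ideal star J \<and> J \<noteq> UNIV) \<and> sorted_wrt (\<subseteq>) Js \<and>
    I = star_prod_list star Js"
proof -
  obtain n where "\<And>M. place M \<Longrightarrow> val M I \<le> enat n"
    using split_off_radical[OF assms] by metis
  then show ?thesis
    by (rule ex_chain_factorization_bounded[OF assms])
qed

lemma power_mem_star_prod_list: "\<forall>J\<in>set Js. x \<in> J \<Longrightarrow> x ^ length Js \<in> star_prod_list star Js"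
  by (induction Js) (auto simp: star_prod_list_Cons intro!: in_cl)

text \<open>An element of the smallest factor lies in all of them, so a power of it lies in the
  product. Hence the product determines its first factor, which starts the uniqueness proof.\<close>

lemma radical_chain_product:
  assumes "\<forall>K\<in>set (J # Js). star_radical_ideal star K" "sorted_wrt (\<subseteq>) (J # Js)"
  shows "ideal_radical (star_prod_list star (J # Js)) = J"
proof
  show "ideal_radical (star_prod_list star (J # Js)) \<subseteq> J"
    using assms(1) by (intro radical_least star_prod_list_subset) (auto simp: star_radical_ideal_def)
  show "J \<subseteq> ideal_radical (star_prod_list star (J # Js))"
  proof
    fix x assume "x \<in> J"
    then have "x ^ length (J # Js) \<in> star_prod_list star (J # Js)"
      using assms(2) by (intro power_mem_star_prod_list) auto
    then show "x \<in> ideal_radical (star_prod_list star (J # Js))"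
      unfolding ideal_radical_def by (auto intro!: exI[of _ "length (J # Js)"])
  qed
qed

lemma chain_factorization_unique:
  assumes "\<forall>J\<in>set Js. star_radical_ideal star J \<and> J \<noteq> UNIV" "sorted_wrt (\<subseteq>) Js"
    and "\<forall>J\<in>set Ks. star_radical_ideal star J \<and> J \<noteq> UNIV" "sorted_wrt (\<subseteq>) Ks"
    and "star_prod_list star Js = star_prod_list star Ks" "star_prod_list star Js \<noteq> {0}"
  shows "Js = Ks"
  using assms
proof (induction Js arbitrary: Ks)
  case Nil
  have "K \<notin> set Ks" for K
    using Nil star_prod_list_subset[of K Ks] by (auto simp: star_radical_ideal_def)
  then show ?case
    by (cases Ks) auto
next
  case (Cons J Js)
  have "Ks \<noteq> []"
    using Cons.prems star_prod_list_subset[of J "J # Js"] by (auto simp: star_radical_ideal_def)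
  then obtain K Ks' where Ks: "Ks = K # Ks'"
    by (cases Ks) auto
  have "J = K"
    using radical_chain_product[of J Js] radical_chain_product[of K Ks'] Cons.prems Ks by auto
  have eq: "star (J * star_prod_list star Js) = star (J * star_prod_list star Ks')"
    using Cons.prems(5) Ks \<open>J = K\<close> by (simp add: star_prod_list_Cons del: cl_times_cl)
  have nz: "star (J * star_prod_list star Js) \<noteq> {0}"
    using Cons.prems(6) by (simp add: star_prod_list_Cons del: cl_times_cl)
  have zero: "star ({0} * X) = {0}" "star (X * {0}) = {0}" for X
    using star_singleton_times[of 0 X] clD(1)[of X] by (auto simp: elt_set_times_def mult.commute)
  have nz': "J \<noteq> {0}" "star_prod_list star Js \<noteq> {0}" "star_prod_list star Ks' \<noteq> {0}"
    using nz eq zero by (metis, metis, metis)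
  have J: "star_ideal star J"
    using Cons.prems(1) by (simp add: star_radical_ideal_def)
  \<comment> \<open>The common first factor may fail to be invertible. It is cancelled through its
    values, which are finite because it is nonzero.\<close>
  have "val M (star_prod_list star Js) = val M (star_prod_list star Ks')" if M: "place M" for M
  proof -
    have "val M J + val M (star_prod_list star Js) = val M J + val M (star_prod_list star Ks')"
      using eq val_star[OF M] val_times[OF M] by metis
    then show ?thesis
      using val_finite[OF M star_ideal_nonzero_not_subset[OF J nz'(1)]] by auto
  qed
  then have "star_prod_list star Js = star_prod_list star Ks'"
    using eq_iff_val[of "star_prod_list star Js" "star_prod_list star Ks'"] nz' by auto
  then have "Js = Ks'"
    using Cons.prems Ks nz' by (intro Cons.IH) auto
  then show ?case
    using Ks \<open>J = K\<close> by simp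
qed

end

section \<open>The inverse topology\<close>

text \<open>The decomposition of a bounded function into the indicators of its sets
  \<open>k \<le> f\<close>, for \<open>k\<close> from 1 to the bound, read at one point with
  \<open>m\<close> as its value there.\<close>

lemma sum_list_indicators:
  "sum_list (map (\<lambda>k. if k \<le> m then 1 else 0) [1..<Suc n]) = enat (min m n)"
proof (induction n)
  case (Suc n)
  then show ?case
    by (cases "Suc n \<le> m") (auto simp: one_enat_def min_def)
qed (simp add: zero_enat_def)

context star_closure
begin

lemma star_fin_gen_zero: "star_fin_gen star {0}"
  using star_fin_gen_cl[of "{}"] by simp

lemma topspace_star_max_inverse: "topspace (star_max_inverse star) = {M. star_maximal star M}"
proof -
  have "star_maximal star M \<Longrightarrow> {0} \<subseteq> M" for M
    using star_idealD(1) by (auto simp: star_maximal_def)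
  then show ?thesis
    unfolding star_max_inverse_def topology_generated_by_topspace using star_fin_gen_zero by blast
qed

lemma openin_hull:
  "star_fin_gen star I \<Longrightarrow> openin (star_max_inverse star) {M. star_maximal star M \<and> I \<subseteq> M}"
  unfolding star_max_inverse_def by (rule topology_generated_by_Basis) blast

lemma openin_contains_hull:
  assumes "openin (star_max_inverse star) U" "M \<in> U"
  shows "\<exists>I. star_fin_gen star I \<and> I \<subseteq> M \<and> (\<forall>N. star_maximal star N \<longrightarrow> I \<subseteq> N \<longrightarrow> N \<in> U)"
proof -
  have "generate_topology_on {{M. star_maximal star M \<and> I \<subseteq> M} |I. star_fin_gen star I} U"
    using assms(1) by (simp add: star_max_inverse_def openin_topology_generated_by_iff)
  then show ?thesis
    using assms(2)
  proof induction
    case Empty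
    then show ?case
      by simp
  next
    case (Int a b)
    then obtain I J where I: "star_fin_gen star I" "I \<subseteq> M" "\<forall>N. star_maximal star N \<longrightarrow> I \<subseteq> N \<longrightarrow> N \<in> a"
      and J: "star_fin_gen star J" "J \<subseteq> M" "\<forall>N. star_maximal star N \<longrightarrow> J \<subseteq> N \<longrightarrow> N \<in> b"
      by auto
    have "openin (star_max_inverse star) (a \<inter> b)"
      using Int.hyps by (simp add: star_max_inverse_def openin_topology_generated_by_iff generate_topology_on.Int)
    then have "M \<in> topspace (star_max_inverse star)"
      using openin_subset Int.prems by blast
    then have M: "star_ideal star M"
      by (simp add: topspace_star_max_inverse star_maximal_def)
    show ?case
    proof (intro exI conjI allI impI)
      show "star_fin_gen star (star (I \<union> J))"
        using I(1) J(1) by (rule star_fin_gen_union)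
      show "star (I \<union> J) \<subseteq> M"
        using M I(2) J(2) by (simp add: cl_union_least)
      show "N \<in> a \<inter> b" if "star_maximal star N" "star (I \<union> J) \<subseteq> N" for N
        using that I(3) J(3) by (simp add: cl_union_least star_maximal_def)
    qed
  next
    case (UN K)
    then obtain k where k: "k \<in> K" "M \<in> k"
      by blast
    then show ?case
      using UN.IH[OF k] k(1) by (meson UnionI)
  next
    case (Basis s)
    then obtain I where "star_fin_gen star I" "s = {M. star_maximal star M \<and> I \<subseteq> M}"
      by blast
    then show ?case
      using Basis.prems by (intro exI[of _ I]) auto
  qed
qed

section \<open>Compact sets and semicontinuous functions for the inverse topology\<close>

lemma prod_notin_prime:
  assumes "prime_ideal N" "finite F" "F \<inter> N = {}"
  shows "\<Prod>F \<notin> N"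
  using assms(2,3)
proof induction
  case empty
  then show ?case
    using assms(1) ring_idealD(3)[of N 1] by (auto simp: prime_ideal_def)
next
  case (insert x F)
  then show ?case
    using assms(1) by (auto simp: prime_ideal_def)
qed

text \<open>The hulls of the elements outside \<open>N\<close> cover \<open>C\<close>. A finite
  subcover gives finitely many such elements, whose product lies in every member of \<open>C\<close>
  but not in the prime \<open>N\<close>. Both maximal \<open>N\<close> and \<open>N = {0}\<close>
  occur.\<close>

lemma compact_Inter_not_subset:
  assumes C: "compactin (star_max_inverse star) C" and N: "prime_ideal N"
    and not: "\<And>M. M \<in> C \<Longrightarrow> \<not> M \<subseteq> N"
  shows "\<not> \<Inter>C \<subseteq> N"
proof -
  define h where "h x = {M. star_maximal star M \<and> star {x} \<subseteq> M}" for x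
  have sub: "C \<subseteq> {M. star_maximal star M}"
    using compactin_subset_topspace[OF C] by (simp add: topspace_star_max_inverse)
  have mem: "star {x} \<subseteq> M \<longleftrightarrow> x \<in> M" if "star_maximal star M" for x M
    using that by (simp add: star_maximal_def cl_subset_star_ideal)
  have "\<exists>\<F>. finite \<F> \<and> \<F> \<subseteq> h ` (- N) \<and> C \<subseteq> \<Union>\<F>"
  proof -
    have "openin (star_max_inverse star) U" if "U \<in> h ` (- N)" for U
      using that star_fin_gen_cl openin_hull by (auto simp: h_def)
    moreover have "C \<subseteq> \<Union>(h ` (- N))"
    proof
      fix M assume M: "M \<in> C"
      then obtain x where x: "x \<in> M" "x \<notin> N"
        using not by blast
      have "star_maximal star M"
        using M sub by blast
      then have "M \<in> h x"
        using x(1) mem by (simp add: h_def)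
      then show "M \<in> \<Union>(h ` (- N))"
        using x(2) by blast
    qed
    ultimately show ?thesis
      using C unfolding compactin_def by meson
  qed
  then obtain F where F: "finite F" "F \<subseteq> - N" "C \<subseteq> \<Union>(h ` F)"
    using finite_subset_image by metis
  have "\<Prod>F \<in> M" if M: "M \<in> C" for M
  proof -
    obtain x where x: "x \<in> F" "M \<in> h x"
      using F(3) M by blast
    then have "x \<in> M" "star_ideal star M"
      using mem by (auto simp: h_def star_maximal_def)
    then have "x * \<Prod>(F - {x}) \<in> M"
      by (simp add: star_idealD)
    then show ?thesis
      using F(1) x(1) by (simp add: prod.remove)
  qed
  moreover have "\<Prod>F \<notin> N"
    using prod_notin_prime[OF N F(1)] F(2) by blast
  ultimately show ?thesis
    by blast
qed

lemma hull_Inter_compact: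
  assumes C: "compactin (star_max_inverse star) C" and N: "star_maximal star N"
  shows "\<Inter>C \<subseteq> N \<longleftrightarrow> N \<in> C"
proof
  assume sub: "\<Inter>C \<subseteq> N"
  have N': "prime_ideal N"
    using star_maximal_prime[OF N] by (simp add: star_prime_def)
  show "N \<in> C"
  proof (rule ccontr)
    assume "N \<notin> C"
    have "\<not> M \<subseteq> N" if M: "M \<in> C" for M
    proof
      assume "M \<subseteq> N"
      moreover have "star_maximal star M"
        using compactin_subset_topspace[OF C] M by (auto simp: topspace_star_max_inverse)
      ultimately have "N = M"
        using N by (simp add: star_maximal_def)
      then show False
        using M \<open>N \<notin> C\<close> by simp
    qed
    then show False
      using compact_Inter_not_subset[OF C N'] sub by blast
  qed
qed blast

text \<open>The ideal attached to the set where \<open>f\<close> is at least \<open>k\<close>. It is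
  \<open>R\<close> if this set is empty.\<close>

definition level_kernel :: "('a set \<Rightarrow> nat) \<Rightarrow> nat \<Rightarrow> 'a set" where
  "level_kernel f k = \<Inter>{M. star_maximal star M \<and> k \<le> f M}"

lemma star_ideal_level_kernel: "star_ideal star (level_kernel f k)"
  unfolding level_kernel_def by (rule star_ideal_Inter) (auto simp: star_maximal_def)

lemma usc_compact_level:
  assumes "f \<in> usc_compact (star_max_inverse star)" "k \<ge> 1"
  shows "compactin (star_max_inverse star) {M. star_maximal star M \<and> k \<le> f M}"
  using assms by (simp add: usc_compact_def topspace_star_max_inverse)

lemma level_kernel_subset_iff:
  assumes "f \<in> usc_compact (star_max_inverse star)" "k \<ge> 1" "star_maximal star M"
  shows "level_kernel f k \<subseteq> M \<longleftrightarrow> k \<le> f M"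
  unfolding level_kernel_def
  using hull_Inter_compact[OF usc_compact_level[OF assms(1,2)] assms(3)] assms(3) by simp

text \<open>If \<open>f\<close> were unbounded, the kernels would form an increasing chain of proper
  ideals. By finite type the union lies in a maximal ideal \<open>N\<close>, and the kernel at
  \<open>Suc (f N)\<close> inside \<open>N\<close> gives \<open>Suc (f N) \<le> f N\<close>.\<close>

lemma usc_compact_bounded:
  assumes f: "f \<in> usc_compact (star_max_inverse star)"
  shows "\<exists>n. \<forall>M. f M \<le> n"
proof (rule ccontr)
  assume "\<nexists>n. \<forall>M. f M \<le> n"
  then have big: "\<exists>M. k < f M" for k
    by (auto simp: not_le)
  let ?\<C> = "range (level_kernel f)"
  have mono: "level_kernel f k \<subseteq> level_kernel f l" if "k \<le> l" for k l
    unfolding level_kernel_def using that by auto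
  have "star_ideal star (\<Union>?\<C>)"
  proof (rule star_ideal_chain_Union)
    show "subset.chain UNIV ?\<C>"
      using mono by (auto simp: subset_chain_def) (metis nle_le subsetD)
  qed (use star_ideal_level_kernel in auto)
  moreover have "1 \<notin> \<Union>?\<C>"
  proof
    assume "1 \<in> \<Union>?\<C>"
    then obtain k where k: "1 \<in> level_kernel f k"
      by blast
    obtain M where M: "k < f M"
      using big by blast
    then have "star_maximal star M"
      using f by (auto simp: usc_compact_def topspace_star_max_inverse)
    then have "1 \<in> M" "star_ideal star M" "M \<noteq> UNIV"
      using k M by (auto simp: level_kernel_def star_maximal_def)
    then show False
      using star_ideal_eq_UNIV by blast
  qed
  ultimately obtain N where N: "star_maximal star N" "\<Union>?\<C> \<subseteq> N"
    using ex_star_maximal[of "\<Union>?\<C>"] by blast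
  have "level_kernel f (Suc (f N)) \<subseteq> N"
    using N(2) by blast
  then show False
    using level_kernel_subset_iff[OF f _ N(1), of "Suc (f N)"] by simp
qed

lemma radical_ideal_if_powers: "star_ideal star J \<Longrightarrow> (\<And>x n. x ^ n \<in> J \<Longrightarrow> x \<in> J) \<Longrightarrow> star_radical_ideal star J"
  using subset_radical[of J] unfolding star_radical_ideal_def ideal_radical_def by blast

lemma star_radical_ideal_zero: "star_radical_ideal star {0}"
  by (rule radical_ideal_if_powers) (auto dest: power_not_zero split: if_splits)

lemma star_radical_product_zero: "star_radical_product star {0}"
  unfolding star_radical_product_def
  using star_radical_ideal_zero star_prod_list_single[of "{0}"] by (intro exI[of _ "[{0}]"]) auto

lemma usc_compact_indicator:
  assumes f: "f \<in> usc_compact (star_max_inverse star)" and k: "k \<ge> 1"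
  shows "(\<lambda>M. if k \<le> f M then 1 else 0) \<in> usc_compact (star_max_inverse star)"
proof -
  have "compactin (star_max_inverse star)
      {M \<in> topspace (star_max_inverse star). l \<le> (if k \<le> f M then 1 else (0::nat))}" if l: "l \<ge> 1" for l
  proof (cases "l = 1")
    case True
    then have "{M \<in> topspace (star_max_inverse star). l \<le> (if k \<le> f M then 1 else (0::nat))} =
        {M. star_maximal star M \<and> k \<le> f M}"
      by (auto simp: topspace_star_max_inverse split: if_splits)
    then show ?thesis
      using usc_compact_level[OF f k] by simp
  next
    case False
    then have "{M \<in> topspace (star_max_inverse star). l \<le> (if k \<le> f M then 1 else (0::nat))} = {}"
      using l by auto
    then show ?thesis
      by (simp only: compactin_empty)
  qed
  moreover have "(if k \<le> f M then 1 else (0::nat)) = 0" if "M \<notin> topspace (star_max_inverse star)" for M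
    using f k that by (simp add: usc_compact_def)
  ultimately show ?thesis
    unfolding usc_compact_def by blast
qed

text \<open>The indicators of the sets where \<open>\<phi> I\<close> is at least \<open>k\<close>
  have radical ideals as preimages, and the product of these ideals is \<open>I\<close> since the
  indicators add up to \<open>\<phi> I\<close>.\<close>

lemma SP_if_lattice_iso:
  assumes iso: "\<phi> \<in> mult_lattice_iso (star_ideal_lattice star) (usc_lattice (star_max_inverse star))"
  shows "star_SP_domain star"
proof -
  let ?T = "star_max_inverse star"
  have bij: "bij_betw \<phi> {I. star_ideal star I} (carrier (usc_lattice ?T))"
    and hom: "\<And>I J. star_ideal star I \<Longrightarrow> star_ideal star J \<Longrightarrow> \<phi> (star (I * J)) = (\<lambda>x. \<phi> I x + \<phi> J x)"
    and one: "\<phi> UNIV = (\<lambda>x. 0)"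
    and ord: "\<And>I J. star_ideal star I \<Longrightarrow> star_ideal star J \<Longrightarrow>
      I \<subseteq> J \<longleftrightarrow> (\<forall>x\<in>topspace ?T. \<phi> J x \<le> \<phi> I x)"
    using iso by (auto simp: mult_lattice_iso_def iso_def hom_def star_ideal_lattice_def usc_lattice_def)
  have surj: "\<exists>J. star_ideal star J \<and> \<phi> J = g" if "g \<in> carrier (usc_lattice ?T)" for g
  proof -
    have "g \<in> \<phi> ` {I. star_ideal star I}"
      using bij_betw_imp_surj_on[OF bij] that by simp
    then show ?thesis
      by auto
  qed
  have inj: "I = J" if "star_ideal star I" "star_ideal star J" "\<phi> I = \<phi> J" for I J
    using inj_onD[OF bij_betw_imp_inj_on[OF bij] that(3)] that by simp
  \<comment> \<open>Only \<open>{0}\<close> is sent to the bottom function, because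
    \<open>\<phi>\<close> reflects the order.\<close>
  have usc: "\<exists>f\<in>usc_compact ?T. \<phi> I = (\<lambda>x. enat (f x))" if I: "star_ideal star I" "I \<noteq> {0}" for I
  proof (rule ccontr)
    assume *: "\<not> (\<exists>f\<in>usc_compact ?T. \<phi> I = (\<lambda>x. enat (f x)))"
    have "\<phi> I \<in> carrier (usc_lattice ?T)"
      using bij_betwE[OF bij] I(1) by simp
    then have "\<phi> I = usc_bottom ?T"
      using * by (auto simp: usc_lattice_def)
    then have "I \<subseteq> {0}"
      using I(1) star_idealD(1)[OF I(1)] ord[of "{0}" I] ord[of I "{0}"] by (auto simp: usc_bottom_def)
    then show False
      using I star_idealD(1) by blast
  qed
  have prod: "\<phi> (star_prod_list star Js) x = sum_list (map (\<lambda>J. \<phi> J x) Js)"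
    if "\<forall>J\<in>set Js. star_ideal star J" for Js x
    using that by (induction Js) (simp_all add: one star_prod_list_Cons hom del: cl_times_cl)
  have "star_radical_product star I" if I: "star_ideal star I" "I \<noteq> {0}" for I
  proof -
    obtain f where f: "f \<in> usc_compact ?T" "\<phi> I = (\<lambda>x. enat (f x))"
      using usc[OF I] by blast
    obtain n where n: "\<And>M. f M \<le> n"
      using usc_compact_bounded[OF f(1)] by blast
    have "\<exists>J. star_ideal star J \<and> \<phi> J = (\<lambda>x. if k \<le> f x then 1 else 0)" if k: "k \<ge> 1" for k
    proof (rule surj)
      have "(\<lambda>x. if k \<le> f x then 1 else 0) = (\<lambda>x. enat (if k \<le> f x then 1 else 0))"
        by (auto simp: zero_enat_def one_enat_def)
      then show "(\<lambda>x. if k \<le> f x then 1 else 0) \<in> carrier (usc_lattice ?T)"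
        using usc_compact_indicator[OF f(1) k] by (auto simp: usc_lattice_def)
    qed
    then obtain J where J: "\<And>k. k \<ge> 1 \<Longrightarrow> star_ideal star (J k)"
      "\<And>k. k \<ge> 1 \<Longrightarrow> \<phi> (J k) = (\<lambda>x. if k \<le> f x then 1 else 0)"
      by metis
    have rad: "star_radical_ideal star (J k)" if k: "k \<ge> 1" for k
    proof (rule radical_ideal_if_powers[OF J(1)[OF k]])
      fix x m assume xm: "x ^ m \<in> J k"
      \<comment> \<open>Where the function of \<open>x\<close> vanishes, so do those of all its
        powers. Thus a power of \<open>x\<close> in \<open>J k\<close> forces value at least 1 for
        \<open>x\<close> wherever \<open>J k\<close> has value 1.\<close>
      have zero: "\<phi> (star {x ^ l}) M = 0" if "\<phi> (star {x}) M = 0" for l M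
      proof (induction l)
        case 0
        then show ?case
          using one by simp
      next
        case (Suc l)
        have "star (star {x} * star {x ^ l}) = star {x ^ Suc l}"
          by (simp only: cl_times_cl) (simp add: set_times_def)
        then have "\<phi> (star {x ^ Suc l}) M = \<phi> (star {x}) M + \<phi> (star {x ^ l}) M"
          using hom[of "star {x}" "star {x ^ l}"] by simp
        then show ?case
          using Suc that by simp
      qed
      have "star {x ^ m} \<subseteq> J k"
        using xm J(1)[OF k] by (simp add: cl_subset_star_ideal)
      then have "\<phi> (J k) M \<le> \<phi> (star {x ^ m}) M" if "M \<in> topspace ?T" for M
        using ord[of "star {x ^ m}" "J k"] J(1)[OF k] that by simp
      then have "\<phi> (J k) M \<le> \<phi> (star {x}) M" if "M \<in> topspace ?T" for M
        using zero[of M m] that by (cases "\<phi> (star {x}) M = 0") (force simp: J(2)[OF k] one_eSuc ileI1)+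
      then have "star {x} \<subseteq> J k"
        using ord[of "star {x}" "J k"] J(1)[OF k] by simp
      then show "x \<in> J k"
        using in_cl by blast
    qed
    let ?Js = "map J [1..<Suc n]"
    have rads: "\<forall>K\<in>set ?Js. star_radical_ideal star K"
      using rad by auto
    then have "\<phi> (star_prod_list star ?Js) x = \<phi> I x" for x
    proof -
      have "\<phi> (star_prod_list star ?Js) x = sum_list (map (\<lambda>J. \<phi> J x) ?Js)"
        using rads by (intro prod) (simp add: star_radical_ideal_def)
      also have "map (\<lambda>J. \<phi> J x) ?Js = map (\<lambda>k. if k \<le> f x then 1 else 0) [1..<Suc n]"
        using J(2) by auto
      finally show ?thesis
        using f(2) n[of x] by (simp only: sum_list_indicators) (simp add: min_absorb1)
    qed
    then have "\<phi> I = \<phi> (star_prod_list star ?Js)"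
      by (intro ext) (rule sym)
    then have "I = star_prod_list star ?Js"
      by (rule inj[OF I(1) star_ideal_star_prod_list])
    then show ?thesis
      using rads unfolding star_radical_product_def by blast
  qed
  then show ?thesis
    using star_radical_product_zero unfolding star_SP_domain_def by metis
qed

lemma chain_of_three_primes:
  assumes P: "star_prime star P" "star_prime star M" "P \<noteq> {0}" "P \<subset> M"
  shows "\<not> star_dim star \<le> 1"
proof -
  have M0: "M \<noteq> {0}"
    using P star_idealD(1)[of P] by (auto simp: star_prime_def)
  let ?C = "{{0}, P, M}"
  have "0 \<in> P" "0 \<in> M"
    using P star_idealD(1) by (auto simp: star_prime_def)
  then have "finite ?C \<and> subset.chain {P. star_prime star P} ?C"
    using P star_prime_zero by (auto simp: subset_chain_def)
  then have "enat (card ?C) \<le> (SUP C\<in>{C. finite C \<and> subset.chain {P. star_prime star P} C}. enat (card C))"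
    by (intro SUP_upper) simp
  moreover have "card ?C = 3"
    using P M0 by (auto simp: card_insert_if)
  ultimately show ?thesis
    unfolding star_dim_def
    by (cases "SUP C\<in>{C. finite C \<and> subset.chain {P. star_prime star P} C}. enat (card C)")
      (auto simp: one_enat_def)
qed

end

section \<open>Dimension, compact hulls and the lattice isomorphism from condition (3)\<close>

context star_closure_dim_one
begin

lemma star_dim_le_1: "star_dim star \<le> 1"
proof -
  have "enat (card C) \<le> 2" if C: "finite C" "subset.chain {P. star_prime star P} C" for C
  proof -
    have "P = P'" if "P \<in> C - {{0}}" "P' \<in> C - {{0}}" for P P'
    proof -
      have max: "star_maximal star P" "star_maximal star P'"
        using that C(2) prime_maximal by (auto simp: subset_chain_def)
      have "P \<subseteq> P' \<or> P' \<subseteq> P"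
        using that C(2) by (auto simp: subset_chain_def)
      then show ?thesis
        using max by (auto simp: star_maximal_def)
    qed
    then have "card (C - {{0}}) \<le> 1"
      using C(1) by (intro card_le_Suc0_iff_eq[THEN iffD2, unfolded One_nat_def[symmetric]]) auto
    then have "card C \<le> 2"
      using C(1) by (cases "{0} \<in> C") (auto simp: card_Diff_singleton)
    then show ?thesis
      by (simp add: numeral_eq_enat)
  qed
  then have "(SUP C\<in>{C. finite C \<and> subset.chain {P. star_prime star P} C}. enat (card C)) \<le> 2"
    by (intro SUP_least) simp
  then show ?thesis
    unfolding star_dim_def
    by (cases "SUP C\<in>{C. finite C \<and> subset.chain {P. star_prime star P} C}. enat (card C)")
      (auto simp: one_enat_def numeral_eq_enat)
qed

lemma ex_chain_factorization_all:
  assumes I: "star_ideal star I"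
  shows "\<exists>Js. (\<forall>J\<in>set Js. star_radical_ideal star J) \<and> sorted_wrt (\<subseteq>) Js \<and> I = star_prod_list star Js"
proof (cases "I = {0}")
  case True
  then show ?thesis
    using star_radical_ideal_zero star_prod_list_single[of "{0}"] by (intro exI[of _ "[{0}]"]) auto
next
  case False
  then show ?thesis
    using ex_chain_factorization[OF I] by blast
qed

lemma star_SP_domain: "star_SP_domain star"
  unfolding star_SP_domain_def star_radical_product_def using ex_chain_factorization_all by blast

lemma ex1_chain_factorization:
  assumes I: "star_ideal star I" "I \<noteq> {0}"
  shows "\<exists>!Js. (\<forall>J\<in>set Js. star_radical_ideal star J \<and> J \<noteq> UNIV) \<and> sorted_wrt (\<subseteq>) Js \<and>
    I = star_prod_list star Js"
proof (rule ex_ex1I)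
  show "\<exists>Js. (\<forall>J\<in>set Js. star_radical_ideal star J \<and> J \<noteq> UNIV) \<and> sorted_wrt (\<subseteq>) Js \<and>
      I = star_prod_list star Js"
    by (rule ex_chain_factorization[OF I])
qed (use chain_factorization_unique I(2) in blast)

lemma radical_fin_gen:
  assumes "star_fin_gen star I"
  shows "star_fin_gen star (ideal_radical I)"
proof (cases "I = {0}")
  case True
  then show ?thesis
    using assms star_radical_ideal_zero by (simp add: star_radical_ideal_def)
next
  case False
  then show ?thesis
    using radical_invertible[OF assms] star_invertible_fin_gen by blast
qed

text \<open>Given an open cover, take the finitely generated ideals whose hull lies in one of its
  members. As \<open>A\<close> is nonzero, every prime above it is a point of the hull and contains
  such an ideal; a finite product of them inside \<open>A\<close> names a finite subcover.\<close>

lemma compactin_hull: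
  assumes A: "star_ideal star A" "A \<noteq> {0}"
  shows "compactin (star_max_inverse star) {M. star_maximal star M \<and> A \<subseteq> M}"
  unfolding compactin_def
proof (intro conjI allI impI)
  let ?H = "{M. star_maximal star M \<and> A \<subseteq> M}"
  show "?H \<subseteq> topspace (star_max_inverse star)"
    by (auto simp: topspace_star_max_inverse)
  fix \<U> assume U: "(\<forall>U\<in>\<U>. openin (star_max_inverse star) U) \<and> ?H \<subseteq> \<Union>\<U>"
  define \<F> where "\<F> = {F. star_fin_gen star F \<and> (\<exists>U\<in>\<U>. \<forall>N. star_maximal star N \<longrightarrow> F \<subseteq> N \<longrightarrow> N \<in> U)}"
  have "\<exists>Js. set Js \<subseteq> \<F> \<and> star_prod_list star Js \<subseteq> A"
  proof (rule product_of_prime_cover_subset[OF A(1)])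
    show "star_fin_gen star F" if "F \<in> \<F>" for F
      using that by (simp add: \<F>_def)
    show "\<exists>F\<in>\<F>. F \<subseteq> P" if P: "star_prime star P" "A \<subseteq> P" for P
    proof -
      have "P \<noteq> {0}"
        using P(2) A star_idealD(1) by blast
      then have "P \<in> ?H"
        using prime_maximal[OF P(1)] P(2) by blast
      then obtain U where "U \<in> \<U>" "P \<in> U"
        using U by blast
      then show ?thesis
        using openin_contains_hull[of U P] U unfolding \<F>_def by blast
    qed
  qed
  then obtain Js where Js: "set Js \<subseteq> \<F>" "star_prod_list star Js \<subseteq> A"
    by blast
  then have "\<forall>F\<in>set Js. \<exists>U\<in>\<U>. \<forall>N. star_maximal star N \<longrightarrow> F \<subseteq> N \<longrightarrow> N \<in> U"
    by (auto simp: \<F>_def)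
  then obtain u where u: "\<And>F. F \<in> set Js \<Longrightarrow> u F \<in> \<U>"
    "\<And>F N. F \<in> set Js \<Longrightarrow> star_maximal star N \<Longrightarrow> F \<subseteq> N \<Longrightarrow> N \<in> u F"
    by metis
  have "?H \<subseteq> \<Union>(u ` set Js)"
  proof
    fix M assume "M \<in> ?H"
    then have M: "star_maximal star M" "A \<subseteq> M"
      by auto
    then have "prime_ideal M" "star_prod_list star Js \<subseteq> M"
      using star_maximal_prime Js(2) by (auto simp: star_prime_def)
    then obtain F where "F \<in> set Js" "F \<subseteq> M"
      using prime_contains_factor by blast
    then show "M \<in> \<Union>(u ` set Js)"
      using u(2) M(1) by blast
  qed
  then show "\<exists>\<F>. finite \<F> \<and> \<F> \<subseteq> \<U> \<and> ?H \<subseteq> \<Union>\<F>"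
    using u(1) by (intro exI[of _ "u ` set Js"]) auto
qed

text \<open>After splitting off the radical \<open>k\<close> times, the remaining cofactor has as
  its hull the places where the value of \<open>I\<close> exceeds \<open>k\<close>. Compactness of
  hulls then makes the value function of \<open>I\<close> a member of
  \<open>usc_compact\<close>.\<close>

lemma le_val_iff_hull:
  assumes "star_ideal star I" "I \<noteq> {0}"
  shows "\<exists>A. star_ideal star A \<and> A \<noteq> {0} \<and> (\<forall>M. place M \<longrightarrow> (enat (Suc k) \<le> val M I \<longleftrightarrow> A \<subseteq> M))"
  using assms
proof (induction k arbitrary: I)
  case 0
  then show ?case
    using one_le_val_iff by (intro exI[of _ I]) (auto simp: one_enat_def)
next
  case (Suc k)
  obtain C where C: "star_ideal star C" "C \<noteq> {0}" "I \<subseteq> C"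
    "\<And>M. place M \<Longrightarrow> val M I = (if I \<subseteq> M then 1 else 0) + val M C"
    using split_off_radical[OF Suc.prems] by metis
  have "enat (Suc (Suc k)) \<le> val M I \<longleftrightarrow> enat (Suc k) \<le> val M C" if M: "place M" for M
  proof (cases "I \<subseteq> M")
    case True
    then show ?thesis
      using C(4)[OF M] by (cases "val M C") (auto simp: one_enat_def)
  next
    case False
    then have "\<not> C \<subseteq> M"
      using C(3) by blast
    then have "val M C = 0" "val M I = 0"
      using False one_le_val_iff[OF M, of C] one_le_val_iff[OF M, of I] by (simp_all add: not_le one_eSuc)
    then show ?thesis
      by (simp add: zero_enat_def)
  qed
  then show ?case
    using Suc.IH[OF C(1,2)] by simp
qed

lemma val_UNIV: "place M \<Longrightarrow> val M UNIV = 0"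
  using one_le_val_iff[of M UNIV] place_one[of M] by (auto simp: not_le one_eSuc)

lemma val_star_prod_list: "place M \<Longrightarrow> val M (star_prod_list star Js) = sum_list (map (val M) Js)"
  by (induction Js) (simp_all add: val_UNIV star_prod_list_Cons val_star val_times del: cl_times_cl)

lemma lattice_iso_if_not_field:
  assumes x: "x \<noteq> (0 :: 'a)" "\<not> x dvd 1"
  shows "(\<lambda>I M. if star_maximal star M then val M I else 0) \<in>
    mult_lattice_iso (star_ideal_lattice star) (usc_lattice (star_max_inverse star))"
proof -
  let ?T = "star_max_inverse star"
  \<comment> \<open>A nonzero nonunit keeps \<open>{0}\<close> from being maximal, so the points of
    the space are exactly the places.\<close>
  have not0: "\<not> star_maximal star {0}"
  proof
    assume "star_maximal star {0}"
    moreover have "star_ideal star (star {x})" "star {x} \<noteq> UNIV" "{0} \<subseteq> star {x}"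
      using x(2) in_star_singleton[of 1 x] by (auto simp: in_star_singleton)
    ultimately have "star {x} = {0}"
      unfolding star_maximal_def by blast
    then show False
      using x(1) in_cl[of x "{x}"] by auto
  qed
  then have place: "star_maximal star M \<longleftrightarrow> place M" for M
    by (auto simp: place_def)
  define \<phi> where "\<phi> I = (\<lambda>M. if place M then val M I else 0)" for I
  have top: "topspace ?T = {M. place M}"
    by (simp add: topspace_star_max_inverse place)
  \<comment> \<open>Without a point the bottom function would be the zero function;
    \<open>M0\<close> separates \<open>{0}\<close> from the nonzero ideals.\<close>
  obtain M0 where M0: "place M0"
  proof -
    have "{0} \<noteq> (UNIV :: 'a set)"
      using x(1) by blast
    then show ?thesis
      using ex_star_maximal[OF star_ideal_zero] place that by blast
  qed
  have zero: "\<phi> {0} = usc_bottom ?T"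
    by (auto simp: \<phi>_def usc_bottom_def top val_zero)
  have finite: "\<phi> I M \<noteq> \<infinity>" if "star_ideal star I" "I \<noteq> {0}" for I M
    using val_finite[of M I] star_ideal_nonzero_not_subset[OF that]
    by (simp add: \<phi>_def del: not_infinity_eq)
  have usc: "\<phi> I \<in> (\<lambda>f x. enat (f x)) ` usc_compact ?T" if I: "star_ideal star I" "I \<noteq> {0}" for I
  proof
    let ?f = "\<lambda>M. the_enat (\<phi> I M)"
    show eq: "\<phi> I = (\<lambda>M. enat (?f M))"
    proof
      show "\<phi> I M = enat (?f M)" for M
        using finite[OF I, of M] by auto
    qed
    have "compactin ?T {M \<in> topspace ?T. k \<le> ?f M}" if k: "k \<ge> 1" for k
    proof -
      obtain A where A: "star_ideal star A" "A \<noteq> {0}"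
        "\<And>M. place M \<Longrightarrow> enat k \<le> val M I \<longleftrightarrow> A \<subseteq> M"
        using le_val_iff_hull[OF I, of "k - 1"] k by auto
      have "k \<le> ?f M \<longleftrightarrow> A \<subseteq> M" if M: "place M" for M
      proof -
        have "val M I = enat (?f M)"
          using fun_cong[OF eq, of M] M by (simp add: \<phi>_def)
        then show ?thesis
          using A(3)[OF M] by simp
      qed
      then have "{M \<in> topspace ?T. k \<le> ?f M} = {M. star_maximal star M \<and> A \<subseteq> M}"
        by (auto simp: top place)
      then show ?thesis
        using compactin_hull[OF A(1,2)] by simp
    qed
    then show "?f \<in> usc_compact ?T"
      by (auto simp: usc_compact_def top \<phi>_def zero_enat_def)
  qed
  have hom: "\<phi> (star (I * J)) = (\<lambda>M. \<phi> I M + \<phi> J M)" for I J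
    by (auto simp: \<phi>_def val_star val_times)
  have ord: "I \<subseteq> J \<longleftrightarrow> (\<forall>M\<in>topspace ?T. \<phi> J M \<le> \<phi> I M)" if IJ: "star_ideal star I" "star_ideal star J" for I J
  proof (cases "J = {0}")
    case True
    show ?thesis
    proof
      assume "I \<subseteq> J"
      then show "\<forall>M\<in>topspace ?T. \<phi> J M \<le> \<phi> I M"
        by (auto simp: \<phi>_def top val_antimono)
    next
      assume "\<forall>M\<in>topspace ?T. \<phi> J M \<le> \<phi> I M"
      then have "\<phi> I M0 = \<infinity>"
        using M0 True zero by (auto simp: top usc_bottom_def)
      then show "I \<subseteq> J"
        using finite[OF IJ(1), of M0] True by blast
    qed
  next
    case False
    then show ?thesis
      using subset_iff_val[OF IJ False] by (simp add: \<phi>_def top)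
  qed
  have inj: "I = J" if IJ: "star_ideal star I" "star_ideal star J" "\<phi> I = \<phi> J" for I J
    using ord[OF IJ(1,2)] ord[OF IJ(2,1)] IJ(3) by auto
  have surj: "\<exists>I. star_ideal star I \<and> \<phi> I = (\<lambda>x. enat (f x))" if f: "f \<in> usc_compact ?T" for f
  proof -
    obtain n where n: "\<And>M. f M \<le> n"
      using usc_compact_bounded[OF f] by blast
    \<comment> \<open>The kernel is a nonzero radical ideal whose hull is the set where
      \<open>f\<close> is at least \<open>k\<close>, so its values form the indicator of that set;
      the product of the kernels then has value \<open>f\<close>.\<close>
    have val: "val M (level_kernel f k) = (if k \<le> f M then 1 else 0)" if k: "k \<ge> 1" and M: "place M" for k M
    proof -
      let ?A = "level_kernel f k"
      have "star_radical_ideal star ?A"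
      proof (rule radical_ideal_if_powers[OF star_ideal_level_kernel])
        show "x ^ n \<in> ?A \<Longrightarrow> x \<in> ?A" for x n
          using place_power by (auto simp: level_kernel_def place)
      qed
      moreover have "?A \<noteq> {0}"
      proof -
        \<comment> \<open>Compactness is applied with the prime \<open>{0}\<close>: it contains no
          place, hence not their intersection either.\<close>
        have "\<not> ?A \<subseteq> {0}"
          unfolding level_kernel_def
        proof (rule compact_Inter_not_subset[OF usc_compact_level[OF f k]])
          show "prime_ideal ({0} :: 'a set)"
            using star_prime_zero by (simp add: star_prime_def)
          show "\<not> M \<subseteq> {0}" if "M \<in> {M. star_maximal star M \<and> k \<le> f M}" for M
          proof -
            have "place M"
              using that place by simp
            then show ?thesis
              using star_ideal_nonzero_not_subset[OF place_star_ideal] by (simp add: place_def)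
          qed
        qed
        then show ?thesis
          by auto
      qed
      ultimately show ?thesis
        using val_radical[OF M] level_kernel_subset_iff[OF f k] M place by simp
    qed
    let ?I = "star_prod_list star (map (level_kernel f) [1..<Suc n])"
    have "\<phi> ?I M = enat (f M)" for M
    proof (cases "place M")
      case True
      have "val M ?I = sum_list (map (\<lambda>k. if k \<le> f M then 1 else 0) [1..<Suc n])"
        unfolding val_star_prod_list[OF True] map_map using val[OF _ True]
        by (intro arg_cong[of _ _ sum_list] map_cong) auto
      then show ?thesis
        using True n[of M] by (simp only: sum_list_indicators) (simp add: \<phi>_def min_absorb1)
    next
      case False
      then show ?thesis
        using f by (simp add: \<phi>_def usc_compact_def top zero_enat_def)
    qed
    then show ?thesis
      by (intro exI[of _ ?I]) auto
  qed
  have bij: "bij_betw \<phi> {I. star_ideal star I} (insert (usc_bottom ?T) ((\<lambda>f x. enat (f x)) ` usc_compact ?T))"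
  proof (rule bij_betwI')
    show "(\<phi> I = \<phi> J) = (I = J)" if "I \<in> {I. star_ideal star I}" "J \<in> {I. star_ideal star I}" for I J
      using that inj by blast
    show "\<phi> I \<in> insert (usc_bottom ?T) ((\<lambda>f x. enat (f x)) ` usc_compact ?T)"
      if "I \<in> {I. star_ideal star I}" for I
      using that zero usc by (cases "I = {0}") auto
    show "\<exists>I\<in>{I. star_ideal star I}. g = \<phi> I"
      if "g \<in> insert (usc_bottom ?T) ((\<lambda>f x. enat (f x)) ` usc_compact ?T)" for g
      using that
    proof
      assume "g = usc_bottom ?T"
      then show ?thesis
        using zero star_ideal_zero by (intro bexI[of _ "{0}"]) auto
    next
      assume "g \<in> (\<lambda>f x. enat (f x)) ` usc_compact ?T"
      then show ?thesis
        using surj by force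
    qed
  qed
  have "\<phi> UNIV = (\<lambda>M. 0)"
    by (auto simp: \<phi>_def val_UNIV)
  then have "\<phi> \<in> mult_lattice_iso (star_ideal_lattice star) (usc_lattice ?T)"
    using bij ord hom bij_betwE[OF bij]
    by (auto simp: mult_lattice_iso_def iso_def hom_def star_ideal_lattice_def usc_lattice_def)
  then show ?thesis
    by (simp only: \<phi>_def[abs_def] place)
qed

end

section \<open>The equivalence of the seven conditions\<close>

theorem corollary8p6:
  fixes star :: "'a::idom set \<Rightarrow> 'a set"
  assumes "star_operation star"
    and "star_modular star"
    and "star_finite_type star"
  shows
    "(star_SP_domain star \<longleftrightarrow>
        star_dim star \<le> 1 \<and>
        (\<forall>I. star_invertible star I \<longrightarrow> star_radical_product star I)) \<and>
     (star_SP_domain star \<longleftrightarrow>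
        (\<forall>P. star_prime star P \<and> P \<noteq> {0} \<longrightarrow>
           star_maximal star P \<and>
           (\<exists>J\<subseteq>P. star_invertible star J \<and> star_radical_ideal star J))) \<and>
     (star_SP_domain star \<longleftrightarrow>
        (\<forall>I. star_ideal star I \<longrightarrow>
           (\<exists>Js. (\<forall>J\<in>set Js. star_radical_ideal star J) \<and> sorted_wrt (\<subseteq>) Js \<and>
                 I = star_prod_list star Js)) \<and>
        (\<forall>I. star_ideal star I \<and> I \<noteq> {0} \<longrightarrow>
           (\<exists>!Js. (\<forall>J\<in>set Js. star_radical_ideal star J \<and> J \<noteq> UNIV) \<and> sorted_wrt (\<subseteq>) Js \<and>
                  I = star_prod_list star Js))) \<and>
     (star_SP_domain star \<longleftrightarrow>
        (\<forall>I. star_fin_gen star I \<and> I \<noteq> {0} \<longrightarrow> star_invertible star (ideal_radical I))) \<and>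
     ((\<exists>x::'a. x \<noteq> 0 \<and> \<not> x dvd 1) \<longrightarrow>
        (star_SP_domain star \<longleftrightarrow>
           mult_lattice_iso (star_ideal_lattice star) (usc_lattice (star_max_inverse star)) \<noteq> {})) \<and>
     (star_SP_domain star \<longleftrightarrow>
        PstarMD star \<and>
        (\<forall>I. star_fin_gen star I \<longrightarrow> star_fin_gen star (ideal_radical I)))"
    (is "(?SP \<longleftrightarrow> ?dim \<and> ?inv) \<and> (?SP \<longleftrightarrow> ?prime) \<and> (?SP \<longleftrightarrow> ?chain \<and> ?unique) \<and>
      (?SP \<longleftrightarrow> ?rad) \<and> (?nonfield \<longrightarrow> (?SP \<longleftrightarrow> ?iso)) \<and> (?SP \<longleftrightarrow> PstarMD star \<and> ?fg)")
proof -
  interpret star_closure star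
    using assms(1,3) by (rule star_closureI)
  have contains: "\<exists>J\<subseteq>P. star_invertible star J \<and> star_radical_ideal star J"
    if inv: ?inv and P: "star_prime star P" "P \<noteq> {0}" for P
  proof -
    obtain x where "x \<in> P" "x \<noteq> 0"
      using nonzero_star_ideal P by (auto simp: star_prime_def)
    then show ?thesis
      using prime_contains_invertible_radical[OF P(1)] inv star_invertible_singleton by blast
  qed
  have SP_prime: ?prime if ?SP
    using that contains SP_imp_prime_maximal[OF assms(2)]
    by (auto simp: star_SP_domain_def star_invertible_def)
  have dim_prime: ?prime if "?dim \<and> ?inv"
  proof (intro allI impI conjI)
    fix P assume P: "star_prime star P \<and> P \<noteq> {0}"
    then obtain M where "star_maximal star M" "star_prime star M" "P \<subseteq> M"
      using ex_star_maximal[of P] by (auto simp: star_prime_def prime_ideal_def)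
    then show "star_maximal star P"
      using chain_of_three_primes[of P M] P that by blast
    show "\<exists>J\<subseteq>P. star_invertible star J \<and> star_radical_ideal star J"
      using contains that P by blast
  qed
  have rad_prime: ?prime if rad: ?rad
  proof (intro allI impI conjI)
    fix P assume P: "star_prime star P \<and> P \<noteq> {0}"
    show "star_maximal star P"
      using prime_maximal_if_radicals_invertible rad P by blast
    obtain x where x: "x \<in> P" "x \<noteq> 0"
      using nonzero_star_ideal P by (auto simp: star_prime_def)
    have "star {x} \<subseteq> P"
      using x(1) P by (simp add: star_prime_def cl_subset_star_ideal)
    then have "ideal_radical (star {x}) \<subseteq> P"
      using radical_subset_prime P by blast
    moreover have "star_invertible star (ideal_radical (star {x}))"
      using rad x(2) star_fin_gen_cl[of "{x}"] in_cl[of x "{x}"] by blast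
    ultimately show "\<exists>J\<subseteq>P. star_invertible star J \<and> star_radical_ideal star J"
      using star_radical_ideal_radical[OF star_ideal_cl, of "{x}"]
      by (intro exI[of _ "ideal_radical (star {x})"] conjI)
  qed
  have fg_rad: ?rad if fg: "PstarMD star \<and> ?fg"
  proof (intro allI impI)
    fix I assume I: "star_fin_gen star I \<and> I \<noteq> {0}"
    have "ideal_radical I \<noteq> {0}"
      using I subset_radical[of I] star_idealD(1)[of I] by (auto simp: star_fin_gen_def)
    then show "star_invertible star (ideal_radical I)"
      using fg I by (simp add: PstarMD_def)
  qed
  have prime_all: "?SP \<and> (?dim \<and> ?inv) \<and> (?chain \<and> ?unique) \<and> ?rad \<and> (?nonfield \<longrightarrow> ?iso) \<and> (PstarMD star \<and> ?fg)"
    if prime: ?prime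
  proof -
    interpret star_closure_dim_one star
      using prime by unfold_locales blast+
    have ?inv
      using star_SP_domain by (simp add: star_SP_domain_def star_invertible_def)
    moreover have "PstarMD star"
      using fin_gen_star_invertible by (simp add: PstarMD_def)
    moreover have "?nonfield \<longrightarrow> ?iso"
      using lattice_iso_if_not_field by blast
    moreover have ?chain
      using ex_chain_factorization_all by simp
    moreover have ?unique
      by (intro allI impI ex1_chain_factorization) auto
    moreover have ?rad
      using radical_invertible by simp
    moreover have ?fg
      using radical_fin_gen by simp
    ultimately show ?thesis
      using star_SP_domain star_dim_le_1 by (intro conjI)
  qed
  have chain_SP: ?SP if ?chain
    using that unfolding star_SP_domain_def star_radical_product_def by blast
  have iso_SP: ?SP if ?iso
    using that SP_if_lattice_iso by auto
  \<comment> \<open>What remains is propositional: (1), (2) and (5) give (3), (7) gives (5), the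
    existence part of (4) and the isomorphism in (6) give (1), and (3) gives all the others, with
    (6) for non-fields.\<close>
  have equivalences: "(SP \<longleftrightarrow> dm \<and> ip) \<and> (SP \<longleftrightarrow> prm) \<and> (SP \<longleftrightarrow> chain \<and> unique) \<and> (SP \<longleftrightarrow> rad) \<and>
      (nonfield \<longrightarrow> (SP \<longleftrightarrow> iso)) \<and> (SP \<longleftrightarrow> PMD \<and> fg)"
    if "SP \<Longrightarrow> prm" "dm \<and> ip \<Longrightarrow> prm" "rad \<Longrightarrow> prm" "PMD \<and> fg \<Longrightarrow> rad"
      "prm \<Longrightarrow> SP \<and> (dm \<and> ip) \<and> (chain \<and> unique) \<and> rad \<and> (nonfield \<longrightarrow> iso) \<and> (PMD \<and> fg)"
      "chain \<Longrightarrow> SP" "iso \<Longrightarrow> SP"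
    for SP dm ip prm chain unique rad nonfield iso PMD fg :: bool
    using that by blast
  show ?thesis
    by (rule equivalences[OF SP_prime dim_prime rad_prime fg_rad prime_all chain_SP iso_SP])
qed

end
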